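(* There exists an infinite totally real Galois extension $L/\mathbb{Q}$ (with $L\subseteq\overline{\mathbb{Q}}$) such that $\mathfrak{S}(L)=+\infty$ and $\mathfrak{S}(L(i))<\infty$, where $i=\sqrt{-1}$. In particular, property $(\mathfrak{S})$ is not preserved under finite extensions: there is a field $L$ with property $(\mathfrak{S})$ and a finite extension $F/L$ with $F/\mathbb{Q}$ Galois such that $F$ does not have property $(\mathfrak{S})$.
   Context: $\overline{\mathbb{Q}}$ is a fixed algebraic closure of $\mathbb{Q}$ and $\mathcal{P}$ is the set of rational primes. For a (possibly infinite) Galois extension $L/\mathbb{Q}$ inside $\overline{\mathbb{Q}}$ and a prime $p$, let $e_p(L)$ and $f_p(L)$ be the (possibly infinite) ramification index and inertia (residue) degree of $L/\mathbb{Q}$ at $p$; since $L/\mathbb{Q}$ is Galois these depend only on $p$. Set $$\mathfrak{S}_p(L)=\frac{\log p}{e_p(L)\,(p^{f_p(L)}+1)},$$ with the convention $\mathfrak{S}_p(L)=0$ if $L$ cannot be embedded in a finite extension of $\mathbb{Q}_p$ (i.e. if $e_p(L)$ or $f_p(L)$ is infinite). Put $\mathfrak{S}(L)=\sum_{p\in\mathcal{P}}\mathfrak{S}_p(L)\in[0,+\infty]$. A field $L\subseteq\overline{\mathbb{Q}}$ has property $(\mathfrak{S})$ if $L/\mathbb{Q}$ is Galois and $\mathfrak{S}(L)=+\infty$. *)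

theory Defs
  imports
    "HOL-Algebra.Algebraic_Closure_Type"
    "HOL-Algebra.Ideal_Product"
    "HOL-Algebra.QuotRing"
    "HOL-Algebra.Generated_Fields"
    "HOL-Analysis.Analysis"
begin

text \<open>
  The algebraic closure of the rationals is taken to be the field of algebraic complex numbers.
  A subfield of it is a set of complex numbers, and the notions of HOL-Algebra are applied to
  it inside the ring \<open>CC\<close> of all complex numbers.
\<close>

abbreviation CC :: "complex ring" where
  "CC \<equiv> ring_of_type_algebra"

abbreviation Qbar :: "complex set" where
  "Qbar \<equiv> {z. Polynomial.algebraic z}"

definition finite_extension :: "complex set \<Rightarrow> complex set \<Rightarrow> bool" where
  "finite_extension K L \<longleftrightarrow>
     subfield K CC \<and> subfield L CC \<and> K \<subseteq> L \<and> ring.finite_dimension CC K L"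

text \<open>
  Algebraic and normal over the rationals; separability is automatic in characteristic zero.
  As the complex numbers are algebraically closed, a polynomial splits in \<open>L\<close> iff all
  its complex roots lie in \<open>L\<close>.
\<close>

definition galois_over_rat :: "complex set \<Rightarrow> bool" where
  "galois_over_rat L \<longleftrightarrow>
     subfield L CC \<and> L \<subseteq> Qbar \<and>
     (\<forall>q :: rat poly. Factorial_Ring.irreducible q \<longrightarrow>
        (\<exists>x\<in>L. poly (map_poly of_rat q) x = 0) \<longrightarrow>
        (\<forall>z. poly (map_poly of_rat q) z = 0 \<longrightarrow> z \<in> L))"

definition totally_real :: "complex set \<Rightarrow> bool" where
  "totally_real L \<longleftrightarrow> (\<forall>\<sigma> \<in> ring_hom (CC\<lparr>carrier := L\<rparr>) CC. \<sigma> ` L \<subseteq> \<real>)"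

definition int_ring :: "complex set \<Rightarrow> complex ring" where
  "int_ring L = CC\<lparr>carrier := {x \<in> L. algebraic_int x}\<rparr>"

definition prime_above :: "nat \<Rightarrow> complex set \<Rightarrow> complex set \<Rightarrow> bool" where
  "prime_above p L P \<longleftrightarrow>
     primeideal P (int_ring L) \<and> P \<inter> \<int> = (\<lambda>k. of_nat p * k) ` \<int>"

definition ideal_power :: "complex ring \<Rightarrow> complex set \<Rightarrow> nat \<Rightarrow> complex set" where
  "ideal_power R P n = (ideal_prod R P ^^ n) (carrier R)"

text \<open>
  For a number field \<open>K\<close>, the exponent of the prime \<open>P\<close> in the factorization of the ideal
  generated by \<open>p\<close>, i.e. the largest \<open>n\<close> such that \<open>P\<close> to the power \<open>n\<close> divides (contains) it.
\<close>

definition ramification_index_finite :: "nat \<Rightarrow> complex set \<Rightarrow> complex set \<Rightarrow> enat" where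
  "ramification_index_finite p K P =
     Sup {enat n | n. cgenideal (int_ring K) (of_nat p) \<subseteq> ideal_power (int_ring K) P n}"

text \<open>
  Rings of integers of infinite extensions are not Dedekind, so the ramification index there is
  the supremum of those of the finite subextensions. The intersection of \<open>P\<close> with \<open>K\<close> is the
  prime of \<open>K\<close> below \<open>P\<close>.
\<close>

definition ramification_index :: "nat \<Rightarrow> complex set \<Rightarrow> complex set \<Rightarrow> enat" where
  "ramification_index p L P =
     (SUP K \<in> {K. finite_extension \<rat> K \<and> K \<subseteq> L}. ramification_index_finite p K (P \<inter> K))"

text \<open>
  The image of the integers in the residue field at a prime above \<open>p\<close> is the field with \<open>p\<close>
  elements.
\<close>

definition residue_degree :: "complex set \<Rightarrow> complex set \<Rightarrow> enat" where
  "residue_degree L P =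
     (let k = int_ring L Quot P; F = (\<lambda>n. P +>\<^bsub>int_ring L\<^esub> n) ` \<int>
      in if ring.finite_dimension k F (carrier k) then enat (ring.dim k F (carrier k)) else \<infinity>)"

text \<open>
  For Galois \<open>L\<close> all primes above \<open>p\<close> are conjugate, so the following values do not depend on the
  choice of the prime.
\<close>

definition chosen_prime :: "nat \<Rightarrow> complex set \<Rightarrow> complex set" where
  "chosen_prime p L = (SOME P. prime_above p L P)"

definition e_at :: "nat \<Rightarrow> complex set \<Rightarrow> enat" where
  "e_at p L = ramification_index p L (chosen_prime p L)"

definition f_at :: "nat \<Rightarrow> complex set \<Rightarrow> enat" where
  "f_at p L = residue_degree L (chosen_prime p L)"

definition S_at :: "nat \<Rightarrow> complex set \<Rightarrow> real" where
  "S_at p L =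
     (if e_at p L = \<infinity> \<or> f_at p L = \<infinity> then 0
      else ln (real p) / (real (the_enat (e_at p L)) * (real p ^ the_enat (f_at p L) + 1)))"

definition S_sum :: "complex set \<Rightarrow> ennreal" where
  "S_sum L = (\<Sum>\<^sub>\<infinity>p\<in>{p. prime p}. ennreal (S_at p L))"

definition property_S :: "complex set \<Rightarrow> bool" where
  "property_S L \<longleftrightarrow> galois_over_rat L \<and> S_sum L = \<infinity>"

end

theory Submission
  imports Defs "HOL-Number_Theory.Number_Theory" "Jordan_Normal_Form.Char_Poly"
begin

text \<open>
  \<open>L\<close> is generated by square roots of positive odd integers \<open>d\<^sub>0, d\<^sub>1, \<dots>\<close> chosen one after the other.
  Primes \<open>p \<equiv> 3 (mod 4)\<close> have even residue degree in \<open>L(i)\<close>, as \<open>-1\<close> is not a square modulo \<open>p\<close>, and every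
  prime \<open>p \<equiv> 1 (mod 4)\<close> is made inert in some \<open>\<rat>(\<surd>d\<^sub>k)\<close>; hence the terms of \<open>S(L(i))\<close> are at most
  \<open>log p / p\<^sup>2\<close> for odd \<open>p\<close>. On the other hand the primes \<open>p \<equiv> 3 (mod 4)\<close> that split completely in
  \<open>\<rat>(\<surd>d\<^sub>0, \<dots>, \<surd>d\<^sub>k\<^sub>-\<^sub>1)\<close> have positive density, so that finitely many of them contribute at least
  \<open>1\<close> to \<open>S\<close>; by the Chinese remainder theorem \<open>d\<^sub>k\<close> and all later radicands can be taken to be squares modulo
  these, and \<open>d\<^sub>k\<close> a non-square modulo one further such prime, whence \<open>\<surd>d\<^sub>k\<close> is not in
  the previous field and \<open>L\<close> is infinite.

  The density statement needs \<open>\<Sum> \<kappa>(p) log p / p = O(1)\<close> only for the quadratic characters \<open>\<kappa>\<close> of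
  \<open>\<rat>(\<surd>\<plusminus>d)\<close>, for products \<open>d\<close> of radicands. This follows by the methods of Mertens and Shapiro from
  \<open>L(1, \<kappa>) \<noteq> 0\<close>, which is proved by Monsky's argument.
\<close>

section \<open>Quadratic characters\<close>

text \<open>The construction rests on separating the odd primes modulo 4. A prime that is 3 modulo 4
  is spoilt by i alone, so such primes are free to carry the divergence of the sum for
  \<open>L\<close>. The two demands on a radicand concern different primes and never conflict. Split
  primes are counted by the weight (1 - (-1/p)) * prod (1 + (d/p)); expanded into characters, only
  the trivial one yields a main term. The radicands are merely integers in prescribed residue
  classes, so no theorem on primes in progressions is used to find them; reciprocity enters through
  their prime factors. On the algebraic side no decomposition theory of infinite extensions is
  developed. At split primes e = f = 1 is read off from congruences to rational integers; at the
  others f \<ge> 2 is enough whatever e is, because a larger e only shrinks the term.\<close>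

lemma Legendre_values: "Legendre a p \<in> {-1, 0, 1}"
  unfolding Legendre_def by simp

lemma Legendre_cong: "[a = b] (mod p) \<Longrightarrow> Legendre a p = Legendre b p"
  by (simp add: Legendre_def QuadRes_def Cong.cong_def)

text \<open>Two elements of {-1, 0, 1} differ by at most 2 < p, so a congruence between them is an
  equality. Together with Euler's criterion this determines the symbol, and it yields
  multiplicativity and the value at -1.\<close>

lemma Legendre_eqI:
  assumes "prime p" "2 < p" "x \<in> {-1, 0, 1}" "[x = a ^ ((p - 1) div 2)] (mod int p)"
  shows "Legendre a (int p) = x"
proof -
  have "[Legendre a (int p) = x] (mod int p)"
    using euler_criterion[OF assms(1,2), of a] assms(4) cong_sym cong_trans by blast
  then have dvd: "int p dvd Legendre a (int p) - x"
    by (simp add: cong_iff_dvd_diff)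
  have "-1 \<le> Legendre a (int p)" "Legendre a (int p) \<le> 1" "-1 \<le> x" "x \<le> 1"
    using assms(3) Legendre_values[of a "int p"] by auto
  then have "\<bar>Legendre a (int p) - x\<bar> < \<bar>int p\<bar>"
    using assms(2) by linarith
  then have "Legendre a (int p) - x = 0"
    using dvd_imp_le_int[OF _ dvd] by linarith
  then show ?thesis by simp
qed

lemma Legendre_mult:
  assumes "prime p" "2 < p"
  shows "Legendre (a * b) (int p) = Legendre a (int p) * Legendre b (int p)"
proof (rule Legendre_eqI[OF assms])
  show "Legendre a (int p) * Legendre b (int p) \<in> {-1, 0, 1}"
    using Legendre_values[of a "int p"] Legendre_values[of b "int p"] by auto
  show "[Legendre a (int p) * Legendre b (int p) = (a * b) ^ ((p - 1) div 2)] (mod int p)"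
    unfolding power_mult_distrib
    by (intro cong_mult euler_criterion assms)
qed

lemma Legendre_1: "prime p \<Longrightarrow> 2 < p \<Longrightarrow> Legendre 1 (int p) = 1"
  by (rule Legendre_eqI) auto

lemma Legendre_prod:
  assumes "prime p" "2 < p"
  shows "Legendre (\<Prod>x\<in>S. f x) (int p) = (\<Prod>x\<in>S. Legendre (f x) (int p))"
  by (induction S rule: infinite_finite_induct) (simp_all add: Legendre_1 Legendre_mult assms)

lemma Legendre_eq_0_iff: "Legendre a p = 0 \<longleftrightarrow> p dvd a"
  by (auto simp: Legendre_def cong_0_iff)

definition chi4 :: "nat \<Rightarrow> int" where
  "chi4 n = (if n mod 4 = 1 then 1 else if n mod 4 = 3 then -1 else 0)"

lemma mod4_cases: "(n::nat) mod 4 = 0 \<or> n mod 4 = 1 \<or> n mod 4 = 2 \<or> n mod 4 = 3"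
  by linarith

lemma chi4_mult: "chi4 (m * n) = chi4 m * chi4 n"
proof -
  have "m * n mod 4 = (m mod 4) * (n mod 4) mod 4" by (rule mod_mult_eq[symmetric])
  then show ?thesis
    using mod4_cases[of m] mod4_cases[of n] by (elim disjE) (simp_all only: chi4_def, simp_all)
qed

lemma chi4_odd: "odd n \<Longrightarrow> chi4 n = (-1) ^ ((n - 1) div 2)"
proof -
  assume "odd n"
  then obtain k where k: "n = 2 * k + 1" by (elim oddE)
  show ?thesis
  proof (cases "even k")
    case True
    then obtain j where "k = 2 * j" by (elim evenE)
    then have "n mod 4 = 1" using k by presburger
    then show ?thesis using True k by (simp add: chi4_def)
  next
    case False
    then obtain j where "k = 2 * j + 1" by (elim oddE)
    then have "n mod 4 = 3" using k by presburger
    then show ?thesis using False k by (simp add: chi4_def)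
  qed
qed

lemma Legendre_minus_1:
  assumes "prime p" "2 < p"
  shows "Legendre (-1) (int p) = chi4 p"
proof (rule Legendre_eqI[OF assms])
  show "chi4 p \<in> {-1, 0, 1}" by (simp add: chi4_def)
  have "odd p" using assms prime_odd_nat by auto
  then show "[chi4 p = (- 1) ^ ((p - 1) div 2)] (mod int p)"
    by (simp add: chi4_odd)
qed

text \<open>This packages quadratic reciprocity: p \<mapsto> (m/p) extends to a periodic, completely
  multiplicative function. \<open>M\<close> is any period, not the conductor, and the value at 2 is
  left open. The coprimality clause makes every argument with a nonzero value invertible modulo
  \<open>M\<close>.\<close>

definition is_quadratic_character :: "int \<Rightarrow> (nat \<Rightarrow> int) \<Rightarrow> nat \<Rightarrow> bool" where
  "is_quadratic_character m \<kappa> M \<longleftrightarrow>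
     M > 0 \<and> \<kappa> 1 = 1 \<and> (\<forall>a b. \<kappa> (a * b) = \<kappa> a * \<kappa> b) \<and> (\<forall>a. \<kappa> (a + M) = \<kappa> a) \<and>
     (\<forall>a. \<kappa> a \<in> {-1, 0, 1}) \<and> (\<forall>a. \<kappa> a \<noteq> 0 \<longrightarrow> coprime a M) \<and>
     (\<forall>p. prime p \<longrightarrow> odd p \<longrightarrow> \<kappa> p = Legendre m (int p))"

lemma is_quadratic_characterD:
  assumes "is_quadratic_character m \<kappa> M"
  shows "M > 0" "\<kappa> 1 = 1" "\<And>a b. \<kappa> (a * b) = \<kappa> a * \<kappa> b" "\<And>a. \<kappa> (a + M) = \<kappa> a"
    "\<And>a. \<kappa> a \<in> {-1, 0, 1}" "\<And>a. \<kappa> a \<noteq> 0 \<Longrightarrow> coprime a M"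
    "\<And>p. prime p \<Longrightarrow> odd p \<Longrightarrow> \<kappa> p = Legendre m (int p)"
  using assms unfolding is_quadratic_character_def by blast+

lemma periodic_mult:
  fixes \<kappa> :: "nat \<Rightarrow> int"
  assumes "\<And>a. \<kappa> (a + M) = \<kappa> a"
  shows "\<kappa> (a + k * M) = \<kappa> a"
proof (induction k)
  case (Suc k)
  have "\<kappa> (a + Suc k * M) = \<kappa> (a + k * M + M)" by (simp add: algebra_simps)
  then show ?case using Suc assms by simp
qed simp

lemma prime_odd_gt_2: "prime p \<Longrightarrow> odd p \<Longrightarrow> 2 < (p::nat)"
  using prime_gt_1_nat[of p] by (cases "p = 2") auto

lemma is_quadratic_character_mult:
  assumes chi: "is_quadratic_character m \<kappa> M" and psi: "is_quadratic_character n \<psi> N"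
  shows "is_quadratic_character (m * n) (\<lambda>a. \<kappa> a * \<psi> a) (M * N)"
  unfolding is_quadratic_character_def
proof (intro conjI allI impI)
  note C = is_quadratic_characterD[OF chi] and P = is_quadratic_characterD[OF psi]
  show "M * N > 0" using C(1) P(1) by simp
  show "\<kappa> 1 * \<psi> 1 = 1" unfolding C(2) P(2) by simp
  show "\<kappa> (a * b) * \<psi> (a * b) = \<kappa> a * \<psi> a * (\<kappa> b * \<psi> b)" for a b
    unfolding C(3) P(3) by simp
  show "\<kappa> (a + M * N) * \<psi> (a + M * N) = \<kappa> a * \<psi> a" for a
    using periodic_mult[of \<kappa> M a N, OF C(4)] periodic_mult[of \<psi> N a M, OF P(4)]
    by (simp add: mult.commute)
  show "\<kappa> a * \<psi> a \<in> {-1, 0, 1}" for a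
    using C(5)[of a] P(5)[of a] by auto
  show "coprime a (M * N)" if "\<kappa> a * \<psi> a \<noteq> 0" for a
    using that C(6)[of a] P(6)[of a] by simp
  show "\<kappa> p * \<psi> p = Legendre (m * n) (int p)" if "prime p" "odd p" for p
    using C(7)[OF that] P(7)[OF that] Legendre_mult[OF that(1) prime_odd_gt_2[OF that]] by simp
qed

lemma is_quadratic_character_1: "is_quadratic_character 1 (\<lambda>_. 1) 1"
  unfolding is_quadratic_character_def by (simp add: Legendre_1 prime_odd_gt_2)

lemma coprime_4_iff: "coprime a 4 \<longleftrightarrow> odd (a::nat)"
proof -
  have "coprime a (2 ^ 2) \<longleftrightarrow> coprime a 2"
    by (rule coprime_power_right_iff[of a 2 2, THEN trans]) simp
  then show ?thesis by (simp add: coprime_right_2_iff_odd)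
qed

lemma is_quadratic_character_minus_1: "is_quadratic_character (-1) chi4 4"
  unfolding is_quadratic_character_def
proof (intro conjI allI impI)
  show "coprime a 4" if "chi4 a \<noteq> 0" for a
  proof -
    have "a mod 4 = 1 \<or> a mod 4 = 3"
      using that by (simp add: chi4_def split: if_splits)
    then show ?thesis unfolding coprime_4_iff by presburger
  qed
  show "chi4 (a * b) = chi4 a * chi4 b" for a b by (rule chi4_mult)
  show "chi4 p = Legendre (-1) (int p)" if "prime p" "odd p" for p
    using that by (simp add: Legendre_minus_1 prime_odd_gt_2)
  show "chi4 a \<in> {-1, 0, 1}" for a by (simp add: chi4_def)
qed (simp_all add: chi4_def)

text \<open>By reciprocity (q/p) equals (p/q) if q is 1 modulo 4 and chi4(p) (p/q) if q is 3 modulo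
  4. The right-hand sides depend on p modulo q and modulo 4q, which explains the choice of
  \<open>M\<close>.\<close>

lemma is_quadratic_character_prime:
  assumes q: "prime q" "odd q"
  shows "\<exists>\<kappa> M. is_quadratic_character (int q) \<kappa> M"
proof -
  have q2: "2 < q" using q by (rule prime_odd_gt_2)
  have q4: "q mod 4 = 1 \<or> q mod 4 = 3" using q(2) by presburger
  define M where "M = (if q mod 4 = 3 then 4 * q else q)"
  define \<kappa> where "\<kappa> = (\<lambda>n. Legendre (int n) (int q) * (if q mod 4 = 3 then chi4 n else 1))"
  have "is_quadratic_character (int q) \<kappa> M"
    unfolding is_quadratic_character_def
  proof (intro conjI allI impI)
    show "M > 0" using q2 by (simp add: M_def)
    show "\<kappa> 1 = 1" using Legendre_1[OF q(1) q2] by (simp add: \<kappa>_def chi4_def)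
    show "\<kappa> (a * b) = \<kappa> a * \<kappa> b" for a b
      by (simp add: \<kappa>_def Legendre_mult[OF q(1) q2] chi4_mult)
    show "\<kappa> (a + M) = \<kappa> a" for a
    proof -
      have "Legendre (int (a + M)) (int q) = Legendre (int a) (int q)"
        by (rule Legendre_cong) (auto simp: M_def cong_iff_dvd_diff)
      moreover have "chi4 (a + 4 * q) = chi4 a" by (simp add: chi4_def)
      ultimately show ?thesis by (simp add: \<kappa>_def M_def)
    qed
    show "\<kappa> a \<in> {-1, 0, 1}" for a
      using Legendre_values[of "int a" "int q"] by (auto simp: \<kappa>_def chi4_def)
    show "coprime a M" if "\<kappa> a \<noteq> 0" for a
    proof -
      have "\<not> q dvd a"
        using that by (auto simp: \<kappa>_def Legendre_eq_0_iff)
      then have "coprime a q"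
        using q(1) by (metis coprime_commute prime_imp_coprime)
      moreover have "coprime a 4" if "q mod 4 = 3"
        using that \<open>\<kappa> a \<noteq> 0\<close> is_quadratic_characterD(6)[OF is_quadratic_character_minus_1, of a]
        by (auto simp: \<kappa>_def)
      ultimately show ?thesis by (simp add: M_def)
    qed
    show "\<kappa> p = Legendre (int q) (int p)" if p: "prime p" "odd p" for p
    proof (cases "p = q")
      case True
      then show ?thesis by (simp add: \<kappa>_def Legendre_eq_0_iff[THEN iffD2])
    next
      case False
      have p2: "2 < p" using p by (rule prime_odd_gt_2)
      have rec: "Legendre (int p) (int q) * Legendre (int q) (int p)
                 = (-1) ^ ((p - 1) div 2 * ((q - 1) div 2))"
        using Quadratic_Reciprocity[OF p(1) p2 q(1) q2 False] .
      have "(-1) ^ ((p - 1) div 2 * ((q - 1) div 2)) = (if q mod 4 = 3 then chi4 p else 1)"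
      proof (cases "q mod 4 = 3")
        case True
        then have "odd ((q - 1) div 2)" by presburger
        then show ?thesis using True p by (simp add: chi4_odd minus_one_power_iff)
      next
        case False
        then have "q mod 4 = 1" using q4 by simp
        then have "even ((q - 1) div 2)" by presburger
        then show ?thesis using False by simp
      qed
      then have rec': "Legendre (int p) (int q) * Legendre (int q) (int p)
                 = (if q mod 4 = 3 then chi4 p else 1)" using rec by simp
      have "Legendre (int p) (int q) \<noteq> 0"
        using p q False primes_dvd_imp_eq by (auto simp: Legendre_eq_0_iff)
      \<comment> \<open>A nonzero symbol is its own inverse, so it can be moved to the other side of
        the reciprocity law.\<close>
      then have "Legendre (int p) (int q) * Legendre (int p) (int q) = 1"
        using Legendre_values[of "int p" "int q"] by auto
      then show ?thesis unfolding \<kappa>_def rec'[symmetric] by (simp flip: mult.assoc)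
    qed
  qed
  then show ?thesis by blast
qed

text \<open>Multiply the characters of the prime factors, all odd. Repeated factors are harmless:
  the product is then merely imprimitive.\<close>

lemma quadratic_character_exists:
  assumes "odd m"
  shows "\<exists>\<kappa> M. is_quadratic_character (int m) \<kappa> M"
  using assms
proof (induction m rule: prime_divisors_induct)
  case (unit x)
  then show ?case using is_quadratic_character_1 by auto
next
  case (factor p x)
  then obtain \<kappa> M \<psi> N where "is_quadratic_character (int p) \<kappa> M" "is_quadratic_character (int x) \<psi> N"
    using is_quadratic_character_prime[of p] by auto
  then show ?case using is_quadratic_character_mult by fastforce
qed auto

lemma quadratic_character_neg_exists:
  assumes "odd m"
  shows "\<exists>\<kappa> M. is_quadratic_character (- int m) \<kappa> M"
  using quadratic_character_exists[OF assms] is_quadratic_character_mult[OF is_quadratic_character_minus_1]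
  by fastforce

text \<open>Multiplication by q permutes the residues modulo \<open>M\<close> and changes the sign
  of \<kappa>, so the sum equals its own negative. The prime q is the certificate that \<kappa> is
  nontrivial.\<close>

lemma quadratic_character_sum_0:
  assumes chi: "is_quadratic_character m \<kappa> M"
    and q: "prime q" "odd q" "Legendre m (int q) = -1"
  shows "(\<Sum>a<M. \<kappa> a) = 0"
proof -
  note M = is_quadratic_characterD(1)[OF chi] and mult = is_quadratic_characterD(3)[OF chi]
    and per = is_quadratic_characterD(4)[OF chi] and cop = is_quadratic_characterD(6)[OF chi]
  have chiq: "\<kappa> q = -1" using is_quadratic_characterD(7)[OF chi q(1,2)] q(3) by simp
  have permod: "\<kappa> (a mod M) = \<kappa> a" for a
    using periodic_mult[of \<kappa> M "a mod M" "a div M", OF per] by simp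
  have cq: "coprime q M" using cop[of q] chiq by simp
  have inj: "inj_on (\<lambda>a. q * a mod M) {..<M}"
  proof (rule inj_onI)
    fix a b assume ab: "a \<in> {..<M}" "b \<in> {..<M}" "q * a mod M = q * b mod M"
    then have "[q * a = q * b] (mod M)" by (simp add: Cong.cong_def)
    then have "[a = b] (mod M)" using cq by (simp add: cong_mult_lcancel_nat)
    then show "a = b" using ab by (simp add: Cong.cong_def)
  qed
  have img: "(\<lambda>a. q * a mod M) ` {..<M} = {..<M}"
    by (rule endo_inj_surj[OF _ _ inj]) (use M in auto)
  have "(\<Sum>a<M. \<kappa> a) = (\<Sum>a\<in>(\<lambda>a. q * a mod M) ` {..<M}. \<kappa> a)" by (simp add: img)
  also have "\<dots> = (\<Sum>a<M. \<kappa> (q * a mod M))" by (simp add: sum.reindex[OF inj])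
  also have "\<dots> = (\<Sum>a<M. - \<kappa> a)" by (simp add: permod mult chiq)
  finally show ?thesis by (simp add: sum_negf)
qed

section \<open>Estimates of Chebyshev and Mertens\<close>

text \<open>Writing n = d m, a sum over divisors up to \<open>N\<close> becomes a sum over d with m
  up to the floor of N/d. It serves for log N!, for the Lambert series and for the convolution
  \<kappa> log = (\<kappa> mangoldt) * \<kappa>.\<close>

lemma sum_divisors_swap:
  fixes f :: "nat \<Rightarrow> nat \<Rightarrow> 'a :: comm_monoid_add"
  shows "(\<Sum>n=1..N. \<Sum>d | d dvd n. f d (n div d)) = (\<Sum>d=1..N. \<Sum>m=1..N div d. f d m)"
proof -
  have "(\<Sum>n=1..N. \<Sum>d | d dvd n. f d (n div d)) =
        (\<Sum>(n, d)\<in>Sigma {1..N} (\<lambda>n. {d. d dvd n}). f d (n div d))"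
    by (rule sum.Sigma) (auto intro: finite_divisors_nat)
  also have "\<dots> = (\<Sum>(d, m)\<in>Sigma {1..N} (\<lambda>d. {1..N div d}). f d m)"
  proof (rule sum.reindex_bij_witness[where i = "\<lambda>(d, m). (d * m, d)" and j = "\<lambda>(n, d). (d, n div d)"], goal_cases)
    case (2 a)
    then obtain n d where a: "a = (n, d)" "1 \<le> n" "n \<le> N" "d dvd n" by auto
    then have "d \<le> n" "d > 0" by (auto dest: dvd_imp_le intro: Nat.gr0I)
    moreover have "1 \<le> n div d" using a by (auto elim!: dvdE intro!: Suc_leI Nat.gr0I)
    ultimately show ?case using a by (auto simp: div_le_mono)
  next
    case (4 b)
    then obtain d m where b: "b = (d, m)" "1 \<le> d" "d \<le> N" "1 \<le> m" "m \<le> N div d" by auto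
    have "d * m \<le> d * (N div d)" using b by (intro mult_le_mono) auto
    also have "\<dots> \<le> N" by simp
    finally show ?case using b by auto
  qed auto
  also have "\<dots> = (\<Sum>d=1..N. \<Sum>m=1..N div d. f d m)"
    by (rule sum.Sigma[symmetric]) auto
  finally show ?thesis .
qed

lemma ln_fact_eq_sum_mangoldt:
  "ln (fact N) = (\<Sum>d=1..N. mangoldt d * real (N div d))"
proof -
  have "ln (fact N :: real) = (\<Sum>n=1..N. ln (real n))"
    unfolding fact_prod by (subst ln_prod[symmetric]) auto
  also have "\<dots> = (\<Sum>n=1..N. \<Sum>d | d dvd n. mangoldt d)"
    by (intro sum.cong refl) (simp add: mangoldt_sum)
  also have "\<dots> = (\<Sum>d=1..N. \<Sum>m=1..N div d. mangoldt d)"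
    by (rule sum_divisors_swap)
  finally show ?thesis by (simp add: mult.commute)
qed

text \<open>Chebyshev's argument: the logarithm of the central binomial coefficient weights
  \<open>mangoldt d\<close> by floor(2n/d) - 2 floor(n/d), which is never negative and is 1 for n <
  d \<le> 2n; the coefficient itself is at most 2^(2n).\<close>

lemma sum_mangoldt_double:
  "(\<Sum>d=1..2*n. mangoldt d) \<le> (\<Sum>d=1..n. mangoldt d) + 2 * real n * ln 2"
proof -
  have "(\<Sum>d=1..n. mangoldt d * real (n div d)) = (\<Sum>d=1..2*n. mangoldt d * real (n div d))"
    by (rule sum.mono_neutral_left) auto
  then have eq: "ln (fact (2 * n)) - 2 * ln (fact n) =
      (\<Sum>d=1..2*n. mangoldt d * (real (2 * n div d) - 2 * real (n div d)))"
    by (simp add: ln_fact_eq_sum_mangoldt sum_subtractf sum_distrib_left algebra_simps)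
  have le2: "2 * (n div d) \<le> 2 * n div d" for d
  proof (cases "d = 0")
    case False
    have "d * (2 * (n div d)) = 2 * (d * (n div d))" by simp
    also have "\<dots> \<le> 2 * n" by (intro mult_le_mono) auto
    finally show ?thesis using False by (simp add: less_eq_div_iff_mult_less_eq mult.commute)
  qed auto
  have "(\<Sum>d\<in>{n<..2*n}. mangoldt d) \<le> (\<Sum>d=1..2*n. mangoldt d * (real (2 * n div d) - 2 * real (n div d)))"
  proof -
    have "(\<Sum>d\<in>{n<..2*n}. mangoldt d) = (\<Sum>d\<in>{n<..2*n}. mangoldt d * (real (2 * n div d) - 2 * real (n div d)))"
    proof (intro sum.cong refl)
      fix d assume d: "d \<in> {n<..2*n}"
      then have "n div d = 0" "2 * n div d = 1" by (auto simp: div_nat_eqI)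
      then show "mangoldt d = mangoldt d * (real (2 * n div d) - 2 * real (n div d))" by simp
    qed
    also have "\<dots> \<le> (\<Sum>d=1..2*n. mangoldt d * (real (2 * n div d) - 2 * real (n div d)))"
    proof (rule sum_mono2)
      fix d show "0 \<le> mangoldt d * (real (2 * n div d) - 2 * real (n div d))"
        using le2[of d] by (intro mult_nonneg_nonneg mangoldt_nonneg) (simp flip: of_nat_mult)
    qed auto
    finally show ?thesis .
  qed
  also have "\<dots> = ln (real ((2 * n) choose n))"
  proof -
    have "real ((2 * n) choose n) = fact (2 * n) / (fact n * fact n)"
      by (subst binomial_fact) (auto simp: mult_2)
    then show ?thesis unfolding eq[symmetric] by (simp add: ln_div ln_mult)
  qed
  also have "\<dots> \<le> ln (2 ^ (2 * n))"
  proof (subst ln_le_cancel_iff)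
    have "(2 * n) choose n \<le> 2 ^ (2 * n)" by (rule binomial_le_pow2)
    then show "real ((2 * n) choose n) \<le> 2 ^ (2 * n)"
      by (metis of_nat_le_iff of_nat_numeral of_nat_power)
  qed auto
  finally have "(\<Sum>d\<in>{n<..2*n}. mangoldt d) \<le> 2 * real n * ln 2"
    by (simp add: ln_realpow)
  moreover have "(\<Sum>d=1..2*n. mangoldt d) = (\<Sum>d=1..n. mangoldt d) + (\<Sum>d\<in>{n<..2*n}. mangoldt d :: real)"
    by (subst sum.union_disjoint[symmetric]) (auto intro!: sum.cong)
  ultimately show ?thesis by simp
qed

text \<open>Doubling gives the bound at powers of two; passing to the next power of two above n
  costs at most another factor 2.\<close>

lemma sum_mangoldt_le: "(\<Sum>d=1..n. mangoldt d) \<le> 6 * real n"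
proof -
  have pow: "(\<Sum>d=1..2^k. mangoldt d) \<le> 2 * 2 ^ k * ln (2::real)" for k
  proof (induction k)
    case (Suc k)
    then show ?case using sum_mangoldt_double[of "2 ^ k"] by simp
  qed simp
  show ?thesis
  proof (cases "n = 0")
    case False
    obtain j where j: "2 ^ j \<le> n" "n < 2 ^ (j + 1)"
      using ex_power_ivl1[of 2 n] False by auto
    have "(\<Sum>d=1..n. mangoldt d) \<le> (\<Sum>d=1..2^(j+1). mangoldt d :: real)"
      using j by (intro sum_mono2) (auto simp: mangoldt_nonneg)
    also have "\<dots> \<le> 2 * 2 ^ (j + 1) * ln (2::real)" by (rule pow)
    also have "\<dots> \<le> 2 * 2 ^ (j + 1) * (1::real)"
      using ln_2_less_1 by (intro mult_left_mono) auto
    also have "\<dots> \<le> 4 * real n" using of_nat_mono[OF j(1), where 'a = real] by simp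
    finally show ?thesis by simp
  qed simp
qed

lemma ln_Suc_diff_le:
  assumes "n > 0"
  shows "real n * (ln (real (Suc n)) - ln (real n)) \<le> 1"
proof -
  have "ln (real (Suc n)) - ln (real n) = ln (1 + 1 / real n)"
    using assms ln_div[of "real (Suc n)" "real n"] by (simp add: add_divide_distrib add.commute)
  also have "\<dots> \<le> 1 / real n" using assms by (intro ln_add_one_self_le_self) auto
  finally have "real n * (ln (real (Suc n)) - ln (real n)) \<le> real n * (1 / real n)"
    by (rule mult_left_mono) auto
  then show ?thesis using assms by simp
qed

lemma ln_fact_ge: "N > 0 \<Longrightarrow> real N * ln N - N \<le> ln (fact N)"
proof (induction N rule: nat_induct_non_zero)
  case (Suc n)
  have "real n * (ln (real (Suc n)) - ln (real n)) \<le> 1" using Suc.hyps by (rule ln_Suc_diff_le)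
  moreover have "ln (fact (Suc n) :: real) = ln (real (Suc n)) + ln (fact n)"
    by (simp add: ln_mult del: of_nat_Suc)
  ultimately show ?case using Suc.IH by (simp add: algebra_simps)
qed simp

text \<open>The lower half of Mertens' estimate: in the formula for log N!, replacing floor(N/d) by
  N/d only enlarges the sum, and log N! is at least N log N - N.\<close>

lemma sum_mangoldt_div_ge:
  assumes "N > 0"
  shows "ln (real N) - 1 \<le> (\<Sum>d=1..N. mangoldt d / real d)"
proof -
  have "real N * ln N - N \<le> (\<Sum>d=1..N. mangoldt d * real (N div d))"
    using ln_fact_ge[OF assms] by (simp add: ln_fact_eq_sum_mangoldt)
  also have "\<dots> \<le> (\<Sum>d=1..N. mangoldt d * (real N / real d))"
    by (intro sum_mono mult_left_mono of_nat_div_le_of_nat mangoldt_nonneg)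
  also have "\<dots> = real N * (\<Sum>d=1..N. mangoldt d / real d)"
    by (simp add: sum_distrib_left algebra_simps)
  finally have "real N * (ln N - 1) \<le> real N * (\<Sum>d=1..N. mangoldt d / real d)"
    by (simp add: algebra_simps)
  then show ?thesis using assms by simp
qed

lemma ln_le_2_sqrt: "x > 0 \<Longrightarrow> ln x \<le> 2 * sqrt x"
  using ln_le_minus_one[of "sqrt x"] by (simp add: ln_sqrt)

lemma summable_ln_over_square: "summable (\<lambda>n. ln (real n) / real n ^ 2)"
proof (rule summable_comparison_test')
  show "summable (\<lambda>n. 2 * real n powr (-3/2))"
    by (intro summable_mult) (simp add: summable_real_powr_iff)
  fix n :: nat assume n: "n \<ge> 1"
  have "ln (real n) / real n ^ 2 \<le> 2 * sqrt n / real n ^ 2"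
    using n by (intro divide_right_mono ln_le_2_sqrt) auto
  also have "\<dots> = 2 * real n powr (-3/2)"
  proof -
    have "real n powr (-3/2) = real n powr (1/2 - 2)" by simp
    also have "\<dots> = sqrt n / real n ^ 2"
      using n by (subst powr_diff) (simp add: powr_half_sqrt)
    finally show ?thesis by simp
  qed
  finally show "norm (ln (real n) / real n ^ 2) \<le> 2 * real n powr (-3/2)"
    using n by simp
qed

text \<open>What remains after removing the primes are the powers p^k with k \<ge> 2. For fixed p
  they contribute log p times a geometric series of size at most 2 / p^2, and the sum of log n / n^2
  converges.\<close>

lemma sum_mangoldt_nonprime_bounded:
  "\<exists>C. \<forall>N. (\<Sum>n=1..N. (mangoldt n - (if prime n then ln (real n) else 0)) / real n) \<le> C"
proof -
  define g where "g = (\<lambda>n. ln (real n) / real n ^ 2)"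
  have g0: "0 \<le> g n" for n by (cases "n = 0") (auto simp: g_def)
  have "(\<Sum>n=1..N. (mangoldt n - (if prime n then ln (real n) else 0)) / real n) \<le> 2 * suminf g" for N
  proof -
    define A where "A = {n\<in>{1..N}. primepow n \<and> \<not> prime n}"
    \<comment> \<open>\<open>h\<close> reads off base and exponent of a prime power. On
      \<open>A\<close> both lie between 2 and \<open>N\<close>, so the sum is dominated by one over
      a square of pairs (p, k).\<close>
    define h where "h = (\<lambda>n::nat. (aprimedivisor n, multiplicity (aprimedivisor n) n))"
    have h: "fst (h n) ^ snd (h n) = n" if "n \<in> A" for n
      using that by (simp add: A_def h_def primepow_decompose)
    have "(\<Sum>n=1..N. (mangoldt n - (if prime n then ln (real n) else 0)) / real n)
        = (\<Sum>n\<in>A. mangoldt n / real n)"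
      by (rule sum.mono_neutral_cong_right) (auto simp: A_def mangoldt_def)
    also have "\<dots> = (\<Sum>(p, k)\<in>h ` A. ln (real p) / real p ^ k)"
    proof (subst sum.reindex)
      show "inj_on h A"
        by (rule inj_onI) (metis h)
      show "(\<Sum>n\<in>A. mangoldt n / real n) = sum ((\<lambda>(p, k). ln (real p) / real p ^ k) \<circ> h) A"
      proof (intro sum.cong refl)
        fix n assume n: "n \<in> A"
        have "mangoldt n = ln (real (fst (h n)))"
          using n by (simp add: A_def mangoldt_def h_def)
        moreover have "real n = real (fst (h n)) ^ snd (h n)"
          using h[OF n] by (metis of_nat_power)
        ultimately show "mangoldt n / real n = ((\<lambda>(p, k). ln (real p) / real p ^ k) \<circ> h) n"
          by (simp add: case_prod_beta)
      qed
    qed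
    also have "\<dots> \<le> (\<Sum>(p, k)\<in>{2..N} \<times> {2..N}. ln (real p) / real p ^ k)"
    proof (rule sum_mono2)
      show "h ` A \<subseteq> {2..N} \<times> {2..N}"
      proof (rule image_subsetI)
        fix n assume n: "n \<in> A"
        then obtain p k where pk: "prime p" "k > 0" "n = p ^ k" by (auto simp: A_def primepow_def)
        have "k \<noteq> 1" using n pk by (auto simp: A_def)
        then have k2: "k \<ge> 2" using pk by simp
        have "p \<le> p ^ k" using pk prime_gt_0_nat[of p] by (simp add: self_le_power)
        moreover have "k < p ^ k" using prime_gt_1_nat[OF pk(1)] by (simp add: power_gt_expt)
        moreover have "aprimedivisor n = p" "multiplicity (aprimedivisor n) n = k"
          using pk by (simp_all add: aprimedivisor_prime_power)
        ultimately show "h n \<in> {2..N} \<times> {2..N}"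
          using n k2 pk prime_ge_2_nat[of p] by (auto simp: A_def h_def)
      qed
    qed auto
    also have "\<dots> = (\<Sum>p=2..N. \<Sum>k=2..N. ln (real p) / real p ^ k)"
      by (simp add: sum.cartesian_product)
    also have "\<dots> \<le> (\<Sum>p=2..N. 2 * g p)"
    proof (rule sum_mono)
      fix p assume "p \<in> {2..N}"
      then have p: "p \<ge> 2" by simp
      define x where "x = 1 / real p"
      have x: "0 \<le> x" "x \<le> 1 / 2" using p by (auto simp: x_def field_simps)
      \<comment> \<open>The subtracted last term makes the bound inductive: the step needs exactly 2
        x^(n+1) \<le> x^n, that is x \<le> 1/2. For N < 2 the sum is empty.\<close>
      have "(\<Sum>k=2..N. x ^ k) \<le> 2 * x ^ 2 - (if N < 2 then 0 else x ^ N)" for N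
      proof (induction N)
        case (Suc n)
        show ?case
        proof (cases "n < 2")
          case True
          then have "n = 0 \<or> n = 1" by auto
          then show ?thesis using x by (auto simp: numeral_2_eq_2)
        next
          case False
          have "2 * x ^ (n + 1) \<le> x ^ n"
            using mult_right_mono[OF x(2), of "x ^ n"] x by simp
          then show ?thesis using Suc False by (simp add: sum.nat_ivl_Suc')
        qed
      qed (use x in simp)
      from this[of N] have "(\<Sum>k=2..N. x ^ k) \<le> 2 * x ^ 2"
        using x by (auto split: if_splits intro: order_trans)
      then have "ln (real p) * (\<Sum>k=2..N. x ^ k) \<le> ln (real p) * (2 * x ^ 2)"
        using p by (intro mult_left_mono) auto
      then show "(\<Sum>k=2..N. ln (real p) / real p ^ k) \<le> 2 * g p"
        by (simp add: g_def x_def sum_distrib_left power_one_over mult.commute)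
    qed
    also have "\<dots> = 2 * (\<Sum>p=2..N. g p)" by (simp add: sum_distrib_left)
    also have "\<dots> \<le> 2 * suminf g"
      using summable_ln_over_square g0 unfolding g_def
      by (intro mult_left_mono sum_le_suminf) auto
    finally show ?thesis .
  qed
  then show ?thesis by blast
qed

section \<open>Real Dirichlet characters\<close>

lemma gcd_mult_of_divisors:
  fixes a b d e :: nat
  assumes "coprime a b" "d dvd a" "e dvd b"
  shows "gcd (d * e) a = d" "gcd (d * e) b = e"
  using assms
  by (metis coprime_divisors gcd_mult_left_right_cancel gcd_nat.orderE gcd_nat.order_iff_strict,
      metis coprime_divisors gcd_mult_left_left_cancel gcd_nat.orderE gcd_nat.order_iff_strict coprime_commute)

locale real_character =
  fixes \<kappa> :: "nat \<Rightarrow> real" and M :: nat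
  assumes M_pos: "M > 0" and chi_1: "\<kappa> 1 = 1" and chi_mult: "\<kappa> (a * b) = \<kappa> a * \<kappa> b"
    and chi_values: "\<kappa> a \<in> {-1, 0, 1}" and periodic: "\<kappa> (a + M) = \<kappa> a"
    and sum_period: "(\<Sum>a<M. \<kappa> a) = 0"
begin

lemma abs_chi_le: "\<bar>\<kappa> a\<bar> \<le> 1"
  using chi_values[of a] by auto

text \<open>Complete periods cancel; the remaining incomplete one has fewer than \<open>M\<close>
  terms of size at most 1.\<close>

lemma abs_sum_chi_le: "\<bar>\<Sum>a<n. \<kappa> a\<bar> \<le> M"
proof (induction n rule: less_induct)
  case (less n)
  show ?case
  proof (cases "n < M")
    case True
    have "\<bar>\<Sum>a<n. \<kappa> a\<bar> \<le> (\<Sum>a<n. 1)"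
      by (rule order_trans[OF sum_abs sum_mono]) (rule abs_chi_le)
    then show ?thesis using True by simp
  next
    case False
    then obtain k where k: "n = M + k" using le_Suc_ex by (auto simp: not_less)
    have "(\<Sum>a<M + k. \<kappa> a) = (\<Sum>a<M. \<kappa> a) + (\<Sum>a\<in>{M..<M+k}. \<kappa> a)"
      by (subst sum.union_disjoint[symmetric]) (auto intro!: sum.cong)
    also have "(\<Sum>a\<in>{M..<M+k}. \<kappa> a) = (\<Sum>a<k. \<kappa> (a + M))"
      by (rule sum.reindex_bij_witness[where i = "\<lambda>a. a + M" and j = "\<lambda>a. a - M"]) auto
    finally have "(\<Sum>a<n. \<kappa> a) = (\<Sum>a<k. \<kappa> a)" by (simp add: k sum_period periodic)
    then show ?thesis using less[of k] k M_pos by simp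
  qed
qed

text \<open>Summation by parts against a decreasing weight. The partial sums counted from
  \<open>a\<close> are differences of two sums from 0, hence the factor 2.\<close>

lemma abs_sum_chi_mult_le:
  fixes f :: "nat \<Rightarrow> real"
  assumes dec: "\<And>n. n \<ge> a \<Longrightarrow> f (Suc n) \<le> f n" and nonneg: "\<And>n. n \<ge> a \<Longrightarrow> 0 \<le> f n"
  shows "\<bar>\<Sum>n\<in>{a..<b}. \<kappa> n * f n\<bar> \<le> 2 * M * f a"
proof (cases "a \<le> b")
  case True
  define A where "A = (\<lambda>n. \<Sum>k<n. \<kappa> k)"
  have A: "\<bar>A n - A a\<bar> \<le> 2 * M" for n
    using abs_sum_chi_le[of n] abs_sum_chi_le[of a] unfolding A_def by linarith
  have eq: "(\<Sum>n\<in>{a..<b}. \<kappa> n * f n) =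
      (\<Sum>n\<in>{a..<b}. (A (Suc n) - A a) * (f n - f (Suc n))) + (A b - A a) * f b"
    using True by (induction b rule: dec_induct) (simp_all add: A_def algebra_simps)
  have tel: "(\<Sum>n\<in>{a..<b}. 2 * M * (f n - f (Suc n))) = 2 * M * (f a - f b)"
    using True by (induction b rule: dec_induct) (simp_all add: algebra_simps)
  have "\<bar>\<Sum>n\<in>{a..<b}. \<kappa> n * f n\<bar> \<le>
      \<bar>\<Sum>n\<in>{a..<b}. (A (Suc n) - A a) * (f n - f (Suc n))\<bar> + \<bar>(A b - A a) * f b\<bar>"
    unfolding eq by (rule abs_triangle_ineq)
  also have "\<dots> \<le> 2 * M * (f a - f b) + 2 * M * f b"
  proof (rule add_mono)
    have "\<bar>\<Sum>n\<in>{a..<b}. (A (Suc n) - A a) * (f n - f (Suc n))\<bar> \<le> (\<Sum>n\<in>{a..<b}. 2 * M * (f n - f (Suc n)))"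
    proof (rule order_trans[OF sum_abs sum_mono])
      fix n assume "n \<in> {a..<b}"
      then show "\<bar>(A (Suc n) - A a) * (f n - f (Suc n))\<bar> \<le> 2 * M * (f n - f (Suc n))"
        using mult_right_mono[OF A[of "Suc n"], of "f n - f (Suc n)"] dec[of n] by (simp add: abs_mult)
    qed
    then show "\<bar>\<Sum>n\<in>{a..<b}. (A (Suc n) - A a) * (f n - f (Suc n))\<bar> \<le> 2 * M * (f a - f b)"
      by (simp only: tel)
    show "\<bar>(A b - A a) * f b\<bar> \<le> 2 * M * f b"
      using mult_right_mono[OF A[of b], of "f b"] nonneg[OF True] by (simp add: abs_mult)
  qed
  also have "\<dots> = 2 * M * f a" by (simp add: algebra_simps)
  finally show ?thesis .
qed (use nonneg[of a] in simp)

section \<open>The value L(1, \<kappa>) and its non-vanishing\<close>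

definition L1 :: real where "L1 = (\<Sum>n. \<kappa> n / n)"

text \<open>Summation by parts bounds every block of the series by 2M over its first index, which
  gives convergence and the rate at once. The rate matters: at floor(N/d) in place of N the error is
  O(d/N), which Chebyshev's bound can absorb.\<close>

lemma abs_partial_sum_minus_L1_le: "\<bar>(\<Sum>n=1..N. \<kappa> n / n) - L1\<bar> \<le> 2 * M / (N + 1)"
proof -
  have part: "\<bar>\<Sum>n\<in>{a..<b}. \<kappa> n / n\<bar> \<le> 2 * M / a" if "a > 0" for a b
    using abs_sum_chi_mult_le[of a "\<lambda>n. 1 / real n" b] that by (simp add: frac_le)
  have "summable (\<lambda>n. \<kappa> n / n)"
    unfolding summable_Cauchy
  proof (intro allI impI)
    fix e :: real assume e: "e > 0"
    obtain K where K: "2 * M / e < real K" using reals_Archimedean2 by blast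
    have K0: "K > 0"
    proof (rule ccontr)
      assume "\<not> K > 0"
      then have "2 * M / e < 0" using K by simp
      then show False using e M_pos by (simp add: divide_less_0_iff)
    qed
    show "\<exists>N. \<forall>m\<ge>N. \<forall>n. norm (\<Sum>n\<in>{m..<n}. \<kappa> n / n) < e"
    proof (intro exI allI impI)
      fix m n assume m: "K \<le> m"
      have "\<bar>\<Sum>n\<in>{m..<n}. \<kappa> n / n\<bar> \<le> 2 * M / m" using m K0 by (intro part) auto
      also have "\<dots> \<le> 2 * M / K" using m K0 by (intro divide_left_mono) auto
      also have "\<dots> < e" using K e K0 by (simp add: field_simps)
      finally show "norm (\<Sum>n\<in>{m..<n}. \<kappa> n / n) < e" by simp
    qed
  qed
  then have lim: "(\<lambda>n. \<Sum>k<n. \<kappa> k / k) \<longlonglongrightarrow> L1"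
    unfolding L1_def by (rule summable_LIMSEQ)
  \<comment> \<open>The series starts at 0, where the term vanishes because division by zero gives
    0.\<close>
  have eq: "(\<Sum>n=1..N. \<kappa> n / n) = (\<Sum>k<Suc N. \<kappa> k / k)"
    by (rule sum.mono_neutral_left) (auto simp: not_le less_Suc_eq_le)
  have "(\<lambda>n. \<bar>(\<Sum>k<Suc N. \<kappa> k / k) - (\<Sum>k<n. \<kappa> k / k)\<bar>) \<longlonglongrightarrow> \<bar>(\<Sum>k<Suc N. \<kappa> k / k) - L1\<bar>"
    by (intro tendsto_intros lim)
  then have "\<bar>(\<Sum>k<Suc N. \<kappa> k / k) - L1\<bar> \<le> 2 * M / (N + 1)"
  proof (rule LIMSEQ_le_const2, intro exI allI impI)
    fix n assume n: "Suc N \<le> n"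
    have "(\<Sum>k<n. \<kappa> k / k) = (\<Sum>k<Suc N. \<kappa> k / k) + (\<Sum>k\<in>{Suc N..<n}. \<kappa> k / k)"
      using n by (subst sum.union_disjoint[symmetric]) (auto intro!: sum.cong simp: less_Suc_eq_le)
    then show "\<bar>(\<Sum>k<Suc N. \<kappa> k / k) - (\<Sum>k<n. \<kappa> k / k)\<bar> \<le> 2 * M / (N + 1)"
      using part[of "Suc N" n] by (simp add: add.commute)
  qed
  then show ?thesis by (simp only: eq of_nat_add of_nat_1)
qed

lemma sum_divisors_chi_prime_power:
  assumes p: "prime p"
  shows "(\<Sum>d | d dvd p ^ k. \<kappa> d) \<ge> (if even k then 1 else 0)"
proof -
  have pow: "\<kappa> (p ^ i) = \<kappa> p ^ i" for i
    by (induction i) (simp_all add: chi_1[unfolded One_nat_def] chi_mult)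
  \<comment> \<open>The divisor sum is the geometric sum 1 + x + ... + x^k with x in {-1, 0, 1}; it
    can vanish only for x = -1 and odd k.\<close>
  have "(\<Sum>d | d dvd p ^ k. \<kappa> d) = (\<Sum>i\<le>k. \<kappa> p ^ i)"
  proof (rule sum.reindex_bij_betw[symmetric, of "\<lambda>i. p ^ i", THEN trans])
    show "bij_betw (\<lambda>i. p ^ i) {..k} {d. d dvd p ^ k}"
      unfolding bij_betw_def using prime_gt_1_nat[OF p]
      by (auto simp: inj_on_def le_imp_power_dvd divides_primepow_nat[OF p])
  qed (simp add: pow)
  moreover have "(\<Sum>i\<le>k. x ^ i) \<ge> (if even k then 1 else 0)" if "x \<in> {-1, 0, 1::real}" for x
  proof -
    have "x = -1 \<or> x = 0 \<or> x = 1" using that by simp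
    then consider "x = -1" | "x = 0" | "x = 1" by metis
    then show ?thesis
    proof cases
      case 1
      have "(\<Sum>i\<le>k. (-1) ^ i) = (if even k then 1 else 0 :: real)" by (induction k) auto
      then show ?thesis using 1 by simp
    next
      case 2
      have "(\<Sum>i\<le>k. 0 ^ i) = (1 :: real)" by (induction k) auto
      then show ?thesis using 2 by simp
    qed auto
  qed
  ultimately show ?thesis using chi_values[of p] by metis
qed

text \<open>A divisor of a b is uniquely a product of a divisor of a and one of b, recovered as its
  gcds with a and b.\<close>

lemma sum_divisors_chi_coprime:
  assumes "coprime a b" "a > 0" "b > 0"
  shows "(\<Sum>d | d dvd a * b. \<kappa> d) = (\<Sum>d | d dvd a. \<kappa> d) * (\<Sum>d | d dvd b. \<kappa> d)"
proof -
  have "(\<Sum>d | d dvd a. \<kappa> d) * (\<Sum>d | d dvd b. \<kappa> d) =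
      (\<Sum>(d, e)\<in>{d. d dvd a} \<times> {d. d dvd b}. \<kappa> (d * e))"
    by (simp add: sum_product sum.cartesian_product chi_mult)
  also have "\<dots> = (\<Sum>d | d dvd a * b. \<kappa> d)"
  proof (rule sum.reindex_bij_witness[where i = "\<lambda>x. (gcd x a, gcd x b)" and j = "\<lambda>(d, e). d * e"], goal_cases)
    case (1 y)
    then show ?case using gcd_mult_of_divisors[OF assms(1)] by auto
  next
    case (3 x)
    then obtain d e where "x = d * e" "d dvd a" "e dvd b" using division_decomp by blast
    then show ?case using gcd_mult_of_divisors[OF assms(1)] by simp
  qed auto
  finally show ?thesis ..
qed

text \<open>The divisor sum is multiplicative, so both claims reduce to prime powers. The induction
  splits off the full power of one prime; if n is a square, this exponent is even and the cofactor
  is again a square.\<close>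

lemma sum_divisors_chi_ge:
  assumes "n > 0"
  shows "0 \<le> (\<Sum>d | d dvd n. \<kappa> d) \<and> ((\<exists>k. n = k ^ 2) \<longrightarrow> 1 \<le> (\<Sum>d | d dvd n. \<kappa> d))"
  using assms
proof (induction n rule: less_induct)
  case (less n)
  show ?case
  proof (cases "n = 1")
    case True
    then show ?thesis using chi_1 by simp
  next
    case False
    then obtain p where p: "prime p" "p dvd n" using prime_factor_nat by blast
    define k where "k = multiplicity p n"
    obtain m where m: "n = p ^ k * m" "\<not> p dvd m"
      using multiplicity_decompose'[of n p] less.prems p unfolding k_def by (metis not_prime_unit less_not_refl)
    have m0: "m > 0" using m less.prems by (auto intro: Nat.gr0I)
    have k0: "k > 0" unfolding k_def using p less.prems by (simp add: prime_multiplicity_gt_zero_iff)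
    have cop: "coprime (p ^ k) m" using p m by (simp add: prime_imp_coprime)
    have "1 < p ^ k" using prime_gt_1_nat[OF p(1)] k0 by (rule one_less_power)
    then have "m < n" using m m0 by simp
    note IH = less.IH[OF this m0]
    have eq: "(\<Sum>d | d dvd n. \<kappa> d) = (\<Sum>d | d dvd p ^ k. \<kappa> d) * (\<Sum>d | d dvd m. \<kappa> d)"
      unfolding m(1) using cop m0 p prime_gt_0_nat by (intro sum_divisors_chi_coprime) auto
    have pk: "(\<Sum>d | d dvd p ^ k. \<kappa> d) \<ge> (if even k then 1 else 0)"
      by (rule sum_divisors_chi_prime_power[OF p(1)])
    show ?thesis
    proof (intro conjI impI)
      show "0 \<le> (\<Sum>d | d dvd n. \<kappa> d)"
        unfolding eq using pk IH by (intro mult_nonneg_nonneg) (auto split: if_splits)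
      assume "\<exists>k. n = k ^ 2"
      then obtain j where j: "n = j ^ 2" by blast
      then have "k = 2 * multiplicity p j"
        using p less.prems unfolding k_def by (simp add: prime_elem_multiplicity_power_distrib)
      then have ev: "even k" by simp
      have "\<exists>i. m = i ^ 2"
      proof -
        have "p ^ (multiplicity p j) dvd j" by (rule multiplicity_dvd)
        then obtain i where i: "j = p ^ multiplicity p j * i" by (elim dvdE)
        have "p ^ k * m = p ^ k * i ^ 2"
          using j i m(1) \<open>k = 2 * multiplicity p j\<close>
          by (metis power_mult power_mult_distrib mult.commute)
        then show ?thesis using p prime_gt_0_nat by auto
      qed
      then have "1 \<le> (\<Sum>d | d dvd m. \<kappa> d)" using IH by blast
      then show "1 \<le> (\<Sum>d | d dvd n. \<kappa> d)"
        unfolding eq using pk ev mult_mono[of 1 "\<Sum>d | d dvd p ^ k. \<kappa> d" 1 "\<Sum>d | d dvd m. \<kappa> d"] by simp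
    qed
  qed
qed

end

text \<open>With s_n = 1 + t + ... + t^(n-1) this says t^n / (s_n s_(n+1)) \<le> 1 / (n (n+1)),
  which is what makes the coefficients \<open>c n\<close> of Monsky's argument decrease. The
  induction step needs only a lower bound for s_(n+1), supplied by Bernoulli's inequality; what is
  left over is (n+1)(e + n e^2 / 2) with e = 1 - t, which is nonnegative.\<close>

lemma geometric_sum_product_ge:
  fixes t :: real
  assumes t: "0 \<le> t" "t \<le> 1"
  shows "real n * (real n + 1) * t ^ n \<le> (\<Sum>i<n. t ^ i) * (\<Sum>i<Suc n. t ^ i)"
proof (induction n)
  case (Suc n)
  define s where "s = (\<Sum>i<Suc n. t ^ i)"
  define e where "e = 1 - t"
  have bern: "t ^ i \<ge> 1 - real i * e" for i
    using Bernoulli_inequality[of "-e" i] t by (simp add: e_def algebra_simps)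
  have "s \<ge> (\<Sum>i<Suc n. 1 - real i * e)"
    unfolding s_def by (intro sum_mono bern)
  moreover have "2 * (\<Sum>i<Suc n. 1 - real i * e) = 2 * (real n + 1) - real n * (real n + 1) * e"
    by (induction n) (simp_all add: algebra_simps)
  ultimately have s: "s \<ge> (real n + 1) - real n * (real n + 1) / 2 * e" by simp
  have "(real n + 1) * (real n + 2) * t \<le> real n * (real n + 1) + s * (1 + t)"
  proof -
    have "s * (1 + t) \<ge> ((real n + 1) - real n * (real n + 1) / 2 * e) * (1 + t)"
      using s t by (intro mult_right_mono) auto
    moreover have "real n * (real n + 1) + ((real n + 1) - real n * (real n + 1) / 2 * e) * (1 + t)
        - (real n + 1) * (real n + 2) * t = (real n + 1) * (e + real n * e ^ 2 / 2)"
      by (simp add: e_def field_simps power2_eq_square)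
    moreover have "(real n + 1) * (e + real n * e ^ 2 / 2) \<ge> 0"
      using t by (simp add: e_def)
    ultimately show ?thesis by linarith
  qed
  then have "(real n + 1) * (real n + 2) * t * t ^ n \<le> (real n * (real n + 1) + s * (1 + t)) * t ^ n"
    using t by (intro mult_right_mono) auto
  also have "\<dots> = real n * (real n + 1) * t ^ n + s * (t ^ n + t ^ Suc n)"
    by (simp add: algebra_simps)
  also have "\<dots> \<le> (\<Sum>i<n. t ^ i) * s + s * (t ^ n + t ^ Suc n)"
    using Suc by (simp add: s_def)
  also have "\<dots> = s * (\<Sum>i<Suc (Suc n). t ^ i)"
    by (simp add: algebra_simps)
  finally show ?case by (simp add: s_def algebra_simps)
qed simp

context real_character
begin

text \<open>Monsky's argument: as \<open>c n\<close> decreases, the Lambert series \<open>\<Sum> \<kappa>(n) t\<^sup>n / (1 - t\<^sup>n)\<close> would be bounded as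
  \<open>t\<close> tends to \<open>1\<close> if \<open>L(1, \<kappa>)\<close> vanished. But its coefficients \<open>\<Sum>\<^sub>d\<^sub>|\<^sub>k \<kappa>(d)\<close> are nonnegative, and at least
  \<open>1\<close> for squares \<open>k\<close>. The two last terms account for truncating the series.\<close>

lemma lambert_partial_sum_le:
  fixes t :: real
  assumes t: "0 < t" "t < 1" and L: "L1 = 0"
  shows "(1 - t) * (\<Sum>k=1..N. (\<Sum>d | d dvd k. \<kappa> d) * t ^ k) \<le> real (2 * M) * (1 - t) + real (2 * M) / (real N + 1) + real N * t ^ N"
proof -
  define s where "s = (\<lambda>n. \<Sum>i<n. t ^ i)"
  \<comment> \<open>Since 1 - t^n = (1 - t) \<open>s n\<close>, the second term is (1 - t) t^n / (1
    - t^n): summing \<kappa>(n) \<open>c n\<close> compares the series for L(1, \<kappa>) with (1 -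
    t) times the Lambert series.\<close>
  define c where "c = (\<lambda>n. 1 / real n - t ^ n / s n)"
  have s1: "s n \<ge> 1" if "n \<ge> 1" for n
  proof -
    have "(\<Sum>i\<in>{0}. t ^ i) \<le> s n" unfolding s_def using that t by (intro sum_mono2) auto
    then show ?thesis by simp
  qed
  have geo: "1 - t ^ n = (1 - t) * s n" for n
    unfolding s_def using one_diff_power_eq[of t n] .
  have c_dec: "c (Suc n) \<le> c n" if n: "n \<ge> 1" for n
  proof -
    have pos: "s n > 0" "s (Suc n) > 0" using s1[of n] s1[of "Suc n"] n by auto
    have sS: "s (Suc n) - t * s n = 1"
      unfolding s_def by (subst sum.lessThan_Suc_shift) (simp add: sum_distrib_left)
    have "t ^ n / s n - t ^ Suc n / s (Suc n) = t ^ n * (s (Suc n) - t * s n) / (s n * s (Suc n))"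
      using pos by (simp add: field_simps)
    also have "\<dots> = t ^ n / (s n * s (Suc n))" by (simp add: sS)
    also have "\<dots> \<le> 1 / (real n * (real n + 1))"
      using geometric_sum_product_ge[of t n] t n pos
      by (simp add: s_def divide_simps mult.commute)
    also have "\<dots> = 1 / real n - 1 / real (Suc n)" using n by (simp add: field_simps)
    finally show ?thesis by (simp add: c_def)
  qed
  have c_lim: "c \<longlonglongrightarrow> 0"
  proof -
    have "(\<lambda>n. t ^ n) \<longlonglongrightarrow> 0" using t by (intro LIMSEQ_power_zero) auto
    then have "(\<lambda>n. t ^ n / s n) \<longlonglongrightarrow> 0"
    proof (rule Lim_null_comparison[rotated])
      show "\<forall>\<^sub>F n in sequentially. norm (t ^ n / s n) \<le> t ^ n"
      proof (rule eventually_sequentiallyI[of 1])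
        fix n :: nat assume "1 \<le> n"
        then show "norm (t ^ n / s n) \<le> t ^ n"
          using s1[of n] t by (simp add: field_simps)
      qed
    qed
    moreover have "(\<lambda>n. 1 / real n) \<longlonglongrightarrow> 0" by (rule lim_1_over_n)
    ultimately show ?thesis unfolding c_def using tendsto_diff by fastforce
  qed
  have c_nonneg: "c n \<ge> 0" if "n \<ge> 1" for n
  proof (rule LIMSEQ_le_const2[OF c_lim], intro exI allI impI)
    fix k assume "n \<le> k"
    then show "c k \<le> c n"
      by (induction k rule: dec_induct) (use that c_dec in \<open>auto intro: order_trans\<close>)
  qed
  \<comment> \<open>The first coefficient carries the factor 1 - t. Summation by parts bounds the
    whole sum by 2M times it, so that dividing by 1 - t later leaves a bound free of t.\<close>
  have c1: "c 1 = 1 - t" by (simp add: c_def s_def)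
  have "\<bar>\<Sum>n\<in>{1..<Suc N}. \<kappa> n * c n\<bar> \<le> 2 * M * c 1"
    by (rule abs_sum_chi_mult_le) (use c_dec c_nonneg in auto)
  then have A: "\<bar>\<Sum>n=1..N. \<kappa> n * c n\<bar> \<le> 2 * M * (1 - t)"
    by (simp only: c1 atLeastLessThanSuc_atLeastAtMost)
  have B: "\<bar>\<Sum>n=1..N. \<kappa> n / n\<bar> \<le> real (2 * M) / (real N + 1)"
    using abs_partial_sum_minus_L1_le[of N] L by (simp add: add.commute)
  have "(\<Sum>n=1..N. \<kappa> n * (t ^ n / s n)) = (\<Sum>n=1..N. \<kappa> n / n) - (\<Sum>n=1..N. \<kappa> n * c n)"
    by (simp add: c_def algebra_simps sum_subtractf)
  then have C: "(\<Sum>n=1..N. \<kappa> n * (t ^ n / s n)) \<le> real (2 * M) * (1 - t) + real (2 * M) / (real N + 1)"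
    using A B by linarith
  \<comment> \<open>A truncated geometric series: the first omitted exponent d (floor(N/d) + 1)
    exceeds N, so the tail costs at most t^N. Summed over d this is the error N t^N.\<close>
  have inner: "\<kappa> d * ((1 - t) * (\<Sum>m=1..N div d. t ^ (d * m))) \<le> \<kappa> d * (t ^ d / s d) + t ^ N"
    if d: "d \<in> {1..N}" for d
  proof -
    define K where "K = N div d"
    have sd: "s d \<ge> 1" using d by (intro s1) auto
    have td: "t ^ d < 1" using t d by (intro power_Suc_less_one power_less_one_iff[THEN iffD2]) auto
    have "(1 - t ^ d) * (\<Sum>m=1..K. (t ^ d) ^ m) = t ^ d - t ^ d * (t ^ d) ^ K"
    proof (induction K)
      case (Suc K)
      have eq: "(1 - t ^ d) * (\<Sum>m=1..Suc K. (t ^ d) ^ m) =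
          (1 - t ^ d) * (\<Sum>m=1..K. (t ^ d) ^ m) + (1 - t ^ d) * (t ^ d) ^ Suc K"
        by (simp add: distrib_left del: power_Suc)
      show ?case unfolding eq Suc by (simp add: algebra_simps)
    qed simp
    then have "s d * ((1 - t) * (\<Sum>m=1..K. t ^ (d * m))) = t ^ d - t ^ d * t ^ (d * K)"
      by (simp only: geo power_mult[symmetric] mult_ac)
    then have "s d * ((1 - t) * (\<Sum>m=1..K. t ^ (d * m))) = t ^ d - t ^ (d * (K + 1))"
      by (simp add: power_add)
    then have eq: "(1 - t) * (\<Sum>m=1..K. t ^ (d * m)) = t ^ d / s d - t ^ (d * (K + 1)) / s d"
      using sd by (simp add: field_simps)
    have "N < d * (K + 1)" unfolding K_def
      using d dividend_less_times_div[of d N] by simp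
    then have "t ^ (d * (K + 1)) \<le> t ^ N" using t by (intro power_decreasing) auto
    moreover have "t ^ (d * (K + 1)) / s d \<le> t ^ (d * (K + 1))"
      using sd t by (simp add: field_simps)
    ultimately have "t ^ (d * (K + 1)) / s d \<le> t ^ N" by linarith
    moreover have "0 \<le> t ^ (d * (K + 1)) / s d" using sd t by simp
    ultimately have "- \<kappa> d * (t ^ (d * (K + 1)) / s d) \<le> t ^ N"
      using abs_chi_le[of d] mult_mono[of "- \<kappa> d" 1 "t ^ (d * (K + 1)) / s d" "t ^ N"] t by simp
    then show ?thesis unfolding K_def[symmetric] eq by (simp add: algebra_simps)
  qed
  have "(\<Sum>k=1..N. (\<Sum>d | d dvd k. \<kappa> d) * t ^ k) = (\<Sum>k=1..N. \<Sum>d | d dvd k. \<kappa> d * t ^ (d * (k div d)))"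
    by (auto simp: sum_distrib_right intro!: sum.cong)
  also have "\<dots> = (\<Sum>d=1..N. \<Sum>m=1..N div d. \<kappa> d * t ^ (d * m))"
    by (rule sum_divisors_swap)
  finally have "(1 - t) * (\<Sum>k=1..N. (\<Sum>d | d dvd k. \<kappa> d) * t ^ k) =
      (\<Sum>d=1..N. \<kappa> d * ((1 - t) * (\<Sum>m=1..N div d. t ^ (d * m))))"
    by (simp add: sum_distrib_left mult_ac)
  also have "\<dots> \<le> (\<Sum>d=1..N. \<kappa> d * (t ^ d / s d) + t ^ N)"
    by (intro sum_mono inner)
  also have "\<dots> = (\<Sum>d=1..N. \<kappa> d * (t ^ d / s d)) + N * t ^ N"
    by (simp add: sum.distrib)
  finally show ?thesis using C by simp
qed

text \<open>Keep only the square indices of the Lambert series, where the coefficients are at least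
  1. For fixed t < 1 the truncation errors vanish as N grows, and division by 1 - t leaves at most
  2M for the sum of t^(j^2). As t tends to 1, the first 2M + 1 squares alone exceed this.\<close>

theorem L1_nonzero: "L1 \<noteq> 0"
proof
  assume L: "L1 = 0"
  define J where "J = 2 * M + 1"
  have bound: "(\<Sum>j=1..J. t ^ (j ^ 2)) \<le> 2 * M" if t: "0 < t" "t < 1" for t :: real
  proof -
    define r where "r = (\<lambda>k. \<Sum>d | d dvd k. \<kappa> d)"
    have le: "(1 - t) * (\<Sum>j=1..J. t ^ (j ^ 2)) \<le> real (2 * M) * (1 - t) + real (2 * M) / (real N + 1) + real N * t ^ N"
      if N: "N \<ge> J ^ 2" for N
    proof -
      have "(\<Sum>j=1..J. t ^ (j ^ 2)) = (\<Sum>k\<in>(\<lambda>j. j ^ 2) ` {1..J}. t ^ k)"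
        by (subst sum.reindex) (auto simp: inj_on_def power2_eq_iff)
      also have "\<dots> \<le> (\<Sum>k\<in>(\<lambda>j. j ^ 2) ` {1..J}. r k * t ^ k)"
      proof (rule sum_mono)
        fix k assume "k \<in> (\<lambda>j. j ^ 2) ` {1..J}"
        then have "1 \<le> r k" using sum_divisors_chi_ge[of k] by (auto simp: r_def)
        then show "t ^ k \<le> r k * t ^ k" using t by simp
      qed
      also have "\<dots> \<le> (\<Sum>k=1..N. r k * t ^ k)"
      proof (rule sum_mono2)
        show "(\<lambda>j. j ^ 2) ` {1..J} \<subseteq> {1..N}"
          using N by (auto intro: order_trans[OF power_mono])
        fix k assume "k \<in> {1..N} - (\<lambda>j. j ^ 2) ` {1..J}"
        then show "0 \<le> r k * t ^ k"
          using sum_divisors_chi_ge[of k] t by (auto simp: r_def)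
      qed auto
      finally have "(1 - t) * (\<Sum>j=1..J. t ^ (j ^ 2)) \<le> (1 - t) * (\<Sum>k=1..N. r k * t ^ k)"
        using t by (intro mult_left_mono) auto
      then show ?thesis using lambert_partial_sum_le[OF t L, of N] by (simp add: r_def)
    qed
    have "(\<lambda>N. real (2 * M) * (1 - t) + real (2 * M) / (real N + 1) + real N * t ^ N) \<longlonglongrightarrow> real (2 * M) * (1 - t) + 0 + 0"
    proof (intro tendsto_add tendsto_const)
      have "(\<lambda>N. real (2 * M) * inverse (real (Suc N))) \<longlonglongrightarrow> real (2 * M) * 0"
        by (intro tendsto_mult_left LIMSEQ_inverse_real_of_nat)
      then show "(\<lambda>N. real (2 * M) / (real N + 1)) \<longlonglongrightarrow> 0"
        by (simp add: divide_inverse add.commute)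
      show "(\<lambda>N. real N * t ^ N) \<longlonglongrightarrow> 0"
        using powser_times_n_limit_0[of t] t by simp
    qed
    then have "(1 - t) * (\<Sum>j=1..J. t ^ (j ^ 2)) \<le> real (2 * M) * (1 - t) + 0 + 0"
      by (rule LIMSEQ_le_const) (use le in blast)
    then have "(1 - t) * (\<Sum>j=1..J. t ^ (j ^ 2)) \<le> (1 - t) * (2 * M)" by (simp add: mult_ac)
    then show ?thesis using t by simp
  qed
  have "((\<lambda>t::real. \<Sum>j=1..J. t ^ (j ^ 2)) \<longlongrightarrow> (\<Sum>j=1..J. 1 ^ (j ^ 2))) (at_left 1)"
    by (intro tendsto_intros)
  moreover have "\<forall>\<^sub>F t in at_left (1::real). (\<Sum>j=1..J. t ^ (j ^ 2)) \<le> 2 * M"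
    using bound unfolding eventually_at_left_field by (intro exI[of _ 0]) auto
  ultimately have "(\<Sum>j=1..J. 1 ^ (j ^ 2)) \<le> real (2 * M)"
    by (rule tendsto_upperbound) simp
  then show False by (simp add: J_def)
qed

section \<open>Mertens sums twisted by a character\<close>

lemma ln_over_self_decreasing:
  assumes "n \<ge> 3"
  shows "ln (real (Suc n)) / real (Suc n) \<le> ln (real n) / real n"
proof -
  have "exp 1 \<le> real n" using exp_le assms by simp
  then have ln1: "1 \<le> ln (real n)" using assms by (subst ln_ge_iff) auto
  have "real n * (ln (real (Suc n)) - ln (real n)) \<le> 1" using assms by (intro ln_Suc_diff_le) auto
  then have "real n * ln (real (Suc n)) \<le> real (Suc n) * ln (real n)"
    using ln1 assms by (simp add: algebra_simps)
  then show ?thesis using assms by (simp add: field_simps)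
qed

text \<open>Summation by parts again. The indices 1 and 2 are split off because log x / x decreases
  only from e on.\<close>

lemma sum_chi_ln_bounded: "\<exists>C. \<forall>N. \<bar>\<Sum>n=1..N. \<kappa> n * (ln n / n)\<bar> \<le> C"
proof (intro exI allI)
  fix N
  have sub: "(\<Sum>n=1..N. \<kappa> n * (ln n / n)) = (\<Sum>n\<in>{1..N} \<inter> {1,2}. \<kappa> n * (ln n / n)) + (\<Sum>n\<in>{3..<Suc N}. \<kappa> n * (ln n / n))"
    by (subst sum.union_disjoint[symmetric]) (auto intro!: sum.cong)
  have "\<bar>\<Sum>n\<in>{1..N} \<inter> {1,2}. \<kappa> n * (ln n / n)\<bar> \<le> (\<Sum>n\<in>{1..N} \<inter> {1,2}. ln n / n)"
  proof (rule order_trans[OF sum_abs sum_mono])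
    fix n :: nat
    assume "n \<in> {1..N} \<inter> {1,2}"
    then have "0 \<le> ln n / n" by auto
    then show "\<bar>\<kappa> n * (ln n / n)\<bar> \<le> ln n / n"
      using mult_right_mono[OF abs_chi_le[of n], of "ln n / n"] by (simp only: abs_mult abs_of_nonneg mult_1)
  qed
  also have "\<dots> \<le> (\<Sum>n\<in>{1,2::nat}. ln n / n)"
    by (rule sum_mono2) auto
  finally have 1: "\<bar>\<Sum>n\<in>{1..N} \<inter> {1,2}. \<kappa> n * (ln n / n)\<bar> \<le> (\<Sum>n\<in>{1,2::nat}. ln n / n)" .
  have "\<bar>\<Sum>n\<in>{3..<Suc N}. \<kappa> n * (ln n / n)\<bar> \<le> 2 * M * (ln (real 3) / real 3)"
    by (rule abs_sum_chi_mult_le) (auto intro: ln_over_self_decreasing simp del: of_nat_Suc)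
  then show "\<bar>\<Sum>n=1..N. \<kappa> n * (ln n / n)\<bar> \<le> (\<Sum>n\<in>{1,2::nat}. ln n / n) + 2 * M * (ln (real 3) / real 3)"
    using 1 sub by linarith
qed

text \<open>Decompose log as a divisor sum of \<open>mangoldt\<close> in the bounded sum of
  \<kappa>(n) log n / n. The inner sum over m is \<open>L1\<close> up to an error 2M d / N, and by
  Chebyshev the errors add up to at most 6N * 2M / N = 12M. So \<open>L1\<close> times the sum in
  question is bounded, and \<open>L1\<close> is not 0.\<close>

lemma sum_chi_mangoldt_bounded: "\<exists>C. \<forall>N. \<bar>\<Sum>d=1..N. \<kappa> d * (mangoldt d / d)\<bar> \<le> C"
proof -
  obtain C where C: "\<And>N. \<bar>\<Sum>n=1..N. \<kappa> n * (ln n / n)\<bar> \<le> C"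
    using sum_chi_ln_bounded by blast
  have "\<bar>\<Sum>d=1..N. \<kappa> d * (mangoldt d / d)\<bar> \<le> (C + 12 * M) / \<bar>L1\<bar>" for N
  proof (cases "N = 0")
    case True
    then show ?thesis using C[of 0] by simp
  next
    case False
    define E where "E = (\<lambda>d. (\<Sum>m=1..N div d. \<kappa> m / real m) - L1)"
    have "(\<Sum>n=1..N. \<kappa> n * (ln n / n)) =
        (\<Sum>n=1..N. \<Sum>d | d dvd n. \<kappa> d * (mangoldt d / d) * (\<kappa> (n div d) / real (n div d)))"
    proof (intro sum.cong refl)
      fix n assume n: "n \<in> {1..N}"
      have "\<kappa> n * (ln n / n) = (\<Sum>d | d dvd n. \<kappa> n * (mangoldt d / n))"
        using n mangoldt_sum[of n, where 'a = real] by (simp flip: sum_distrib_left sum_divide_distrib)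
      also have "\<dots> = (\<Sum>d | d dvd n. \<kappa> d * (mangoldt d / d) * (\<kappa> (n div d) / real (n div d)))"
      proof (intro sum.cong refl)
        fix d assume "d \<in> {d. d dvd n}"
        then obtain m where m: "n = d * m" by (auto elim: dvdE)
        then have "d > 0" "m > 0" using n by (auto intro: Nat.gr0I)
        then show "\<kappa> n * (mangoldt d / n) = \<kappa> d * (mangoldt d / d) * (\<kappa> (n div d) / real (n div d))"
          by (simp add: m chi_mult)
      qed
      finally show "\<kappa> n * (ln n / n) = (\<Sum>d | d dvd n. \<kappa> d * (mangoldt d / d) * (\<kappa> (n div d) / real (n div d)))" .
    qed
    also have "\<dots> = (\<Sum>d=1..N. \<Sum>m=1..N div d. \<kappa> d * (mangoldt d / d) * (\<kappa> m / real m))"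
      by (rule sum_divisors_swap)
    also have "\<dots> = (\<Sum>d=1..N. \<kappa> d * (mangoldt d / d) * (\<Sum>m=1..N div d. \<kappa> m / real m))"
      by (simp add: sum_distrib_left)
    finally have eq: "(\<Sum>n=1..N. \<kappa> n * (ln n / n)) =
        (\<Sum>d=1..N. \<kappa> d * (mangoldt d / d) * E d) +
        L1 * (\<Sum>d=1..N. \<kappa> d * (mangoldt d / d))"
      by (simp add: E_def algebra_simps sum_subtractf sum_distrib_left)
    have "\<bar>\<Sum>d=1..N. \<kappa> d * (mangoldt d / d) * E d\<bar> \<le>
        (\<Sum>d=1..N. mangoldt d * (2 * M / N))"
    proof (rule order_trans[OF sum_abs sum_mono])
      fix d assume d: "d \<in> {1..N}"
      have "N < d * (N div d + 1)" using d dividend_less_times_div[of d N] by simp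
      then have "real N < real d * (real (N div d) + 1)"
        by (metis of_nat_1 of_nat_add of_nat_less_iff of_nat_mult)
      then have "2 * M / (real (N div d) + 1) \<le> real d * (2 * M / N)"
        using False M_pos mult_left_mono[of "real N" "real d * (real (N div d) + 1)" "2 * real M"]
        by (simp add: field_simps)
      then have "\<bar>E d\<bar> \<le> real d * (2 * M / N)"
        using abs_partial_sum_minus_L1_le[of "N div d"] unfolding E_def by linarith
      then have "(mangoldt d / d) * \<bar>E d\<bar> \<le> (mangoldt d / d) * (real d * (2 * M / N))"
        by (intro mult_left_mono divide_nonneg_nonneg mangoldt_nonneg) auto
      also have "\<dots> = mangoldt d * (2 * M / N)" using d by simp
      finally have "(mangoldt d / d) * \<bar>E d\<bar> \<le> mangoldt d * (2 * M / N)" .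
      moreover have "\<bar>\<kappa> d\<bar> * ((mangoldt d / d) * \<bar>E d\<bar>)
          \<le> 1 * ((mangoldt d / d) * \<bar>E d\<bar>)"
        by (intro mult_right_mono abs_chi_le mult_nonneg_nonneg divide_nonneg_nonneg mangoldt_nonneg) auto
      ultimately show "\<bar>\<kappa> d * (mangoldt d / d) * E d\<bar> \<le> mangoldt d * (2 * M / N)"
        by (simp add: abs_mult)
    qed
    also have "\<dots> = (\<Sum>d=1..N. mangoldt d) * (2 * M / N)" by (simp only: sum_distrib_right)
    also have "\<dots> \<le> 6 * real N * (2 * M / N)"
      by (intro mult_right_mono sum_mangoldt_le) auto
    also have "\<dots> = 12 * M" using False by simp
    finally have "\<bar>L1 * (\<Sum>d=1..N. \<kappa> d * (mangoldt d / d))\<bar> \<le> C + 12 * M"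
      using C[of N] eq by linarith
    then show ?thesis using L1_nonzero by (simp add: abs_mult field_simps)
  qed
  then show ?thesis by blast
qed

lemma sum_chi_primes_bounded:
  "\<exists>C. \<forall>N. \<bar>\<Sum>p | p \<in> {1..N} \<and> prime p. \<kappa> p * (ln p / p)\<bar> \<le> C"
proof -
  obtain C where C: "\<And>N. \<bar>\<Sum>d=1..N. \<kappa> d * (mangoldt d / d)\<bar> \<le> C"
    using sum_chi_mangoldt_bounded by blast
  obtain C' where C': "\<And>N. (\<Sum>n=1..N. (mangoldt n - (if prime n then ln (real n) else 0)) / real n) \<le> C'"
    using sum_mangoldt_nonprime_bounded by blast
  have "\<bar>\<Sum>p | p \<in> {1..N} \<and> prime p. \<kappa> p * (ln p / p)\<bar> \<le> C + C'" for N
  proof -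
    define g where "g = (\<lambda>n. (mangoldt n - (if prime n then ln (real n) else 0)) / real n)"
    have g: "g n \<ge> 0" for n by (auto simp: g_def mangoldt_nonneg)
    have "(\<Sum>p | p \<in> {1..N} \<and> prime p. \<kappa> p * (ln p / p)) = (\<Sum>n=1..N. \<kappa> n * (mangoldt n / n) - \<kappa> n * g n)"
      by (rule sum.mono_neutral_cong_left) (auto simp: g_def)
    also have "\<dots> = (\<Sum>n=1..N. \<kappa> n * (mangoldt n / n)) - (\<Sum>n=1..N. \<kappa> n * g n)"
      by (simp add: sum_subtractf)
    finally have eq: "(\<Sum>p | p \<in> {1..N} \<and> prime p. \<kappa> p * (ln p / p)) =
      (\<Sum>n=1..N. \<kappa> n * (mangoldt n / n)) - (\<Sum>n=1..N. \<kappa> n * g n)" .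
    have "\<bar>\<Sum>n=1..N. \<kappa> n * g n\<bar> \<le> (\<Sum>n=1..N. g n)"
    proof (rule order_trans[OF sum_abs sum_mono])
      fix n show "\<bar>\<kappa> n * g n\<bar> \<le> g n"
        using mult_right_mono[OF abs_chi_le[of n] g[of n]] g[of n] by (simp add: abs_mult)
    qed
    then show ?thesis using eq C[of N] C'[of N] by (simp add: g_def)
  qed
  then show ?thesis by blast
qed

end

section \<open>Primes splitting in a multiquadratic field\<close>

text \<open>The sum starts at 3 because the character is tied to the Legendre symbol at odd primes;
  its value at 2 changes the bound by a constant. The prime q makes the character
  nontrivial.\<close>

lemma sum_Legendre_primes_bounded:
  assumes kappa: "is_quadratic_character m \<kappa> M" and q: "prime q" "odd q" "Legendre m (int q) = -1"
  shows "\<exists>C. \<forall>N. \<bar>\<Sum>p | p \<in> {3..N} \<and> prime p. real_of_int (Legendre m (int p)) * (ln p / p)\<bar> \<le> C"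
proof -
  note K = is_quadratic_characterD[OF kappa]
  interpret real_character "\<lambda>n. real_of_int (\<kappa> n)" M
  proof
    show "M > 0" by (rule K(1))
    show "real_of_int (\<kappa> 1) = 1" unfolding K(2) by simp
    show "real_of_int (\<kappa> (a * b)) = real_of_int (\<kappa> a) * real_of_int (\<kappa> b)" for a b
      unfolding K(3) by simp
    show "real_of_int (\<kappa> a) \<in> {-1, 0, 1}" for a using K(5)[of a] by auto
    show "real_of_int (\<kappa> (a + M)) = real_of_int (\<kappa> a)" for a unfolding K(4) ..
    show "(\<Sum>a<M. real_of_int (\<kappa> a)) = 0"
      using quadratic_character_sum_0[OF kappa q] by (metis of_int_0 of_int_sum)
  qed
  obtain C where C: "\<And>N. \<bar>\<Sum>p | p \<in> {1..N} \<and> prime p. real_of_int (\<kappa> p) * (ln p / p)\<bar> \<le> C"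
    using sum_chi_primes_bounded by blast
  have "\<bar>\<Sum>p | p \<in> {3..N} \<and> prime p. real_of_int (Legendre m (int p)) * (ln p / p)\<bar> \<le> C + \<bar>real_of_int (\<kappa> 2) * (ln (real 2) / real 2)\<bar>" for N
  proof -
    have 1: "(\<Sum>p | p \<in> {3..N} \<and> prime p. real_of_int (Legendre m (int p)) * (ln p / p)) =
        (\<Sum>p | p \<in> {3..N} \<and> prime p. real_of_int (\<kappa> p) * (ln p / p))"
    proof (intro sum.cong refl)
      fix p assume p: "p \<in> {p. p \<in> {3..N} \<and> prime p}"
      then have "odd p" using prime_odd_nat[of p] by auto
      then show "real_of_int (Legendre m (int p)) * (ln p / p) = real_of_int (\<kappa> p) * (ln p / p)"
        using p K(7)[of p] by simp
    qed
    have set: "{p. p \<in> {1..N} \<and> prime p} = {p. p \<in> {3..N} \<and> prime p} \<union> ({1..N} \<inter> {2})"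
    proof (intro equalityI subsetI)
      fix p assume p: "p \<in> {p. p \<in> {1..N} \<and> prime p}"
      then have "p = 2 \<or> 3 \<le> p" using prime_ge_2_nat[of p] by (simp add: le_less) linarith
      then show "p \<in> {p. p \<in> {3..N} \<and> prime p} \<union> ({1..N} \<inter> {2})"
        using p by (elim disjE) simp_all
    next
      fix p assume "p \<in> {p. p \<in> {3..N} \<and> prime p} \<union> ({1..N} \<inter> {2})"
      then show "p \<in> {p. p \<in> {1..N} \<and> prime p}" by (elim UnE) simp_all
    qed
    have "(\<Sum>p | p \<in> {1..N} \<and> prime p. real_of_int (\<kappa> p) * (ln p / p)) =
        (\<Sum>p | p \<in> {3..N} \<and> prime p. real_of_int (\<kappa> p) * (ln p / p)) +
        (\<Sum>p\<in>{1..N} \<inter> {2}. real_of_int (\<kappa> p) * (ln p / p))"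
      unfolding set by (rule sum.union_disjoint) auto
    moreover have "\<bar>\<Sum>p\<in>{1..N} \<inter> {2}. real_of_int (\<kappa> p) * (ln p / p)\<bar> \<le> \<bar>real_of_int (\<kappa> 2) * (ln (real 2) / real 2)\<bar>"
      by (cases "N \<ge> 2") auto
    ultimately show ?thesis using C[of N] unfolding 1 by linarith
  qed
  then show ?thesis by blast
qed

lemma sum_primes_ge: "\<exists>C. \<forall>N>0. ln (real N) - C \<le> (\<Sum>p | p \<in> {3..N} \<and> prime p. ln (real p) / real p)"
proof -
  obtain C where C: "\<And>N. (\<Sum>n=1..N. (mangoldt n - (if prime n then ln (real n) else 0)) / real n) \<le> C"
    using sum_mangoldt_nonprime_bounded by blast
  have "ln (real N) - (C + 1 + ln 2 / 2) \<le> (\<Sum>p | p \<in> {3..N} \<and> prime p. ln (real p) / real p)" if "N > 0" for N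
  proof -
    have "(\<Sum>n=1..N. (mangoldt n - (if prime n then ln (real n) else 0)) / real n) =
        (\<Sum>n=1..N. mangoldt n / real n) - (\<Sum>n=1..N. if prime n then ln n / n else 0)"
      unfolding sum_subtractf[symmetric] by (intro sum.cong) (auto simp: diff_divide_distrib)
    moreover have "(\<Sum>n=1..N. if prime n then ln n / n else 0) \<le> (\<Sum>p | p \<in> {3..N} \<and> prime p. ln (real p) / real p) + ln 2 / 2"
    proof -
      have "(\<Sum>n=1..N. if prime n then ln n / n else 0) \<le> (\<Sum>n\<in>{3..N} \<union> {2}. if prime n then ln n / n else 0)"
      proof (rule order.trans[OF eq_refl sum_mono2])
        show "(\<Sum>n=1..N. if prime n then ln n / n else 0) = (\<Sum>n\<in>{1..N} - {1}. if prime n then ln n / n else 0)"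
          by (rule sum.mono_neutral_right) auto
      qed auto
      also have "\<dots> = (\<Sum>n\<in>{3..N}. if prime n then ln n / n else 0) + ln 2 / 2"
        by (subst sum.union_disjoint) auto
      also have "(\<Sum>n\<in>{3..N}. if prime n then ln n / n else 0) = (\<Sum>p | p \<in> {3..N} \<and> prime p. ln (real p) / real p)"
        by (rule sum.mono_neutral_cong_right) auto
      finally show ?thesis .
    qed
    ultimately show ?thesis using C[of N] sum_mangoldt_div_ge[OF that] by linarith
  qed
  then show ?thesis by blast
qed

text \<open>These primes split in the field of square roots of \<open>D\<close> and are inert in the
  Gaussian field: they contribute fully to the sum for \<open>L\<close> and little to the one for
  L(i).\<close>

definition split_primes :: "nat set \<Rightarrow> nat set" where
  "split_primes D = {p. prime p \<and> p mod 4 = 3 \<and> (\<forall>d\<in>D. Legendre (int d) (int p) = 1)}"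

lemma odd_prod: "(\<And>d. d \<in> S \<Longrightarrow> odd d) \<Longrightarrow> odd (\<Prod>S :: nat)"
  by (induction S rule: infinite_finite_induct) auto

lemma split_primes_diverge:
  assumes fin: "finite D" and D: "\<And>d. d \<in> D \<Longrightarrow> odd d" "\<And>d. d \<in> D \<Longrightarrow> Legendre (int d) 3 = 1"
    and indep: "\<And>S. S \<subseteq> D \<Longrightarrow> S \<noteq> {} \<Longrightarrow> \<exists>q. prime q \<and> odd q \<and> Legendre (int (\<Prod>S)) (int q) = -1"
  shows "\<exists>N. C < (\<Sum>p | p \<in> split_primes D \<and> p \<le> N. ln p / (real p + 1))"
proof -
  define P where "P = (\<lambda>N. {p::nat. p \<in> {3..N} \<and> prime p})"
  define l where "l = (\<lambda>m p. real_of_int (Legendre m (int p)))"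
  have P_finite [simp]: "finite (P N)" for N
    by (rule finite_subset[of _ "{3..N}"]) (auto simp: P_def)
  have oddS: "odd (\<Prod>S)" if "S \<subseteq> D" for S using that D(1) by (intro odd_prod) auto
  have "\<exists>C. \<forall>N. \<bar>\<Sum>p\<in>P N. l (int (\<Prod>S)) p * (ln p / p)\<bar> \<le> C" if S: "S \<subseteq> D" "S \<noteq> {}" for S
  proof -
    obtain q where "prime q" "odd q" "Legendre (int (\<Prod>S)) (int q) = -1"
      using indep[OF S] by blast
    moreover obtain \<kappa> M where "is_quadratic_character (int (\<Prod>S)) \<kappa> M"
      using quadratic_character_exists[OF oddS[OF S(1)]] by blast
    ultimately show ?thesis unfolding P_def l_def using sum_Legendre_primes_bounded by blast
  qed
  then obtain C1 where C1: "\<And>S N. S \<subseteq> D \<Longrightarrow> S \<noteq> {} \<Longrightarrow> \<bar>\<Sum>p\<in>P N. l (int (\<Prod>S)) p * (ln p / p)\<bar> \<le> C1 S"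
    by metis
  have "\<exists>C. \<forall>N. \<bar>\<Sum>p\<in>P N. l (- int (\<Prod>S)) p * (ln p / p)\<bar> \<le> C" if S: "S \<subseteq> D" for S
  proof -
    have p3: "prime (3::nat)" "2 < (3::nat)" by simp_all
    have "Legendre (int (\<Prod>S)) (int 3) = (\<Prod>d\<in>S. Legendre (int d) (int 3))"
      unfolding of_nat_prod by (rule Legendre_prod[OF p3])
    also have "\<dots> = 1" using S D(2) by (intro prod.neutral) auto
    finally have "Legendre (- int (\<Prod>S)) (int 3) = -1"
      using Legendre_mult[OF p3, of "-1" "int (\<Prod>S)"] Legendre_minus_1[OF p3] by (simp add: chi4_def)
    moreover obtain \<kappa> M where "is_quadratic_character (- int (\<Prod>S)) \<kappa> M"
      using quadratic_character_neg_exists[OF oddS[OF S]] by blast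
    ultimately show ?thesis unfolding P_def l_def using sum_Legendre_primes_bounded[of _ _ _ 3] p3 by auto
  qed
  then obtain C2 where C2: "\<And>S N. S \<subseteq> D \<Longrightarrow> \<bar>\<Sum>p\<in>P N. l (- int (\<Prod>S)) p * (ln p / p)\<bar> \<le> C2 S"
    by metis
  obtain C3 where C3: "\<And>N. N > 0 \<Longrightarrow> ln (real N) - C3 \<le> (\<Sum>p\<in>P N. ln p / p)"
    using sum_primes_ge unfolding P_def by blast
  define K where "K = C3 + (\<Sum>S\<in>Pow D - {{}}. C1 S) + (\<Sum>S\<in>Pow D. C2 S)"
  \<comment> \<open>For odd p dividing no radicand, \<open>T p\<close> is \<open>W\<close> = 2 *
    2^|D| if p is in \<open>split_primes D\<close> and 0 otherwise. Expanding the product turns it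
    into a signed sum of the Legendre symbols of the numbers \<Prod>S and -\<Prod>S.\<close>
  define T where "T = (\<lambda>p. (1 - l (-1) p) * (\<Prod>d\<in>D. l (int d) p + 1))"
  have T_eq: "T p = (\<Sum>S\<in>Pow D. l (int (\<Prod>S)) p) - (\<Sum>S\<in>Pow D. l (- int (\<Prod>S)) p)" if "p \<in> P N" for p N
  proof -
    have p: "prime p" "2 < p" using that by (auto simp: P_def)
    have "(\<Prod>d\<in>D. l (int d) p + 1) = (\<Sum>S\<in>Pow D. \<Prod>d\<in>S. l (int d) p)"
      by (subst prod_add[OF fin]) simp
    also have "\<dots> = (\<Sum>S\<in>Pow D. l (int (\<Prod>S)) p)"
      unfolding l_def of_nat_prod Legendre_prod[OF p] by simp
    finally have 1: "(\<Prod>d\<in>D. l (int d) p + 1) = (\<Sum>S\<in>Pow D. l (int (\<Prod>S)) p)" .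
    have "l (- int n) p = l (-1) p * l (int n) p" for n
      using Legendre_mult[OF p, of "-1" "int n"] by (simp add: l_def)
    then show ?thesis unfolding T_def 1
      by (simp only: left_diff_distrib sum_distrib_left mult_1 sum_subtractf)
  qed
  have lower: "ln (real N) - K \<le> (\<Sum>p\<in>P N. T p * (ln p / p))" if N: "N > 0" for N
  proof -
    define A where "A = (\<lambda>m. \<Sum>p\<in>P N. l m p * (ln p / p))"
    have "(\<Sum>p\<in>P N. T p * (ln p / p)) = (\<Sum>p\<in>P N. ((\<Sum>S\<in>Pow D. l (int (\<Prod>S)) p) - (\<Sum>S\<in>Pow D. l (- int (\<Prod>S)) p)) * (ln p / p))"
      by (intro sum.cong refl) (simp add: T_eq)
    also have "\<dots> = (\<Sum>S\<in>Pow D. A (int (\<Prod>S))) - (\<Sum>S\<in>Pow D. A (- int (\<Prod>S)))"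
      unfolding A_def sum.swap[of _ _ "Pow D"]
      by (simp only: left_diff_distrib sum_subtractf sum_distrib_right)
    \<comment> \<open>The empty set gives the trivial character and with it the growth of ln N.
      Every other character sum is bounded independently of N.\<close>
    also have "(\<Sum>S\<in>Pow D. A (int (\<Prod>S))) = A (int (\<Prod>{})) + (\<Sum>S\<in>Pow D - {{}}. A (int (\<Prod>S)))"
      using fin by (intro sum.remove) auto
    finally have eq: "(\<Sum>p\<in>P N. T p * (ln p / p)) =
        A (int (\<Prod>{})) + (\<Sum>S\<in>Pow D - {{}}. A (int (\<Prod>S))) - (\<Sum>S\<in>Pow D. A (- int (\<Prod>S)))" .
    have "A (int (\<Prod>{})) = (\<Sum>p\<in>P N. ln p / p)"
      unfolding A_def l_def by (intro sum.cong refl) (auto simp: P_def Legendre_1)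
    then have 1: "ln (real N) - C3 \<le> A (int (\<Prod>{}))" using C3[OF N] by simp
    have "(\<Sum>S\<in>Pow D - {{}}. - C1 S) \<le> (\<Sum>S\<in>Pow D - {{}}. A (int (\<Prod>S)))"
      using C1 unfolding A_def by (intro sum_mono) (auto simp: abs_le_iff minus_le_iff)
    then have 2: "- (\<Sum>S\<in>Pow D - {{}}. C1 S) \<le> (\<Sum>S\<in>Pow D - {{}}. A (int (\<Prod>S)))"
      by (simp add: sum_negf)
    have 3: "(\<Sum>S\<in>Pow D. A (- int (\<Prod>S))) \<le> (\<Sum>S\<in>Pow D. C2 S)"
      using C2 unfolding A_def by (intro sum_mono) (auto simp: abs_le_iff)
    show ?thesis unfolding eq K_def using 1 2 3 by linarith
  qed
  \<comment> \<open>At a prime dividing a radicand a factor of \<open>T\<close> may be 1, so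
    \<open>T\<close> can be positive although the prime is not split. There are finitely many such
    primes, and they cost a constant.\<close>
  define E where "E = {p. prime p \<and> p dvd \<Prod>D}"
  have D0: "\<Prod>D \<noteq> 0" using oddS[of D] by (metis even_zero order_refl)
  have E_fin: "finite E" unfolding E_def using D0 by (intro finite_subset[OF _ finite_divisors_nat[of "\<Prod>D"]]) auto
  define W where "W = 2 * (2::real) ^ card D"
  have upper: "T p \<le> W * ((if p \<in> split_primes D then 1 else 0) + (if p \<in> E then 1 else 0))" if "p \<in> P N" for p N
  proof -
    have p: "prime p" "2 < p" using that by (auto simp: P_def)
    have lv: "l m p \<in> {-1, 0, 1}" for m using Legendre_values[of m "int p"] by (auto simp: l_def)
    have f: "0 \<le> l m p + 1" "l m p + 1 \<le> 2" for m using lv[of m] by auto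
    have "(\<Prod>d\<in>D. l (int d) p + 1) \<le> (\<Prod>d\<in>D. 2)" by (intro prod_mono) (use f in auto)
    then have b1: "(\<Prod>d\<in>D. l (int d) p + 1) \<le> 2 ^ card D" by simp
    have b0: "0 \<le> (\<Prod>d\<in>D. l (int d) p + 1)" by (intro prod_nonneg) (use f in auto)
    have b2: "1 - l (-1) p \<le> 2" "0 \<le> 1 - l (-1) p" using lv[of "-1"] by auto
    have "T p \<le> W" unfolding T_def W_def using b0 b1 b2 by (intro mult_mono) auto
    moreover have "T p = 0" if np: "p \<notin> split_primes D" "p \<notin> E"
    proof (cases "p mod 4 = 3")
      case True
      then obtain d where d: "d \<in> D" "Legendre (int d) (int p) \<noteq> 1"
        using np p by (auto simp: split_primes_def)
      have "\<not> p dvd d" using np p d fin by (auto simp: E_def dvd_prod_eqI intro: dvd_trans)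
      then have "Legendre (int d) (int p) \<noteq> 0" by (simp add: Legendre_eq_0_iff)
      then have "l (int d) p + 1 = 0" using d Legendre_values[of "int d" "int p"] by (auto simp: l_def)
      then have "(\<Prod>d\<in>D. l (int d) p + 1) = 0" using d fin by (intro prod_zero) auto
      then show ?thesis by (simp add: T_def)
    next
      case False
      have "odd p" using p prime_odd_nat by auto
      then have "p mod 4 = 1" using False by presburger
      then show ?thesis using Legendre_minus_1[OF p] by (simp add: T_def l_def chi4_def)
    qed
    moreover have "W > 0" by (simp add: W_def)
    ultimately show ?thesis by auto
  qed
  define F where "F = (\<Sum>p\<in>E. ln p / p)"
  have ineq: "ln (real N) - K \<le> 2 * W * (\<Sum>p | p \<in> split_primes D \<and> p \<le> N. ln p / (real p + 1)) + W * F" if N: "N > 0" for N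
  proof -
    have pos: "0 \<le> ln (real p) / real p" for p :: nat by (cases "p = 0") auto
    have "ln (real N) - K \<le> (\<Sum>p\<in>P N. T p * (ln p / p))" by (rule lower[OF N])
    also have "\<dots> \<le> (\<Sum>p\<in>P N. W * ((if p \<in> split_primes D then 1 else 0) + (if p \<in> E then 1 else 0)) * (ln p / p))"
      using upper pos by (intro sum_mono mult_right_mono) auto
    also have "\<dots> = W * (\<Sum>p\<in>P N. if p \<in> split_primes D then ln p / p else 0) + W * (\<Sum>p\<in>P N. if p \<in> E then ln p / p else 0)"
      unfolding sum_distrib_left sum.distrib[symmetric] by (intro sum.cong refl) auto
    also have "(\<Sum>p\<in>P N. if p \<in> E then ln p / p else 0) \<le> F"
    proof -
      have "(\<Sum>p\<in>P N. if p \<in> E then ln p / p else 0) = (\<Sum>p\<in>P N \<inter> E. ln p / p)"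
        by (rule sum.mono_neutral_cong_right) auto
      also have "\<dots> \<le> F" unfolding F_def using E_fin pos by (intro sum_mono2) auto
      finally show ?thesis .
    qed
    also have "(\<Sum>p\<in>P N. if p \<in> split_primes D then ln p / p else 0) \<le>
        2 * (\<Sum>p | p \<in> split_primes D \<and> p \<le> N. ln p / (real p + 1))"
    proof -
      have "(\<Sum>p\<in>P N. if p \<in> split_primes D then ln p / p else 0) = (\<Sum>p\<in>P N \<inter> split_primes D. ln p / p)"
        by (rule sum.mono_neutral_cong_right) auto
      also have "\<dots> \<le> (\<Sum>p\<in>P N \<inter> split_primes D. 2 * (ln p / (real p + 1)))"
      proof (rule sum_mono)
        fix p assume "p \<in> P N \<inter> split_primes D"
        then have "p \<ge> 3" by (auto simp: P_def)
        then have "ln (real p) / (2 * real p) \<le> ln (real p) / (real p + 1)"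
          by (intro divide_left_mono) auto
        then show "ln p / p \<le> 2 * (ln p / (real p + 1))" by simp
      qed
      also have "\<dots> = 2 * (\<Sum>p\<in>P N \<inter> split_primes D. ln p / (real p + 1))" by (simp add: sum_distrib_left)
      also have "(\<Sum>p\<in>P N \<inter> split_primes D. ln p / (real p + 1)) \<le> (\<Sum>p | p \<in> split_primes D \<and> p \<le> N. ln p / (real p + 1))"
      proof (rule sum_mono2)
        show "finite {p \<in> split_primes D. p \<le> N}" by simp
        show "P N \<inter> split_primes D \<subseteq> {p \<in> split_primes D. p \<le> N}" by (auto simp: P_def)
        fix p show "0 \<le> ln (real p) / (real p + 1)" by (cases "p = 0") auto
      qed
      finally show ?thesis by simp
    qed
    finally show ?thesis by (simp add: W_def mult_ac)
  qed
  have W0: "W > 0" by (simp add: W_def)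
  \<comment> \<open>Obtained by solving \<open>ineq\<close> for the sum over split primes. One
    factor 2 in 2W comes from replacing p by p + 1 in the denominator.\<close>
  define B where "B = K + W * F + 2 * W * C"
  obtain N where N: "exp B < real N" using reals_Archimedean2 by blast
  have "0 < real N" using N exp_gt_zero[of B] by linarith
  then have "N > 0" by simp
  have "B < ln (real N)" using ln_less_cancel_iff[of "exp B" "real N"] N \<open>0 < real N\<close> by simp
  then have "2 * W * C < 2 * W * (\<Sum>p | p \<in> split_primes D \<and> p \<le> N. ln p / (real p + 1))"
    using ineq[OF \<open>N > 0\<close>] unfolding B_def by linarith
  then show ?thesis using W0 by auto
qed

section \<open>Successive choice of the radicands\<close>

lemma nonresidue_exists:
  assumes p: "prime p" "odd p"
  shows "\<exists>n. Legendre (int n) (int p) = -1"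
proof -
  have p2: "2 < p" using p by (rule prime_odd_gt_2)
  define f where "f = (\<lambda>a. a ^ 2 mod p)"
  have f1: "f 1 = 1" using p2 by (simp add: f_def)
  have "(p - 1) ^ 2 = (p - 2) * p + 1"
  proof -
    obtain k where "p = k + 2" using p2 by (metis add.commute le_Suc_ex less_imp_le_nat)
    then show ?thesis by (simp add: power2_eq_square algebra_simps)
  qed
  then have "f (p - 1) = ((p - 2) * p + 1) mod p" by (simp only: f_def)
  also have "\<dots> = 1 mod p" by (rule mod_mult_self3)
  finally have "f (p - 1) = 1" using p2 by simp
  \<comment> \<open>Squaring takes 1 and p - 1 to the same residue; a self-map of a finite set that
    is not injective is not surjective, and a residue that is missed is a nonresidue.\<close>
  then have "\<not> inj_on f {..<p}"
    using f1 p2 inj_onD[of f "{..<p}" 1 "p - 1"] by auto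
  then have "f ` {..<p} \<noteq> {..<p}" using eq_card_imp_inj_on[of "{..<p}" f] by auto
  moreover have "f ` {..<p} \<subseteq> {..<p}" using p2 by (auto simp: f_def)
  ultimately obtain n where n: "n < p" "n \<notin> f ` {..<p}" by blast
  have n0: "n \<noteq> 0"
  proof
    assume "n = 0"
    then have "n = f 0" using p2 by (simp add: f_def)
    then show False using n p2 by auto
  qed
  have "\<not> QuadRes (int p) (int n)"
  proof
    assume "QuadRes (int p) (int n)"
    then obtain y where y: "[y ^ 2 = int n] (mod int p)" by (auto simp: QuadRes_def)
    define a where "a = nat (y mod int p)"
    have a: "int a = y mod int p" using p2 by (simp add: a_def)
    have "int (f a) = (y mod int p) ^ 2 mod int p" by (simp add: f_def a zmod_int)
    also have "\<dots> = int n" using y n(1) unfolding Cong.cong_def power_mod by (simp flip: zmod_int)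
    finally have "f a = n" by simp
    moreover have "a < p" using a p2 by (metis of_nat_less_iff pos_mod_bound of_nat_0_less_iff prime_gt_0_nat p(1))
    ultimately show False using n by auto
  qed
  moreover have "\<not> p dvd n" using n(1) n0 by (auto dest: dvd_imp_le)
  ultimately have "Legendre (int n) (int p) = -1"
    by (simp add: Legendre_def cong_0_iff)
  then show ?thesis ..
qed

lemma odd_with_prescribed_Legendre:
  assumes Q: "finite Q" "\<And>p. p \<in> Q \<Longrightarrow> prime p \<and> odd p" and c: "\<And>p. p \<in> Q \<Longrightarrow> c p = 1 \<or> c p = -1"
  shows "\<exists>d. odd d \<and> (\<forall>p\<in>Q. Legendre (int d) (int p) = c p)"
proof -
  have "\<exists>n. Legendre (int n) (int p) = c p" if "p \<in> Q" for p
  proof -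
    have "Legendre (int 1) (int p) = 1" using Legendre_1 Q(2)[OF that] prime_odd_gt_2 by simp
    then show ?thesis using c[OF that] nonresidue_exists[of p] Q(2)[OF that] by metis
  qed
  then obtain n where n: "\<And>p. p \<in> Q \<Longrightarrow> Legendre (int (n p)) (int p) = c p" by metis
  \<comment> \<open>The modulus 2 with residue 1 is added to make the solution odd.\<close>
  have "\<exists>x. \<forall>p\<in>insert 2 Q. [x = (if p = 2 then 1 else n p)] (mod p)"
  proof (rule chinese_remainder_nat)
    show "\<forall>p\<in>insert 2 Q. \<forall>q\<in>insert 2 Q. p \<noteq> q \<longrightarrow> coprime p q"
      using Q(2) by (intro ballI impI primes_coprime) auto
  qed (use Q in simp)
  then obtain d where d: "\<And>p. p \<in> insert 2 Q \<Longrightarrow> [d = (if p = 2 then 1 else n p)] (mod p)" by blast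
  have "[d = 1] (mod 2)" using d[of 2] by simp
  then have "odd d" unfolding Cong.cong_def by presburger
  moreover have "Legendre (int d) (int p) = c p" if p: "p \<in> Q" for p
  proof -
    have "p \<noteq> 2" using Q(2)[OF p] by auto
    then have "[d = n p] (mod p)" using d[of p] p by simp
    then have "[int d = int (n p)] (mod int p)" by (simp add: cong_int_iff)
    then show ?thesis using Legendre_cong n[OF p] by simp
  qed
  ultimately show ?thesis by blast
qed

lemma split_primesD:
  assumes "p \<in> split_primes D"
  shows "prime p" "p mod 4 = 3" "odd p" "\<And>d. d \<in> D \<Longrightarrow> Legendre (int d) (int p) = 1"
  using assms by (auto simp: split_primes_def) presburger

text \<open>The last condition makes the characters of \<open>\<rat>(\<surd>\<Prod>S)\<close> nontrivial. Those of \<open>\<rat>(\<surd>-\<Prod>S)\<close> take the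
  value \<open>-1\<close> at \<open>3\<close>.\<close>

definition good_radicands :: "nat set \<Rightarrow> bool" where
  "good_radicands D \<longleftrightarrow> finite D \<and> (\<forall>d\<in>D. odd d \<and> Legendre (int d) 3 = 1) \<and>
     (\<forall>S\<subseteq>D. S \<noteq> {} \<longrightarrow> (\<exists>q. prime q \<and> odd q \<and> Legendre (int (\<Prod>S)) (int q) = -1))"

text \<open>If \<open>S\<close> contains d, the prime q itself witnesses nontriviality: all other
  members of \<open>S\<close> are squares modulo q and d is not. If not, the witness is inherited
  from \<open>D\<close>.\<close>

lemma good_radicands_insert:
  assumes D: "good_radicands D" and d: "odd d" "Legendre (int d) 3 = 1"
    and q: "q \<in> split_primes D" "Legendre (int d) (int q) = -1"
  shows "good_radicands (insert d D)"
  unfolding good_radicands_def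
proof (intro conjI ballI allI impI)
  show "finite (insert d D)" using D by (simp add: good_radicands_def)
  show "odd e" "Legendre (int e) 3 = 1" if "e \<in> insert d D" for e
    using that d D by (auto simp: good_radicands_def)
  fix S assume S: "S \<subseteq> insert d D" "S \<noteq> {}"
  show "\<exists>q. prime q \<and> odd q \<and> Legendre (int (\<Prod>S)) (int q) = -1"
  proof (cases "d \<in> S")
    case True
    note Q = split_primesD[OF q(1)]
    have q2: "2 < q" using Q by (intro prime_odd_gt_2)
    have finS: "finite S" using S D by (auto simp: good_radicands_def intro: finite_subset)
    have "Legendre (int (\<Prod>S)) (int q) = (\<Prod>e\<in>S. Legendre (int e) (int q))"
      unfolding of_nat_prod by (rule Legendre_prod[OF Q(1) q2])
    also have "\<dots> = Legendre (int d) (int q) * (\<Prod>e\<in>S - {d}. Legendre (int e) (int q))"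
      by (rule prod.remove[OF finS True])
    also have "(\<Prod>e\<in>S - {d}. Legendre (int e) (int q)) = 1"
      using S Q(4) by (intro prod.neutral) auto
    finally show ?thesis using Q q by auto
  next
    case False
    then have "S \<subseteq> D" using S by auto
    then show ?thesis using D S by (auto simp: good_radicands_def)
  qed
qed

lemma extend_radicands:
  assumes D: "good_radicands D" and N: "3 \<le> N"
  shows "\<exists>N' d q. N < N' \<and> good_radicands (insert d D) \<and> q \<in> split_primes D \<and>
      Legendre (int d) (int q) = -1 \<and>
      (\<forall>p. prime p \<longrightarrow> p mod 4 = 1 \<longrightarrow> p \<le> N' \<longrightarrow> Legendre (int d) (int p) = -1) \<and>
      (\<forall>p. prime p \<longrightarrow> p mod 4 = 3 \<longrightarrow> p \<le> N \<longrightarrow> Legendre (int d) (int p) = 1) \<and>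
      1 \<le> (\<Sum>p | p \<in> split_primes (insert d D) \<and> N < p \<and> p \<le> N'. ln (real p) / (real p + 1))"
proof -
  define w where "w = (\<lambda>p. ln (real p) / (real p + 1))"
  have w0: "0 \<le> w p" for p unfolding w_def by (cases "p = 0") auto
  have w1: "w p \<le> 1" for p
  proof (cases "p = 0")
    case False
    then have "ln (real p) \<le> real p + 1" using ln_le_minus_one[of "real p"] by simp
    then show ?thesis using False by (simp add: w_def)
  qed (simp add: w_def)
  define U where "U = (\<lambda>N. {p. p \<in> split_primes D \<and> p \<le> N})"
  have U_fin [simp]: "finite (U N)" for N by (simp add: U_def)
  \<comment> \<open>A surplus of 2 pays for two things: one split prime q, of weight at most 1, is
    sacrificed to make d a nonresidue, and weight at least 1 has to survive.\<close>
  obtain N' where N': "2 + sum w (U N) < sum w (U N')"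
    using split_primes_diverge[of D "2 + sum w (U N)"] D
    unfolding good_radicands_def U_def w_def by blast
  define V where "V = {p. p \<in> split_primes D \<and> N < p \<and> p \<le> N'}"
  have V_fin [simp]: "finite V" by (simp add: V_def)
  have "N < N'"
  proof (rule ccontr)
    assume "\<not> N < N'"
    then have "U N' \<subseteq> U N" by (auto simp: U_def)
    then have "sum w (U N') \<le> sum w (U N)" using w0 by (intro sum_mono2) auto
    then show False using N' by simp
  qed
  then have "U N' = U N \<union> V" "U N \<inter> V = {}" by (auto simp: U_def V_def)
  then have V2: "2 < sum w V" using N' by (simp add: sum.union_disjoint)
  then have "V \<noteq> {}" by auto
  then obtain q where q: "q \<in> V" by blast
  define Q where "Q = {p. prime p \<and> odd p \<and> p \<le> N'}"
  \<comment> \<open>The symbols prescribed for d: -1 at every prime that is 1 modulo 4 and at q, and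
    1 at the other primes that are 3 modulo 4. As 3 \<le> N < q, the symbol at 3 is 1, as
    \<open>good_radicands\<close> demands.\<close>
  define c where "c = (\<lambda>p::nat. if p mod 4 = 3 \<and> p \<noteq> q then 1 else -1 :: int)"
  have "\<exists>d. odd d \<and> (\<forall>p\<in>Q. Legendre (int d) (int p) = c p)"
    by (rule odd_with_prescribed_Legendre) (auto simp: Q_def c_def)
  then obtain d where d: "odd d" "\<And>p. p \<in> Q \<Longrightarrow> Legendre (int d) (int p) = c p"
    by blast
  have q': "q \<in> split_primes D" "N < q" "q \<le> N'" using q by (auto simp: V_def)
  have dq: "Legendre (int d) (int q) = -1"
    using d(2)[of q] split_primesD[OF q'(1)] q' by (simp add: Q_def c_def)
  have p4: "odd p" if "p mod 4 = 3 \<or> p mod 4 = 1" for p :: nat using that by presburger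
  have d3: "Legendre (int d) 3 = 1"
    using d(2)[of 3] N \<open>N < N'\<close> q' by (simp add: Q_def c_def)
  have "1 \<le> sum w (V - {q})" using V2 w1[of q] by (simp add: sum_diff1 q)
  also have "\<dots> \<le> sum w {p. p \<in> split_primes (insert d D) \<and> N < p \<and> p \<le> N'}"
  proof (rule sum_mono2)
    show "V - {q} \<subseteq> {p. p \<in> split_primes (insert d D) \<and> N < p \<and> p \<le> N'}"
    proof
      fix p assume p: "p \<in> V - {q}"
      then have "p \<in> split_primes D" by (simp add: V_def)
      note P = split_primesD[OF this]
      have "Legendre (int d) (int p) = 1" using d(2)[of p] p P by (simp add: Q_def V_def c_def)
      then show "p \<in> {p. p \<in> split_primes (insert d D) \<and> N < p \<and> p \<le> N'}"
        using p by (auto simp: V_def split_primes_def)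
    qed
  qed (use w0 in auto)
  finally have "1 \<le> (\<Sum>p | p \<in> split_primes (insert d D) \<and> N < p \<and> p \<le> N'. ln (real p) / (real p + 1))"
    by (simp add: w_def)
  moreover have "Legendre (int d) (int p) = -1" if "prime p" "p mod 4 = 1" "p \<le> N'" for p
    using d(2)[of p] that p4 by (simp add: Q_def c_def)
  moreover have "Legendre (int d) (int p) = 1" if "prime p" "p mod 4 = 3" "p \<le> N" for p
    using d(2)[of p] that p4 q' \<open>N < N'\<close> by (simp add: Q_def c_def)
  moreover have "good_radicands (insert d D)"
    using D d(1) d3 q'(1) dq by (rule good_radicands_insert)
  ultimately show ?thesis using \<open>N < N'\<close> q'(1) dq by blast
qed

text \<open>Each stage has a window between consecutive bounds in which the split primes weigh at
  least 1. Later radicands are squares modulo all primes that are 3 modulo 4 below that window's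
  upper end, so these primes stay split for ever and the weights accumulate without bound.\<close>

theorem radicands_exist:
  obtains d :: "nat \<Rightarrow> nat" where
    "\<And>k. \<exists>q\<in>split_primes (d ` {..<k}). Legendre (int (d k)) (int q) = -1"
    "\<And>p. prime p \<Longrightarrow> p mod 4 = 1 \<Longrightarrow> \<exists>k. Legendre (int (d k)) (int p) = -1"
    "\<And>C. \<exists>N. C < (\<Sum>p | p \<in> split_primes (range d) \<and> p \<le> N. ln (real p) / (real p + 1))"
proof -
  \<comment> \<open>A state consists of the radicands chosen so far, the bound up to which primes
    have been treated, and the radicand added last. In the initial state the last entry is a dummy,
    so \<open>d n\<close> is read from state n + 1.\<close>
  define R :: "nat set \<times> nat \<times> nat \<Rightarrow> nat set \<times> nat \<times> nat \<Rightarrow> bool" where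
    "R = (\<lambda>(D, N, e) (D', N', d). D' = insert d D \<and> N < N' \<and>
      (\<exists>q\<in>split_primes D. Legendre (int d) (int q) = -1) \<and>
      (\<forall>p. prime p \<longrightarrow> p mod 4 = 1 \<longrightarrow> p \<le> N' \<longrightarrow> Legendre (int d) (int p) = -1) \<and>
      (\<forall>p. prime p \<longrightarrow> p mod 4 = 3 \<longrightarrow> p \<le> N \<longrightarrow> Legendre (int d) (int p) = 1) \<and>
      1 \<le> (\<Sum>p | p \<in> split_primes (insert d D) \<and> N < p \<and> p \<le> N'. ln (real p) / (real p + 1)))"
  define I :: "nat \<Rightarrow> nat set \<times> nat \<times> nat \<Rightarrow> bool" where
    "I = (\<lambda>n (D, N, e). good_radicands D \<and> 3 \<le> N \<and> (n = 0 \<longrightarrow> D = {}))"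
  have "\<exists>f. \<forall>n. I n (f n) \<and> R (f n) (f (Suc n))"
  proof (rule dependent_nat_choice)
    have "good_radicands {}" by (simp add: good_radicands_def)
    then show "\<exists>x. I 0 x" by (intro exI[of _ "({}, 3, 0)"]) (simp add: I_def)
    fix x n assume x: "I n x"
    obtain D N e where xx: "x = (D, N, e)" by (cases x) auto
    obtain N' d q where "N < N'" "good_radicands (insert d D)" "q \<in> split_primes D"
      "Legendre (int d) (int q) = -1"
      "\<forall>p. prime p \<longrightarrow> p mod 4 = 1 \<longrightarrow> p \<le> N' \<longrightarrow> Legendre (int d) (int p) = -1"
      "\<forall>p. prime p \<longrightarrow> p mod 4 = 3 \<longrightarrow> p \<le> N \<longrightarrow> Legendre (int d) (int p) = 1"
      "1 \<le> (\<Sum>p | p \<in> split_primes (insert d D) \<and> N < p \<and> p \<le> N'. ln (real p) / (real p + 1))"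
      using extend_radicands[of D N] x unfolding xx I_def by blast
    then show "\<exists>y. I (Suc n) y \<and> R x y"
      using x by (intro exI[of _ "(insert d D, N', d)"]) (auto simp: I_def R_def xx)
  qed
  then obtain f where f: "\<And>n. I n (f n)" "\<And>n. R (f n) (f (Suc n))" by blast
  define D where "D = (\<lambda>n. fst (f n))"
  define N where "N = (\<lambda>n. fst (snd (f n)))"
  define d where "d = (\<lambda>n. snd (snd (f (Suc n))))"
  have step: "R (D n, N n, snd (snd (f n))) (D (Suc n), N (Suc n), d n)" for n
    using f(2)[of n] by (simp add: D_def N_def d_def)
  have R: "D (Suc n) = insert (d n) (D n)" "N n < N (Suc n)"
    "\<exists>q\<in>split_primes (D n). Legendre (int (d n)) (int q) = -1"
    "\<And>p. prime p \<Longrightarrow> p mod 4 = 1 \<Longrightarrow> p \<le> N (Suc n) \<Longrightarrow> Legendre (int (d n)) (int p) = -1"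
    "\<And>p. prime p \<Longrightarrow> p mod 4 = 3 \<Longrightarrow> p \<le> N n \<Longrightarrow> Legendre (int (d n)) (int p) = 1"
    "1 \<le> (\<Sum>p | p \<in> split_primes (D (Suc n)) \<and> N n < p \<and> p \<le> N (Suc n). ln (real p) / (real p + 1))" for n
    using step[of n] unfolding R_def by auto
  have D_eq: "D n = d ` {..<n}" for n
  proof (induction n)
    case 0
    then show ?case using f(1)[of 0] by (simp add: I_def D_def case_prod_beta)
  qed (simp add: R(1) lessThan_Suc)
  have mono: "strict_mono N" using R(2) by (simp add: strict_mono_Suc_iff)
  have 1: "\<exists>q\<in>split_primes (d ` {..<k}). Legendre (int (d k)) (int q) = -1" for k
    using R(3)[of k] by (simp add: D_eq)
  have 2: "\<exists>k. Legendre (int (d k)) (int p) = -1" if "prime p" "p mod 4 = 1" for p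
  proof -
    have "p \<le> N p" using strict_mono_imp_increasing[OF mono] by simp
    also have "\<dots> < N (Suc p)" by (rule R(2))
    finally show ?thesis using R(4)[OF that, of p] by auto
  qed
  define w where "w = (\<lambda>p. ln (real p) / (real p + 1))"
  have w0: "0 \<le> w p" for p unfolding w_def by (cases "p = 0") auto
  have split: "p \<in> split_primes (range d)" if p: "p \<in> split_primes (D (Suc n))" "p \<le> N (Suc n)" for p n
  proof -
    note P = split_primesD[OF p(1)]
    have "Legendre (int (d k)) (int p) = 1" for k
    proof (cases "k < Suc n")
      case True
      then show ?thesis using P(4) by (simp add: D_eq)
    next
      case False
      then have "N (Suc n) \<le> N k" using mono by (simp add: strict_mono_less_eq)
      then show ?thesis using R(5)[OF P(1,2), of k] p by simp
    qed
    then show ?thesis using P by (auto simp: split_primes_def)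
  qed
  have ge: "real n \<le> sum w {p. p \<in> split_primes (range d) \<and> p \<le> N n}" for n
  proof (induction n)
    case 0
    then show ?case using w0 by (simp add: sum_nonneg)
  next
    case (Suc n)
    let ?A = "{p. p \<in> split_primes (range d) \<and> p \<le> N n}"
    let ?B = "{p. p \<in> split_primes (D (Suc n)) \<and> N n < p \<and> p \<le> N (Suc n)}"
    have "real (Suc n) \<le> sum w ?A + sum w ?B" using Suc R(6)[of n] by (simp add: w_def)
    also have "\<dots> = sum w (?A \<union> ?B)" by (rule sum.union_disjoint[symmetric]) auto
    also have "\<dots> \<le> sum w {p. p \<in> split_primes (range d) \<and> p \<le> N (Suc n)}"
    proof (rule sum_mono2)
      show "?A \<union> ?B \<subseteq> {p. p \<in> split_primes (range d) \<and> p \<le> N (Suc n)}"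
        using split R(2)[of n] by auto
    qed (use w0 in auto)
    finally show ?case .
  qed
  have 3: "\<exists>N. C < sum w {p. p \<in> split_primes (range d) \<and> p \<le> N}" for C
  proof -
    obtain n where "C < real n" using reals_Archimedean2 by blast
    then show ?thesis using ge[of n] by (intro exI[of _ "N n"]) linarith
  qed
  show thesis by (rule that[of d]) (use 1 2 3 in \<open>auto simp: w_def\<close>)
qed

section \<open>Algebraic integers\<close>

definition int_span :: "complex set \<Rightarrow> complex set" where
  "int_span S = {(\<Sum>s\<in>S. of_int (c s) * s) | c. True}"

lemma int_spanI: "x = (\<Sum>s\<in>S. of_int (c s) * s) \<Longrightarrow> x \<in> int_span S"
  by (auto simp: int_span_def)

lemma int_span_0: "0 \<in> int_span S"
  by (rule int_spanI[of _ "\<lambda>_. 0"]) simp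

lemma int_span_add: "a \<in> int_span S \<Longrightarrow> b \<in> int_span S \<Longrightarrow> a + b \<in> int_span S"
proof -
  assume "a \<in> int_span S" "b \<in> int_span S"
  then obtain c d where "a = (\<Sum>s\<in>S. of_int (c s) * s)" "b = (\<Sum>s\<in>S. of_int (d s) * s)"
    by (auto simp: int_span_def)
  then have "a + b = (\<Sum>s\<in>S. of_int (c s + d s) * s)"
    by (simp add: distrib_right sum.distrib)
  then show ?thesis by (rule int_spanI)
qed

lemma int_span_mult: "a \<in> int_span S \<Longrightarrow> of_int k * a \<in> int_span S"
proof -
  assume "a \<in> int_span S"
  then obtain c where "a = (\<Sum>s\<in>S. of_int (c s) * s)"
    by (auto simp: int_span_def)
  then have "of_int k * a = (\<Sum>s\<in>S. of_int (k * c s) * s)"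
    by (simp add: sum_distrib_left mult.assoc)
  then show ?thesis by (rule int_spanI)
qed

lemma int_span_sum: "(\<And>i. i \<in> I \<Longrightarrow> f i \<in> int_span S) \<Longrightarrow> (\<Sum>i\<in>I. f i) \<in> int_span S"
  by (induction I rule: infinite_finite_induct) (auto intro: int_span_0 int_span_add)

lemma int_span_base: "finite S \<Longrightarrow> s \<in> S \<Longrightarrow> s \<in> int_span S"
proof (rule int_spanI)
  assume "finite S" "s \<in> S"
  then have "(\<Sum>t\<in>S. of_int (if t = s then 1 else 0) * t) = (\<Sum>t\<in>{s}. of_int (if t = s then 1 else 0) * t)"
    by (intro sum.mono_neutral_right) auto
  then show "s = (\<Sum>t\<in>S. of_int (if t = s then 1 else 0) * t)" by simp
qed

lemma int_span_stable:
  assumes "\<And>s. s \<in> S \<Longrightarrow> z * s \<in> int_span S" "a \<in> int_span S"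
  shows "z * a \<in> int_span S"
proof -
  obtain c where "a = (\<Sum>s\<in>S. of_int (c s) * s)"
    using assms(2) by (auto simp: int_span_def)
  then have "z * a = (\<Sum>s\<in>S. of_int (c s) * (z * s))"
    by (simp add: sum_distrib_left mult_ac)
  then show ?thesis using assms(1) by (auto intro!: int_span_sum int_span_mult)
qed

text \<open>The determinant trick: expressing each z * s through \<open>S\<close> gives an integer
  matrix for which the vector of the elements of \<open>S\<close> is an eigenvector with eigenvalue
  z, nonzero because of \<open>s0\<close>. Its characteristic polynomial is monic with integer
  coefficients.\<close>

lemma algebraic_int_if_stable:
  assumes S: "finite S" "s0 \<in> S" "s0 \<noteq> 0" and stable: "\<And>s. s \<in> S \<Longrightarrow> z * s \<in> int_span S"
  shows "algebraic_int z"
proof -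
  obtain xs where xs: "set xs = S" "distinct xs"
    using finite_distinct_list[OF S(1)] by blast
  define n where "n = length xs"
  have "\<exists>c. z * s = (\<Sum>t\<in>S. of_int (c t) * t)" if "s \<in> S" for s
    using stable[OF that] by (auto simp: int_span_def)
  then obtain c where c: "\<And>s. s \<in> S \<Longrightarrow> z * s = (\<Sum>t\<in>S. of_int (c s t) * t)" by metis
  define A :: "int mat" where "A = mat n n (\<lambda>(i, j). c (xs ! i) (xs ! j))"
  define B :: "complex mat" where "B = map_mat of_int A"
  define v where "v = vec n (\<lambda>i. xs ! i)"
  have A: "A \<in> carrier_mat n n" and B: "B \<in> carrier_mat n n" by (simp_all add: A_def B_def)
  have bij: "bij_betw (\<lambda>i. xs ! i) {0..<n} S"
    using xs by (intro bij_betw_nth) (auto simp: n_def)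
  have "eigenvector B v z"
    unfolding eigenvector_def
  proof (intro conjI)
    show "v \<in> carrier_vec (dim_row B)" using B by (simp add: v_def)
    show "v \<noteq> 0\<^sub>v (dim_row B)"
    proof
      assume v: "v = 0\<^sub>v (dim_row B)"
      obtain i where i: "i < n" "xs ! i = s0" using S(2) xs by (auto simp: n_def in_set_conv_nth)
      have "vec_index v i = 0" using v B i by simp
      then show False using i S(3) by (simp add: v_def)
    qed
    show "B *\<^sub>v v = z \<cdot>\<^sub>v v"
    proof (rule eq_vecI)
      fix i assume "i < dim_vec (z \<cdot>\<^sub>v v)"
      then have i: "i < n" by (simp add: v_def)
      have "vec_index (B *\<^sub>v v) i = (\<Sum>j\<in>{0..<n}. of_int (c (xs ! i) (xs ! j)) * xs ! j)"
        using i by (simp add: B_def A_def v_def scalar_prod_def)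
      also have "\<dots> = (\<Sum>t\<in>S. of_int (c (xs ! i) t) * t)"
        by (rule sum.reindex_bij_betw[OF bij])
      also have "\<dots> = z * xs ! i" using c[of "xs ! i"] i xs nth_mem[of i xs] by (simp add: n_def)
      finally show "vec_index (B *\<^sub>v v) i = vec_index (z \<cdot>\<^sub>v v) i" using i by (simp add: v_def)
    qed (simp add: v_def B_def A_def)
  qed
  then have "eigenvalue B z" unfolding eigenvalue_def by blast
  then have "poly (char_poly B) z = 0" using eigenvalue_root_char_poly[OF B] by simp
  then have "poly (map_poly of_int (char_poly A)) z = 0"
    unfolding B_def of_int_hom.char_poly_hom[OF A] .
  moreover have "lead_coeff (char_poly A) = 1" using degree_monic_char_poly[OF A] by auto
  ultimately show ?thesis unfolding algebraic_int_altdef_ipoly by blast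
qed

lemma power_degree_reduce:
  fixes x :: complex
  assumes "poly (map_poly of_int p) x = 0" "lead_coeff p = 1"
  shows "x ^ degree p = (\<Sum>i<degree p. of_int (- coeff p i) * x ^ i)"
proof -
  have "0 = (\<Sum>i\<le>degree p. of_int (coeff p i) * x ^ i)"
    using assms(1) by (simp add: poly_altdef degree_map_poly coeff_map_poly)
  also have "\<dots> = (\<Sum>i<degree p. of_int (coeff p i) * x ^ i) + x ^ degree p"
    using assms(2) by (simp flip: lessThan_Suc_atMost)
  finally show ?thesis by (simp add: sum_negf eq_neg_iff_add_eq_0 add.commute)
qed

text \<open>The group spanned by the products x^i y^j with i < m and j < n is stable under both x
  and y, since the monic equations rewrite x^m and y^n. Hence it is stable under x + y and x
  y.\<close>

lemma algebraic_int_plus_times: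
  fixes x y :: complex
  assumes x: "algebraic_int x" and y: "algebraic_int y"
  shows "algebraic_int (x + y)" "algebraic_int (x * y)"
proof -
  obtain p where p: "poly (map_poly of_int p) x = 0" "lead_coeff p = 1"
    using x unfolding algebraic_int_altdef_ipoly by blast
  obtain q where q: "poly (map_poly of_int q) y = 0" "lead_coeff q = 1"
    using y unfolding algebraic_int_altdef_ipoly by blast
  define m n where "m = degree p" and "n = degree q"
  have m: "m > 0" "n > 0"
    using p q by (auto simp: m_def n_def intro!: Nat.gr0I elim!: degree_eq_zeroE)
  define S where "S = (\<lambda>(i, j). x ^ i * y ^ j) ` ({..<m} \<times> {..<n})"
  have fin: "finite S" by (simp add: S_def)
  have S: "x ^ i * y ^ j \<in> int_span S" if "i < m" "j < n" for i j
    using that by (intro int_span_base[OF fin]) (auto simp: S_def)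
  have one: "1 \<in> S" using m by (force simp: S_def)
  have stx: "x * s \<in> int_span S" if "s \<in> S" for s
  proof -
    from that have "\<exists>i j. s = x ^ i * y ^ j \<and> i < m \<and> j < n" by (auto simp: S_def)
    then obtain i j where s: "s = x ^ i * y ^ j" "i < m" "j < n" by blast
    show ?thesis
    proof (cases "Suc i < m")
      case True
      then show ?thesis using S[of "Suc i" j] s by (simp add: mult_ac)
    next
      case False
      then have "x * s = x ^ m * y ^ j" using s by (metis Suc_lessI mult.assoc power_Suc)
      also have "\<dots> = (\<Sum>i<m. of_int (- coeff p i) * (x ^ i * y ^ j))"
        unfolding m_def power_degree_reduce[OF p] by (simp add: sum_distrib_right mult.assoc)
      finally show ?thesis using S s by (simp only:) (intro int_span_sum int_span_mult, auto)
    qed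
  qed
  have sty: "y * s \<in> int_span S" if "s \<in> S" for s
  proof -
    from that have "\<exists>i j. s = x ^ i * y ^ j \<and> i < m \<and> j < n" by (auto simp: S_def)
    then obtain i j where s: "s = x ^ i * y ^ j" "i < m" "j < n" by blast
    show ?thesis
    proof (cases "Suc j < n")
      case True
      then show ?thesis using S[of i "Suc j"] s by (simp add: mult_ac)
    next
      case False
      then have "y * s = x ^ i * y ^ n" using s by (metis Suc_lessI mult.left_commute power_Suc)
      also have "\<dots> = (\<Sum>j<n. of_int (- coeff q j) * (x ^ i * y ^ j))"
        unfolding n_def power_degree_reduce[OF q] by (simp add: sum_distrib_left mult_ac)
      finally show ?thesis using S s by (simp only:) (intro int_span_sum int_span_mult, auto)
    qed
  qed
  show "algebraic_int (x + y)"
    by (rule algebraic_int_if_stable[OF fin one]) (auto simp: distrib_right intro!: int_span_add stx sty)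
  show "algebraic_int (x * y)"
    by (rule algebraic_int_if_stable[OF fin one]) (auto simp: mult.assoc intro!: int_span_stable[OF stx] sty)
qed

section \<open>Multiquadratic fields\<close>

text \<open>Multiply the equation of degree n + 1 by c^n, with c its leading coefficient. In terms
  of y = c x the term of index i \<le> n becomes a_i c^(n-i) y^i and the top one y^(n+1), so the
  powers of y up to n span a module stable under y.\<close>

lemma algebraic_imp_multiple_algebraic_int:
  fixes x :: complex
  assumes "algebraic x"
  shows "\<exists>c::int. c \<noteq> 0 \<and> algebraic_int (of_int c * x)"
proof -
  obtain p :: "int poly" where p: "p \<noteq> 0" "poly (map_poly of_int p) x = 0"
    using assms by (elim algebraicE')
  define c where "c = lead_coeff p"
  have c: "c \<noteq> 0" using p by (simp add: c_def)
  have "degree p \<noteq> 0"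
  proof
    assume "degree p = 0"
    then obtain a where "p = [:a:]" by (elim degree_eq_zeroE)
    then show False using p by simp
  qed
  then obtain n where n: "degree p = Suc n" using not0_implies_Suc by blast
  define y where "y = of_int c * x"
  define S where "S = (\<lambda>i. y ^ i) ` {..n}"
  have fin: "finite S" and one: "1 \<in> S"
    by (auto simp: S_def intro!: image_eqI[where x = 0])
  have pow: "y ^ i \<in> int_span S" if "i \<le> n" for i
    using that by (intro int_span_base[OF fin]) (auto simp: S_def)
  have "0 = (\<Sum>i\<le>Suc n. of_int (coeff p i) * x ^ i)"
    using p(2) n by (simp add: poly_altdef degree_map_poly coeff_map_poly)
  then have "0 = of_int c ^ n * (\<Sum>i\<le>Suc n. of_int (coeff p i) * x ^ i)" by simp
  also have "\<dots> = of_int c ^ n * (\<Sum>i\<le>n. of_int (coeff p i) * x ^ i) + y ^ Suc n"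
    by (simp add: y_def c_def n power_mult_distrib algebra_simps)
  also have "of_int c ^ n * (\<Sum>i\<le>n. of_int (coeff p i) * x ^ i) = (\<Sum>i\<le>n. of_int (coeff p i * c ^ (n - i)) * y ^ i)"
    unfolding sum_distrib_left
  proof (rule sum.cong[OF refl])
    fix i assume "i \<in> {..n}"
    then have "of_int c ^ n = of_int c ^ (n - i) * (of_int c :: complex) ^ i"
      by (simp flip: power_add)
    then show "of_int c ^ n * (of_int (coeff p i) * x ^ i) = of_int (coeff p i * c ^ (n - i)) * y ^ i"
      by (simp add: y_def power_mult_distrib)
  qed
  finally have "y ^ Suc n = of_int (- 1) * (\<Sum>i\<le>n. of_int (coeff p i * c ^ (n - i)) * y ^ i)"
    by (simp add: add_eq_0_iff)
  moreover have "of_int (- 1) * (\<Sum>i\<le>n. of_int (coeff p i * c ^ (n - i)) * y ^ i) \<in> int_span S"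
    using pow by (intro int_span_mult int_span_sum) auto
  ultimately have top: "y ^ Suc n \<in> int_span S" by metis
  have "algebraic_int y"
  proof (rule algebraic_int_if_stable[OF fin one])
    fix s assume "s \<in> S"
    then obtain i where i: "s = y ^ i" "i \<le> n" by (auto simp: S_def)
    then have "y * s = y ^ Suc i" by simp
    then show "y * s \<in> int_span S"
      using i pow[of "Suc i"] top by (cases "i = n") auto
  qed simp
  then show ?thesis using c unfolding y_def by blast
qed

text \<open>Substituting c X into a monic equation of c x keeps integer coefficients; the leading
  one becomes a power of c and is not 0.\<close>

lemma algebraic_if_multiple_algebraic_int:
  fixes x :: complex
  assumes "c \<noteq> 0" "algebraic_int (of_int c * x)"
  shows "algebraic x"
proof -
  obtain p where p: "poly (map_poly of_int p) (of_int c * x) = 0" "lead_coeff p = 1"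
    using assms(2) unfolding algebraic_int_altdef_ipoly by blast
  define q :: "complex poly" where "q = (\<Sum>i\<le>degree p. monom (of_int (coeff p i * c ^ i)) i)"
  have coeff_q: "coeff q i = (if i \<le> degree p then of_int (coeff p i * c ^ i) else 0)" for i
    by (simp add: q_def coeff_sum)
  have "poly q x = poly (map_poly of_int p) (of_int c * x)"
    unfolding poly_altdef[of "map_poly of_int p"]
    by (simp add: q_def poly_sum poly_monom degree_map_poly coeff_map_poly power_mult_distrib mult.assoc)
  then have root: "poly q x = 0" using p by simp
  have int: "coeff q i \<in> \<int>" for i by (simp add: coeff_q)
  have nz: "q \<noteq> 0"
  proof
    assume "q = 0"
    then have "of_int (coeff p (degree p) * c ^ degree p) = (0 :: complex)"
      using coeff_q[of "degree p"] by simp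
    then show False unfolding p(2) using assms(1) by simp
  qed
  show ?thesis using int nz root by (rule algebraicI)
qed

lemma algebraic_plus_times:
  fixes x y :: complex
  assumes "algebraic x" "algebraic y"
  shows "algebraic (x + y)" "algebraic (x * y)"
proof -
  obtain a where a: "a \<noteq> 0" "algebraic_int (of_int a * x)"
    using algebraic_imp_multiple_algebraic_int[OF assms(1)] by blast
  obtain b where b: "b \<noteq> 0" "algebraic_int (of_int b * y)"
    using algebraic_imp_multiple_algebraic_int[OF assms(2)] by blast
  note ab = a b
  have int: "algebraic_int (of_int k :: complex)" for k by simp
  have "algebraic_int (of_int b * (of_int a * x) + of_int a * (of_int b * y))"
    by (intro algebraic_int_plus_times(1) algebraic_int_plus_times(2)[OF int] ab)
  then have "algebraic_int (of_int (a * b) * (x + y))" by (simp add: algebra_simps)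
  then show "algebraic (x + y)" using ab by (intro algebraic_if_multiple_algebraic_int[of "a * b"]) auto
  have "algebraic_int ((of_int a * x) * (of_int b * y))"
    by (rule algebraic_int_plus_times(2)[OF a(2) b(2)])
  then have "algebraic_int (of_int (a * b) * (x * y))" by (simp add: mult_ac)
  then show "algebraic (x * y)" using ab by (intro algebraic_if_multiple_algebraic_int[of "a * b"]) auto
qed

section \<open>Subfields of the complex numbers and adjunction of square roots\<close>

lemma CC_simps [simp]:
  "carrier CC = UNIV" "monoid.mult CC = (*)" "monoid.one CC = 1" "ring.zero CC = 0" "ring.add CC = (+)"
  by (auto simp: ring_of_type_algebra_def)

lemma field_CC: "field CC" by (rule field_from_type_algebra)

lemma ring_CC: "ring CC" by (rule ring_from_type_algebra)

lemma CC_a_inv [simp]: "\<ominus>\<^bsub>CC\<^esub> x = - x"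
  using abelian_group.minus_equality[OF ring.is_abelian_group[OF ring_CC], of "- x" x] by simp

lemma CC_m_inv [simp]: "x \<noteq> 0 \<Longrightarrow> inv\<^bsub>CC\<^esub> x = inverse x"
  using monoid.inv_unique'[OF ring.is_monoid[OF ring_CC], of x "inverse x"] by simp

text \<open>Subfields in terms of the type class operations, equivalent to
  \<open>subfield K CC\<close>. As \<open>inverse 0 = 0\<close>, closure under inverses can be
  stated without excluding 0.\<close>

definition csubfield :: "complex set \<Rightarrow> bool" where
  "csubfield K \<longleftrightarrow> 1 \<in> K \<and> (\<forall>a\<in>K. \<forall>b\<in>K. a + b \<in> K) \<and> (\<forall>a\<in>K. \<forall>b\<in>K. a * b \<in> K) \<and>
     (\<forall>a\<in>K. - a \<in> K) \<and> (\<forall>a\<in>K. inverse a \<in> K)"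

lemma csubfieldD:
  assumes "csubfield K"
  shows "1 \<in> K" "0 \<in> K" "\<And>a b. a \<in> K \<Longrightarrow> b \<in> K \<Longrightarrow> a + b \<in> K" "\<And>a b. a \<in> K \<Longrightarrow> b \<in> K \<Longrightarrow> a * b \<in> K"
    "\<And>a. a \<in> K \<Longrightarrow> - a \<in> K" "\<And>a b. a \<in> K \<Longrightarrow> b \<in> K \<Longrightarrow> a - b \<in> K"
    "\<And>a. a \<in> K \<Longrightarrow> inverse a \<in> K" "\<And>a b. a \<in> K \<Longrightarrow> b \<in> K \<Longrightarrow> a / b \<in> K"
proof -
  show *: "1 \<in> K" "\<And>a b. a \<in> K \<Longrightarrow> b \<in> K \<Longrightarrow> a + b \<in> K" "\<And>a b. a \<in> K \<Longrightarrow> b \<in> K \<Longrightarrow> a * b \<in> K"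
    "\<And>a. a \<in> K \<Longrightarrow> - a \<in> K" "\<And>a. a \<in> K \<Longrightarrow> inverse a \<in> K"
    using assms by (auto simp: csubfield_def)
  show "0 \<in> K" using *(2)[of 1 "-1"] *(1) *(4)[of 1] by simp
  show "a - b \<in> K" if "a \<in> K" "b \<in> K" for a b
    using *(2)[of a "- b"] *(4)[of b] that by simp
  show "a / b \<in> K" if "a \<in> K" "b \<in> K" for a b
    using *(3)[of a "inverse b"] *(5)[of b] that by (simp add: field_class.field_divide_inverse)
qed

lemma subfield_CC_iff: "subfield K CC \<longleftrightarrow> csubfield K"
proof
  assume K: "subfield K CC"
  note S = subringE[OF subfieldE(1)[OF K]]
  have "inverse a \<in> K" if "a \<in> K" for a
    using ring.subfield_m_inv(1)[OF ring_CC K, of a] that by (cases "a = 0") auto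
  then show "csubfield K" using S by (simp add: csubfield_def)
next
  assume "csubfield K"
  note K = csubfieldD[OF this]
  show "subfield K CC"
  proof (rule field.subfieldI'[OF field_CC])
    show "subring K CC" by (rule ring.subringI[OF ring_CC]) (use K in auto)
  qed (use K in auto)
qed

lemma csubfield_of_nat: "csubfield K \<Longrightarrow> of_nat n \<in> K"
  by (induction n) (auto dest: csubfieldD)

lemma csubfield_of_int: "csubfield K \<Longrightarrow> of_int n \<in> K"
  by (cases n) (auto intro: csubfield_of_nat csubfieldD(5) simp del: of_nat_Suc)

lemma csubfield_of_rat: "csubfield K \<Longrightarrow> of_rat r \<in> K"
proof (cases r)
  case (Fract a b)
  then show "csubfield K \<Longrightarrow> of_rat r \<in> K"
    by (simp add: of_rat_rat csubfield_of_int csubfieldD(8))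
qed

lemma csubfield_Rats: "csubfield K \<Longrightarrow> \<rat> \<subseteq> K"
  by (auto elim!: Rats_cases intro: csubfield_of_rat)

lemma csubfield_algebraic: "csubfield Qbar"
  by (auto simp: csubfield_def intro: algebraic_plus_times)

text \<open>Radicands are integers, not naturals, so that L(i) is again such a field, with -1 as an
  additional radicand.\<close>

definition quad_field :: "int set \<Rightarrow> complex set" where
  "quad_field D = generate_field CC ((\<lambda>d. csqrt (of_int d)) ` D)"

lemma csubfield_quad_field: "csubfield (quad_field D)"
  unfolding quad_field_def subfield_CC_iff[symmetric]
  by (rule field.generate_field_is_subfield[OF field_CC]) auto

lemma csqrt_in_quad_field: "d \<in> D \<Longrightarrow> csqrt (of_int d) \<in> quad_field D"
  unfolding quad_field_def by (auto intro: generate_field.incl)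

lemma quad_field_minimal:
  assumes "csubfield K" "\<And>d. d \<in> D \<Longrightarrow> csqrt (of_int d) \<in> K"
  shows "quad_field D \<subseteq> K"
  unfolding quad_field_def
  by (rule field.generate_field_min_subfield1[OF field_CC]) (use assms in \<open>auto simp: subfield_CC_iff\<close>)

lemma quad_field_mono: "D \<subseteq> E \<Longrightarrow> quad_field D \<subseteq> quad_field E"
  by (intro quad_field_minimal csubfield_quad_field) (auto intro: csqrt_in_quad_field)

text \<open>The union of the fields of the finite subsets is itself a field, as any two of them lie
  in a third. This gives access to induction on the number of radicands.\<close>

lemma quad_field_finite_subset:
  assumes "x \<in> quad_field D"
  shows "\<exists>F\<subseteq>D. finite F \<and> x \<in> quad_field F"
proof -
  define K where "K = {x. \<exists>F\<subseteq>D. finite F \<and> x \<in> quad_field F}"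
  have two: "\<exists>F\<subseteq>D. finite F \<and> a \<in> quad_field F \<and> b \<in> quad_field F" if "a \<in> K" "b \<in> K" for a b
  proof -
    obtain F G where "F \<subseteq> D" "finite F" "a \<in> quad_field F" "G \<subseteq> D" "finite G" "b \<in> quad_field G"
      using \<open>a \<in> K\<close> \<open>b \<in> K\<close> by (auto simp: K_def)
    then show ?thesis
      using quad_field_mono[of F "F \<union> G"] quad_field_mono[of G "F \<union> G"] by (intro exI[of _ "F \<union> G"]) auto
  qed
  note Q = csubfieldD[OF csubfield_quad_field]
  have "csubfield K"
    unfolding csubfield_def
  proof (intro conjI ballI)
    show "1 \<in> K" using Q(1)[of "{}"] unfolding K_def by blast
    show "a + b \<in> K" if "a \<in> K" "b \<in> K" for a b using two[OF that] Q(3) unfolding K_def by blast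
    show "a * b \<in> K" if "a \<in> K" "b \<in> K" for a b using two[OF that] Q(4) unfolding K_def by blast
    show "- a \<in> K" if "a \<in> K" for a using two[OF that that] Q(5) unfolding K_def by blast
    show "inverse a \<in> K" if "a \<in> K" for a using two[OF that that] Q(7) unfolding K_def by blast
  qed
  moreover have "csqrt (of_int d) \<in> K" if "d \<in> D" for d
    using that csqrt_in_quad_field[of d "{d}"] unfolding K_def by blast
  ultimately have "quad_field D \<subseteq> K" by (rule quad_field_minimal)
  then show ?thesis using assms by (auto simp: K_def)
qed

definition adjoin :: "complex set \<Rightarrow> complex \<Rightarrow> complex set" where
  "adjoin K s = {a + b * s | a b. a \<in> K \<and> b \<in> K}"

lemma adjoinI: "a \<in> K \<Longrightarrow> b \<in> K \<Longrightarrow> a + b * s \<in> adjoin K s"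
  by (auto simp: adjoin_def)

lemma adjoin_unique:
  assumes K: "csubfield K" and s: "s \<notin> K" and eq: "a + b * s = a' + b' * s"
    and abK: "a \<in> K" "b \<in> K" "a' \<in> K" "b' \<in> K"
  shows "a = a'" "b = b'"
proof -
  show "b = b'"
  proof (rule ccontr)
    assume "b \<noteq> b'"
    then have "s = (a' - a) / (b - b')" using eq by (simp add: field_simps)
    then show False using s abK csubfieldD(6,8)[OF K] by simp
  qed
  then show "a = a'" using eq by simp
qed

text \<open>The inverse of a + b s is its conjugate a - b s divided by the norm a^2 - b^2 s^2, which
  lies in \<open>K\<close>. The conjugate is nonzero because s is not in \<open>K\<close>; if s is
  in \<open>K\<close>, nothing is adjoined.\<close>

lemma csubfield_adjoin:
  assumes K: "csubfield K" and s: "s ^ 2 \<in> K"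
  shows "csubfield (adjoin K s)"
proof -
  note KD = csubfieldD[OF K]
  have mult: "x * y \<in> adjoin K s" if xy: "x \<in> adjoin K s" "y \<in> adjoin K s" for x y
  proof -
    obtain a b c d where abcd: "x = a + b * s" "y = c + d * s" "a \<in> K" "b \<in> K" "c \<in> K" "d \<in> K"
      using xy unfolding adjoin_def by blast
    have "x * y = (a * c + b * d * s ^ 2) + (a * d + b * c) * s"
      unfolding abcd by (simp add: algebra_simps power2_eq_square)
    then show ?thesis using abcd s KD by (auto intro!: adjoinI)
  qed
  have KA: "x \<in> adjoin K s" if "x \<in> K" for x using adjoinI[of x K 0 s] that KD by simp
  show ?thesis
    unfolding csubfield_def
  proof (intro conjI ballI)
    show "1 \<in> adjoin K s" using KA KD by blast
    show "x * y \<in> adjoin K s" if "x \<in> adjoin K s" "y \<in> adjoin K s" for x y by (rule mult[OF that])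
    show "x + y \<in> adjoin K s" if xy: "x \<in> adjoin K s" "y \<in> adjoin K s" for x y
    proof -
      obtain a b c d where abcd: "x = a + b * s" "y = c + d * s" "a \<in> K" "b \<in> K" "c \<in> K" "d \<in> K"
        using xy unfolding adjoin_def by blast
      have eq: "x + y = (a + c) + (b + d) * s" unfolding abcd by (simp add: algebra_simps)
      show ?thesis unfolding eq by (intro adjoinI KD(3) abcd)
    qed
    show "- x \<in> adjoin K s" if x: "x \<in> adjoin K s" for x
      using mult[OF KA[OF KD(5)[OF KD(1)]] x] by simp
    show "inverse x \<in> adjoin K s" if x: "x \<in> adjoin K s" for x
    proof (cases "s \<in> K")
      case True
      obtain a b where ab: "x = a + b * s" "a \<in> K" "b \<in> K" using x unfolding adjoin_def by blast
      then have "x \<in> K" using KD(3)[OF ab(2) KD(4)[OF ab(3) True]] by simp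
      then show ?thesis by (intro KA KD(7))
    next
      case False
      obtain a b where ab: "x = a + b * s" "a \<in> K" "b \<in> K" using x unfolding adjoin_def by blast
      define y where "y = a + (- b) * s"
      have y: "y \<in> adjoin K s" unfolding y_def by (intro adjoinI KD(5) ab)
      have xy: "x * y = a ^ 2 - b ^ 2 * s ^ 2" by (simp add: ab y_def algebra_simps power2_eq_square)
      then have xyK: "x * y \<in> K" using KD(6)[OF KD(4)[OF ab(2,2)] KD(4)[OF KD(4)[OF ab(3,3)] s]] by (simp add: power2_eq_square)
      show ?thesis
      proof (cases "x = 0")
        case True
        then show ?thesis using KA[OF KD(2)] by simp
      next
        case x0: False
        have "y \<noteq> 0"
        proof
          assume "y = 0"
          then have "a + (- b) * s = 0 + 0 * s" by (simp add: y_def)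
          then have "a = 0" "- b = 0"
            using adjoin_unique[OF K False _ ab(2) KD(5)[OF ab(3)] KD(2) KD(2)] by blast+
          then show False using x0 ab by simp
        qed
        then have eq: "inverse x = y * inverse (x * y)" using x0 by (simp add: field_simps)
        show ?thesis unfolding eq by (rule mult[OF y KA[OF KD(7)[OF xyK]]])
      qed
    qed
  qed
qed

lemma quad_field_insert: "quad_field (insert d D) = adjoin (quad_field D) (csqrt (of_int d))"
proof
  have K: "csubfield (quad_field D)" by (rule csubfield_quad_field)
  note KD = csubfieldD[OF this]
  have A: "csubfield (adjoin (quad_field D) (csqrt (of_int d)))"
    by (rule csubfield_adjoin[OF K]) (simp add: csubfield_of_int[OF K])
  show "quad_field (insert d D) \<subseteq> adjoin (quad_field D) (csqrt (of_int d))"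
  proof (rule quad_field_minimal[OF A])
    fix e assume "e \<in> insert d D"
    then show "csqrt (of_int e) \<in> adjoin (quad_field D) (csqrt (of_int d))"
      using adjoinI[of 0 "quad_field D" 1 "csqrt (of_int d)"] KD(1,2)
        adjoinI[of "csqrt (of_int e)" "quad_field D" 0 "csqrt (of_int d)"] csqrt_in_quad_field[of e D] by auto
  qed
  note ID = csubfieldD[OF csubfield_quad_field[of "insert d D"]]
  show "adjoin (quad_field D) (csqrt (of_int d)) \<subseteq> quad_field (insert d D)"
    using quad_field_mono[of D "insert d D"] csqrt_in_quad_field[of d "insert d D"]
    by (auto simp: adjoin_def intro!: ID(3,4))
qed

section \<open>Embeddings of subfields and normality\<close>

definition is_hom :: "complex set \<Rightarrow> (complex \<Rightarrow> complex) \<Rightarrow> bool" where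
  "is_hom K \<phi> \<longleftrightarrow> \<phi> 1 = 1 \<and> (\<forall>a\<in>K. \<forall>b\<in>K. \<phi> (a + b) = \<phi> a + \<phi> b) \<and> (\<forall>a\<in>K. \<forall>b\<in>K. \<phi> (a * b) = \<phi> a * \<phi> b)"

context
  fixes K \<phi>
  assumes K: "csubfield K" and hom: "is_hom K \<phi>"
begin

lemma hom_1: "\<phi> 1 = 1" and hom_add: "a \<in> K \<Longrightarrow> b \<in> K \<Longrightarrow> \<phi> (a + b) = \<phi> a + \<phi> b"
  and hom_mult: "a \<in> K \<Longrightarrow> b \<in> K \<Longrightarrow> \<phi> (a * b) = \<phi> a * \<phi> b"
  using hom by (auto simp: is_hom_def)

lemma hom_0: "\<phi> 0 = 0"
  using hom_add[of 0 0] csubfieldD(2)[OF K] by simp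

lemma hom_uminus: "a \<in> K \<Longrightarrow> \<phi> (- a) = - \<phi> a"
  using hom_add[of a "- a"] csubfieldD(5)[OF K] hom_0 by (simp add: eq_neg_iff_add_eq_0 add.commute)

lemma hom_of_nat: "\<phi> (of_nat n) = of_nat n"
  by (induction n) (simp_all add: hom_0 hom_1 hom_add csubfield_of_nat[OF K] csubfieldD(1)[OF K])

lemma hom_of_int: "\<phi> (of_int n) = of_int n"
proof (cases "n \<ge> 0")
  case True
  then show ?thesis using hom_of_nat[of "nat n"] by simp
next
  case False
  then have "n = - int (nat (- n))" by simp
  then obtain m where "n = - int m" by blast
  then show ?thesis using hom_uminus[OF csubfield_of_nat[OF K, of m]] hom_of_nat[of m] by simp
qed

lemma hom_inverse: "a \<in> K \<Longrightarrow> \<phi> (inverse a) = inverse (\<phi> a)"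
proof (cases "a = 0")
  case False
  assume a: "a \<in> K"
  have "\<phi> a * \<phi> (inverse a) = \<phi> (a * inverse a)" using a csubfieldD(7)[OF K] by (simp add: hom_mult)
  also have "\<dots> = 1" using False hom_1 by simp
  finally show ?thesis by (metis inverse_unique)
qed (simp add: hom_0)

lemma hom_of_rat: "\<phi> (of_rat r) = of_rat r"
proof (cases r)
  case (Fract a b)
  have "\<phi> (of_int a * inverse (of_int b)) = of_int a * inverse (of_int b)"
    by (simp only: hom_mult[OF csubfield_of_int[OF K] csubfieldD(7)[OF K csubfield_of_int[OF K]]]
        hom_inverse[OF csubfield_of_int[OF K]] hom_of_int)
  then show ?thesis using Fract by (simp add: of_rat_rat field_class.field_divide_inverse)
qed

lemma hom_poly:
  assumes x: "x \<in> K"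
  shows "poly (map_poly of_rat q) x \<in> K \<and> \<phi> (poly (map_poly of_rat q) x) = poly (map_poly of_rat q) (\<phi> x)"
proof (induction q)
  case 0
  then show ?case using hom_0 csubfieldD(2)[OF K] by simp
next
  case (pCons a q)
  then show ?case
    using x by (simp add: map_poly_pCons hom_add hom_mult hom_of_rat csubfield_of_rat[OF K] csubfieldD(3,4)[OF K])
qed

lemma hom_algebraic_int:
  assumes x: "x \<in> K" "algebraic_int x"
  shows "algebraic_int (\<phi> x)"
proof -
  obtain p where p: "poly (map_poly of_int p) x = 0" "lead_coeff p = 1"
    using x(2) unfolding algebraic_int_altdef_ipoly by blast
  have eq: "map_poly of_rat (map_poly of_int p) = (map_poly of_int p :: complex poly)"
    by (simp add: map_poly_map_poly o_def)
  have "poly (map_poly of_int p) (\<phi> x) = \<phi> (poly (map_poly of_int p) x)"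
    using hom_poly[OF x(1), of "map_poly of_int p"] unfolding eq by simp
  then have "poly (map_poly of_int p) (\<phi> x) = 0" using p hom_0 by simp
  then show ?thesis using p unfolding algebraic_int_altdef_ipoly by blast
qed

text \<open>The extension sends a + b s to \<phi>(a) + \<phi>(b) t, which is well defined as s is
  not in \<open>K\<close>, and is multiplicative because t satisfies the transported equation of s.
  It is used with t = s to enlarge the domain and with t = -s as conjugation.\<close>

lemma hom_extend:
  assumes s: "s \<notin> K" "s ^ 2 \<in> K" and t: "t ^ 2 = \<phi> (s ^ 2)"
  shows "\<exists>\<psi>. is_hom (adjoin K s) \<psi> \<and> (\<forall>a\<in>K. \<psi> a = \<phi> a) \<and> \<psi> s = t"
proof -
  note KD = csubfieldD[OF K]
  define \<psi> where "\<psi> = (\<lambda>x. THE y. \<exists>a\<in>K. \<exists>b\<in>K. x = a + b * s \<and> y = \<phi> a + \<phi> b * t)"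
  have psi: "\<psi> (a + b * s) = \<phi> a + \<phi> b * t" if ab: "a \<in> K" "b \<in> K" for a b
    unfolding \<psi>_def
  proof (rule the_equality)
    show "\<exists>a'\<in>K. \<exists>b'\<in>K. a + b * s = a' + b' * s \<and> \<phi> a + \<phi> b * t = \<phi> a' + \<phi> b' * t"
      using ab by blast
    fix y assume "\<exists>a'\<in>K. \<exists>b'\<in>K. a + b * s = a' + b' * s \<and> y = \<phi> a' + \<phi> b' * t"
    then obtain a' b' where *: "a' \<in> K" "b' \<in> K" "a + b * s = a' + b' * s" "y = \<phi> a' + \<phi> b' * t" by blast
    show "y = \<phi> a + \<phi> b * t"
      using adjoin_unique[OF K s(1) *(3) ab *(1,2)] *(4) by simp
  qed
  have psiK: "\<psi> a = \<phi> a" if "a \<in> K" for a using psi[OF that KD(2)] hom_0 by simp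
  have psis: "\<psi> s = t" using psi[OF KD(2) KD(1)] hom_0 hom_1 by simp
  have "is_hom (adjoin K s) \<psi>"
    unfolding is_hom_def
  proof (intro conjI ballI)
    show "\<psi> 1 = 1" using psiK[OF KD(1)] hom_1 by simp
    fix x y assume xy: "x \<in> adjoin K s" "y \<in> adjoin K s"
    obtain a b c d where x: "x = a + b * s" and y: "y = c + d * s" and K: "a \<in> K" "b \<in> K" "c \<in> K" "d \<in> K"
      using xy unfolding adjoin_def by blast
    have px: "\<psi> x = \<phi> a + \<phi> b * t" and py: "\<psi> y = \<phi> c + \<phi> d * t"
      unfolding x y by (intro psi K)+
    have "x + y = (a + c) + (b + d) * s" by (simp add: x y algebra_simps)
    then have "\<psi> (x + y) = \<phi> (a + c) + \<phi> (b + d) * t" using psi[OF KD(3)[OF K(1,3)] KD(3)[OF K(2,4)]] by simp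
    also have "\<dots> = \<psi> x + \<psi> y" using hom_add[OF K(1,3)] hom_add[OF K(2,4)] px py by (simp add: algebra_simps)
    finally show "\<psi> (x + y) = \<psi> x + \<psi> y" .
    have bd: "b * d \<in> K" using KD K by blast
    have k1: "a * c + b * d * s ^ 2 \<in> K" using KD(3)[OF KD(4)[OF K(1,3)] KD(4)[OF bd s(2)]] .
    have k2: "a * d + b * c \<in> K" using KD(3)[OF KD(4)[OF K(1,4)] KD(4)[OF K(2,3)]] .
    have "x * y = (a * c + b * d * s ^ 2) + (a * d + b * c) * s"
      by (simp add: x y algebra_simps power2_eq_square)
    then have "\<psi> (x * y) = \<phi> (a * c + b * d * s ^ 2) + \<phi> (a * d + b * c) * t"
      using psi[OF k1 k2] by simp
    also have "\<phi> (a * c + b * d * s ^ 2) = \<phi> a * \<phi> c + \<phi> b * \<phi> d * t ^ 2"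
      using hom_add[OF KD(4)[OF K(1,3)] KD(4)[OF bd s(2)]] hom_mult[OF K(1,3)] hom_mult[OF bd s(2)]
        hom_mult[OF K(2,4)] t by simp
    also have "\<phi> (a * d + b * c) = \<phi> a * \<phi> d + \<phi> b * \<phi> c"
      using hom_add[OF KD(4)[OF K(1,4)] KD(4)[OF K(2,3)]] hom_mult[OF K(1,4)] hom_mult[OF K(2,3)] by simp
    also have "\<phi> a * \<phi> c + \<phi> b * \<phi> d * t ^ 2 + (\<phi> a * \<phi> d + \<phi> b * \<phi> c) * t = \<psi> x * \<psi> y"
      unfolding px py by (simp add: algebra_simps power2_eq_square)
    finally show "\<psi> (x * y) = \<psi> x * \<psi> y" .
  qed
  then show ?thesis using psiK psis by blast
qed

end

text \<open>Adjoin the roots one at a time, fixing each root that is not yet in the domain; its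
  square is an integer and so is fixed by every embedding.\<close>

lemma hom_quad_field_finite:
  assumes K: "csubfield K" "is_hom K \<phi>" and "finite F"
  shows "\<exists>K' \<psi>. csubfield K' \<and> K \<subseteq> K' \<and> quad_field F \<subseteq> K' \<and> is_hom K' \<psi> \<and> (\<forall>a\<in>K. \<psi> a = \<phi> a)"
  using \<open>finite F\<close>
proof (induction F)
  case empty
  have "quad_field {} \<subseteq> K" by (rule quad_field_minimal[OF K(1)]) auto
  then show ?case using K by blast
next
  case (insert d F)
  then obtain K' \<psi> where K': "csubfield K'" "K \<subseteq> K'" "quad_field F \<subseteq> K'" "is_hom K' \<psi>" "\<forall>a\<in>K. \<psi> a = \<phi> a"
    by blast
  define s where "s = csqrt (of_int d)"
  have in_min: "quad_field (insert d F) \<subseteq> K''" if "csubfield K''" "quad_field F \<subseteq> K''" "s \<in> K''" for K''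
    using that csqrt_in_quad_field[of _ F] by (intro quad_field_minimal) (auto simp: s_def)
  show ?case
  proof (cases "s \<in> K'")
    case True
    then show ?thesis using K' in_min[OF K'(1,3)] by blast
  next
    case False
    have s2: "s ^ 2 = of_int d" by (simp add: s_def)
    then have s2K: "s ^ 2 \<in> K'" using csubfield_of_int[OF K'(1)] by simp
    have "s ^ 2 = \<psi> (s ^ 2)" unfolding s2 hom_of_int[OF K'(1,4)] ..
    then obtain \<psi>' where psi': "is_hom (adjoin K' s) \<psi>'" "\<forall>a\<in>K'. \<psi>' a = \<psi> a"
      using hom_extend[OF K'(1,4) False s2K] by blast
    have A: "csubfield (adjoin K' s)" by (rule csubfield_adjoin[OF K'(1) s2K])
    have KA: "K' \<subseteq> adjoin K' s"
      using adjoinI[of _ K' 0 s] csubfieldD(2)[OF K'(1)] by auto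
    have "s \<in> adjoin K' s" using adjoinI[of 0 K' 1 s] csubfieldD(1,2)[OF K'(1)] by simp
    then have "quad_field (insert d F) \<subseteq> adjoin K' s" using in_min[OF A] K'(3) KA by blast
    moreover have "\<forall>a\<in>K. \<psi>' a = \<phi> a" using psi'(2) K'(2,5) by (metis subsetD)
    ultimately show ?thesis using A KA K'(2) psi'(1) by blast
  qed
qed

lemma csubfield_hom_preimage:
  assumes K: "csubfield K" "is_hom K \<psi>" and E: "csubfield E"
  shows "csubfield {y \<in> K. \<psi> y \<in> E}"
  unfolding csubfield_def
  using csubfieldD[OF K(1)] csubfieldD[OF E]
  by (simp add: hom_1[OF K] hom_add[OF K] hom_mult[OF K] hom_uminus[OF K] hom_inverse[OF K])

lemma hom_csqrt:
  assumes K: "csubfield K" "is_hom K \<psi>" and s: "csqrt (of_int d) \<in> K"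
  shows "\<psi> (csqrt (of_int d)) \<in> {csqrt (of_int d), - csqrt (of_int d)}"
proof -
  have "(\<psi> (csqrt (of_int d))) ^ 2 = \<psi> ((csqrt (of_int d)) ^ 2)"
    using hom_mult[OF K s s] by (simp add: power2_eq_square)
  also have "\<dots> = (csqrt (of_int d)) ^ 2" using hom_of_int[OF K] by simp
  finally show ?thesis by (auto simp only: power2_eq_iff)
qed

text \<open>An embedding sends each generating root to plus or minus itself, so the preimage of the
  field is a field containing all generators.\<close>

lemma hom_maps_quad_field:
  assumes K: "csubfield K" "is_hom K \<psi>" "quad_field F \<subseteq> K" and x: "x \<in> quad_field F"
  shows "\<psi> x \<in> quad_field F"
proof -
  note F = csubfield_quad_field[of F]
  have "quad_field F \<subseteq> {y \<in> K. \<psi> y \<in> quad_field F}"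
  proof (rule quad_field_minimal[OF csubfield_hom_preimage[OF K(1,2) F]])
    fix d assume "d \<in> F"
    then have s: "csqrt (of_int d) \<in> quad_field F" by (rule csqrt_in_quad_field)
    then have sK: "csqrt (of_int d) \<in> K" using K(3) by blast
    then show "csqrt (of_int d) \<in> {y \<in> K. \<psi> y \<in> quad_field F}"
      using hom_csqrt[OF K(1,2) sK] s csubfieldD(5)[OF F s] by auto
  qed
  then show ?thesis using x by blast
qed

lemma of_rat_poly_plus: "map_poly of_rat (p + q) = (map_poly of_rat p + map_poly of_rat q :: complex poly)"
  by (rule poly_eqI) (simp add: coeff_map_poly of_rat_add)

lemma of_rat_poly_minus: "map_poly of_rat (p - q) = (map_poly of_rat p - map_poly of_rat q :: complex poly)"
  by (rule poly_eqI) (simp add: coeff_map_poly of_rat_diff)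

lemma of_rat_poly_mult: "map_poly of_rat (p * q) = (map_poly of_rat p * map_poly of_rat q :: complex poly)"
  by (rule poly_eqI) (simp add: coeff_map_poly coeff_mult of_rat_sum of_rat_mult)

text \<open>\<open>K\<close> is the field of values f(x). As q is irreducible, f(x) = 0 holds
  exactly if q divides f, so f(x) \<mapsto> f(z) is well defined; inverses come from Bezout
  coefficients of q and f.\<close>

lemma hom_of_conjugate:
  fixes q :: "rat poly" and x z :: complex
  assumes q: "Factorial_Ring.irreducible q" and x: "poly (map_poly of_rat q) x = 0" and z: "poly (map_poly of_rat q) z = 0"
  shows "\<exists>K \<phi>. csubfield K \<and> is_hom K \<phi> \<and> x \<in> K \<and> \<phi> x = z"
proof -
  define ev where "ev = (\<lambda>f (y::complex). poly (map_poly of_rat f) y)"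
  have ev_add: "ev (f + g) y = ev f y + ev g y" and ev_mult: "ev (f * g) y = ev f y * ev g y"
    and ev_diff: "ev (f - g) y = ev f y - ev g y" for f g y
    by (simp_all add: ev_def of_rat_poly_plus of_rat_poly_minus of_rat_poly_mult)
  have ev_1: "ev 1 y = 1" for y by (simp add: ev_def map_poly_1)
  have qx: "ev q x = 0" and qz: "ev q z = 0" using x z by (simp_all add: ev_def)
  have bez: "\<exists>u. \<forall>y. ev q y = 0 \<longrightarrow> ev u y * ev f y = 1" if "\<not> q dvd f" for f
  proof -
    have "coprime q f" using q that by (intro prime_elem_imp_coprime irreducible_imp_prime_elem_gcd)
    then obtain u v where "u * q + v * f = 1"
      using bezout_coefficients_fst_snd[of q f] by (metis coprime_imp_gcd_eq_1)
    then have "ev u y * ev q y + ev v y * ev f y = 1" for y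
      using ev_1 ev_add ev_mult by metis
    then show ?thesis by (intro exI[of _ v]) (metis add_0 mult_zero_right)
  qed
  have dvd: "ev g y = 0" if "q dvd g" "ev q y = 0" for g y
    using that by (auto simp: ev_mult elim!: dvdE)
  have zero: "ev f x = 0 \<longleftrightarrow> q dvd f" for f
  proof
    show "q dvd f" if f: "ev f x = 0"
    proof (rule ccontr)
      assume "\<not> q dvd f"
      then obtain u where "ev u x * ev f x = 1" using bez qx by blast
      then show False using f by simp
    qed
  qed (rule dvd[OF _ qx])
  define K where "K = range (\<lambda>f. ev f x)"
  define \<phi> where "\<phi> = (\<lambda>y. ev (SOME f. ev f x = y) z)"
  have phi: "\<phi> (ev f x) = ev f z" for f
  proof -
    define g where "g = (SOME g. ev g x = ev f x)"
    have "ev g x = ev f x" unfolding g_def by (rule someI) (rule refl)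
    then have "ev (g - f) x = 0" by (simp add: ev_diff)
    then have "ev (g - f) z = 0" using zero dvd[OF _ qz] by blast
    then show ?thesis by (simp add: \<phi>_def g_def ev_diff)
  qed
  have "csubfield K"
    unfolding csubfield_def
  proof (intro conjI ballI)
    show "1 \<in> K" unfolding K_def using ev_1[of x] by (metis rangeI)
    show "a + b \<in> K" if "a \<in> K" "b \<in> K" for a b
      using that unfolding K_def by (auto simp flip: ev_add)
    show "a * b \<in> K" if "a \<in> K" "b \<in> K" for a b
      using that unfolding K_def by (auto simp flip: ev_mult)
    show "- a \<in> K" if a: "a \<in> K" for a
    proof -
      obtain f where f: "a = ev f x" using a by (auto simp: K_def)
      have "- a = ev (f - (f + f)) x" unfolding f ev_diff ev_add by simp
      then show ?thesis by (simp add: K_def)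
    qed
    show "inverse a \<in> K" if a: "a \<in> K" for a
    proof -
      obtain f where f: "a = ev f x" using a by (auto simp: K_def)
      show ?thesis
      proof (cases "q dvd f")
        case True
        then have "a = 0" using zero[of f] f by simp
        then show ?thesis using a by simp
      next
        case False
        then obtain u where "ev u x * ev f x = 1" using bez qx by blast
        then have "inverse a = ev u x" unfolding f by (metis inverse_unique mult.commute)
        then show ?thesis by (simp add: K_def)
      qed
    qed
  qed
  moreover have "is_hom K \<phi>"
    unfolding is_hom_def
  proof (intro conjI ballI)
    show "\<phi> 1 = 1" using phi[of 1] by (simp add: ev_1)
    show "\<phi> (a + b) = \<phi> a + \<phi> b" if ab: "a \<in> K" "b \<in> K" for a b
    proof -
      obtain f g where fg: "a = ev f x" "b = ev g x" using ab by (auto simp: K_def)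
      have "\<phi> (ev f x + ev g x) = ev (f + g) z" unfolding ev_add[symmetric] by (rule phi)
      then show ?thesis by (simp add: fg phi ev_add)
    qed
    show "\<phi> (a * b) = \<phi> a * \<phi> b" if ab: "a \<in> K" "b \<in> K" for a b
    proof -
      obtain f g where fg: "a = ev f x" "b = ev g x" using ab by (auto simp: K_def)
      have "\<phi> (ev f x * ev g x) = ev (f * g) z" unfolding ev_mult[symmetric] by (rule phi)
      then show ?thesis by (simp add: fg phi ev_mult)
    qed
  qed
  moreover have "ev [:0, 1:] y = y" for y by (simp add: ev_def map_poly_pCons)
  then have "x \<in> K" "\<phi> x = z" using phi[of "[:0, 1:]"] rangeI[of "\<lambda>f. ev f x" "[:0, 1:]"] by (simp_all add: K_def)
  ultimately show ?thesis by blast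
qed

text \<open>A conjugate z of x is the image of x under an embedding of Q(x). Extended to a field
  containing finitely many roots that generate x, the embedding maps the field of these roots into
  itself, so z stays inside.\<close>

lemma galois_quad_field: "galois_over_rat (quad_field D)"
  unfolding galois_over_rat_def
proof (intro conjI allI impI)
  show "subfield (quad_field D) CC" by (simp add: subfield_CC_iff csubfield_quad_field)
  show "quad_field D \<subseteq> Qbar"
    by (rule quad_field_minimal[OF csubfield_algebraic]) auto
  fix q :: "rat poly" and z :: complex
  assume q: "Factorial_Ring.irreducible q" "\<exists>x\<in>quad_field D. poly (map_poly of_rat q) x = 0"
    and z: "poly (map_poly of_rat q) z = 0"
  obtain x where x: "x \<in> quad_field D" "poly (map_poly of_rat q) x = 0" using q(2) by blast
  obtain F where F: "F \<subseteq> D" "finite F" "x \<in> quad_field F" using quad_field_finite_subset[OF x(1)] by blast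
  obtain K \<phi> where K: "csubfield K" "is_hom K \<phi>" "x \<in> K" "\<phi> x = z"
    using hom_of_conjugate[OF q(1) x(2) z] by blast
  obtain K' \<psi> where K': "csubfield K'" "quad_field F \<subseteq> K'" "is_hom K' \<psi>" "\<forall>a\<in>K. \<psi> a = \<phi> a"
    using hom_quad_field_finite[OF K(1,2) F(2)] by blast
  have "\<psi> x \<in> quad_field F" by (rule hom_maps_quad_field[OF K'(1,3,2) F(3)])
  then show "z \<in> quad_field D" using K K'(4) quad_field_mono[OF F(1)] by auto
qed

lemma totally_real_quad_field:
  assumes "\<And>d. d \<in> D \<Longrightarrow> 0 \<le> d"
  shows "totally_real (quad_field D)"
  unfolding totally_real_def
proof
  fix \<sigma> assume sig: "\<sigma> \<in> Ring.ring_hom (CC\<lparr>carrier := quad_field D\<rparr>) CC"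
  have Q: "csubfield (quad_field D)" by (rule csubfield_quad_field)
  have hom: "is_hom (quad_field D) \<sigma>"
    using ring_hom_one[OF sig] ring_hom_add[OF sig] ring_hom_mult[OF sig] by (simp add: is_hom_def)
  have "csubfield \<real>" by (simp add: csubfield_def)
  then have "quad_field D \<subseteq> {y \<in> quad_field D. \<sigma> y \<in> \<real>}"
  proof (intro quad_field_minimal[OF csubfield_hom_preimage[OF Q hom]])
    fix d assume d: "d \<in> D"
    have s: "csqrt (of_int d) \<in> quad_field D" using csqrt_in_quad_field[OF d] .
    have "csqrt (of_int d) = of_real (sqrt (of_int d))"
      using csqrt_of_real_nonneg[of "of_int d"] assms[OF d] by simp
    then have "csqrt (of_int d) \<in> \<real>" by simp
    then show "csqrt (of_int d) \<in> {y \<in> quad_field D. \<sigma> y \<in> \<real>}"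
      using s hom_csqrt[OF Q hom s] by auto
  qed
  then show "\<sigma> ` quad_field D \<subseteq> \<real>" by auto
qed

section \<open>Primes of multiquadratic fields\<close>

definition oint :: "complex set \<Rightarrow> complex set" where
  "oint L = {x \<in> L. algebraic_int x}"

lemma int_ring_simps [simp]:
  "carrier (int_ring L) = oint L" "monoid.mult (int_ring L) = (*)" "monoid.one (int_ring L) = 1"
  "ring.zero (int_ring L) = 0" "ring.add (int_ring L) = (+)"
  by (simp_all add: int_ring_def oint_def)

lemma ointD:
  assumes L: "csubfield L"
  shows "of_int n \<in> oint L" "of_nat m \<in> oint L" "1 \<in> oint L" "0 \<in> oint L"
    "\<And>a b. a \<in> oint L \<Longrightarrow> b \<in> oint L \<Longrightarrow> a + b \<in> oint L"
    "\<And>a b. a \<in> oint L \<Longrightarrow> b \<in> oint L \<Longrightarrow> a * b \<in> oint L"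
    "\<And>a. a \<in> oint L \<Longrightarrow> - a \<in> oint L"
    "\<And>a b. a \<in> oint L \<Longrightarrow> b \<in> oint L \<Longrightarrow> a - b \<in> oint L"
proof -
  note LD = csubfieldD[OF L]
  show "of_int n \<in> oint L" "of_nat m \<in> oint L" "1 \<in> oint L" "0 \<in> oint L"
    using LD csubfield_of_int[OF L] csubfield_of_nat[OF L] by (simp_all add: oint_def)
  show "a + b \<in> oint L" if "a \<in> oint L" "b \<in> oint L" for a b
    using that LD(3) by (simp add: oint_def algebraic_int_plus_times)
  show "a * b \<in> oint L" if "a \<in> oint L" "b \<in> oint L" for a b
    using that LD(4) by (simp add: oint_def algebraic_int_plus_times)
  show *: "- a \<in> oint L" if "a \<in> oint L" for a
    using that LD(5) by (simp add: oint_def)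
  show "a - b \<in> oint L" if ab: "a \<in> oint L" "b \<in> oint L" for a b
    using ab(1) *[OF ab(2)] LD(3)[of a "- b"] algebraic_int_plus_times(1)[of a "- b"] by (simp add: oint_def)
qed

lemma cring_int_ring: "csubfield L \<Longrightarrow> cring (int_ring L)"
proof -
  assume "csubfield L"
  note OD = ointD[OF this]
  have "subring (oint L) CC"
    by (rule ring.subringI[OF ring_CC]) (use OD in auto)
  then have "subcring (oint L) CC"
    by (rule cring.subcringI'[OF cring_from_type_algebra])
  then have "cring (CC\<lparr>carrier := oint L\<rparr>)"
    using ring.subcring_iff[OF ring_CC, of "oint L"] by simp
  then show ?thesis by (simp add: int_ring_def oint_def)
qed

lemma bezout_prime_int:
  assumes "prime p" "\<not> int p dvd n"
  obtains a b where "a * int p + b * n = 1"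
proof -
  have "coprime (int p) n" using assms by (intro prime_imp_coprime) auto
  then show thesis using that bezout_int[of "int p" n] by (auto simp: coprime_iff_gcd_eq_1)
qed

text \<open>Zorn's lemma gives an ideal maximal among those containing p but not 1; the principal
  ideal of p is one, since 1/p is rational but no integer. An integer prime to p cannot lie in it,
  by Bezout. This gives meaning to the choice in \<open>chosen_prime\<close>.\<close>

lemma prime_above_exists:
  assumes p: "prime p" and L: "csubfield L"
  shows "\<exists>P. prime_above p L P"
proof -
  define R where "R = int_ring L"
  interpret R: cring R unfolding R_def by (rule cring_int_ring[OF L])
  note OD = ointD[OF L]
  have R [simp]: "carrier R = oint L" "monoid.mult R = (*)" "monoid.one R = 1" "ring.zero R = 0" "ring.add R = (+)"
    by (simp_all add: R_def)
  define A where "A = {I. ideal I R \<and> of_nat p \<in> I \<and> 1 \<notin> I}"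
  have "cgenideal R (of_nat p) \<in> A"
  proof -
    have "ideal (cgenideal R (of_nat p)) R" by (rule R.cgenideal_ideal) (simp add: OD)
    moreover have "of_nat p \<in> cgenideal R (of_nat p)" by (rule R.cgenideal_self) (simp add: OD)
    moreover have "1 \<notin> cgenideal R (of_nat p)"
    proof
      assume "1 \<in> cgenideal R (of_nat p)"
      then obtain x where x: "x \<in> oint L" "1 = x * of_nat p" by (auto simp: cgenideal_def)
      have p0: "(of_nat p :: complex) \<noteq> 0" using prime_gt_0_nat[OF p] by simp
      have "x = inverse (of_nat p)" using x(2) p0 by (simp add: field_simps)
      then have "x \<in> \<rat>" by simp
      then have "x \<in> \<int>" using x(1) rational_algebraic_int_is_int by (auto simp: oint_def)
      then obtain k where "x = of_int k" by (elim Ints_cases)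
      then have "(of_int (k * int p) :: complex) = of_int 1" using x(2) by simp
      then have "k * int p = 1" by (simp only: of_int_eq_iff)
      then have "int p dvd 1" by (metis dvd_triv_right)
      then show False using prime_gt_1_nat[OF p] by simp
    qed
    ultimately show ?thesis by (simp add: A_def)
  qed
  then have "\<exists>I\<in>A. \<forall>J\<in>A. I \<subseteq> J \<longrightarrow> J = I"
  proof (intro subset_Zorn_nonempty)
    fix C assume C: "C \<noteq> {}" "subset.chain A C"
    then have CA: "C \<subseteq> A" by (simp add: subset_chain_def)
    have "subset.chain {I. ideal I R} C"
      using C(2) by (auto simp: subset_chain_def A_def)
    then have "ideal (\<Union>C) R" using R.chain_Union_is_ideal[of C] C(1) by simp
    then show "\<Union>C \<in> A" using CA C(1) by (auto simp: A_def)
  qed auto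
  then obtain P where P: "P \<in> A" "\<And>J. J \<in> A \<Longrightarrow> P \<subseteq> J \<Longrightarrow> J = P" by blast
  have idP: "ideal P R" and pP: "of_nat p \<in> P" and oneP: "1 \<notin> P" using P(1) by (auto simp: A_def)
  have "maximalideal P R"
  proof (rule maximalidealI[OF idP])
    show "carrier R \<noteq> P" using oneP OD(3) by auto
    fix J assume J: "ideal J R" "P \<subseteq> J" "J \<subseteq> carrier R"
    show "J = P \<or> J = carrier R"
    proof (cases "1 \<in> J")
      case True
      then show ?thesis using ideal.one_imp_carrier[OF J(1)] by simp
    next
      case False
      then show ?thesis using P(2)[of J] J pP by (auto simp: A_def)
    qed
  qed
  then have prime: "primeideal P R" by (rule R.maximalideal_prime)
  have addP: "a + b \<in> P" if "a \<in> P" "b \<in> P" for a b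
    using additive_subgroup.a_closed[OF ideal.axioms(1)[OF idP] that] by simp
  have multP: "r * a \<in> P" if "a \<in> P" "r \<in> oint L" for a r
    using ideal.I_l_closed[OF idP, of a r] that by simp
  have "P \<inter> \<int> = (\<lambda>k. of_nat p * k) ` \<int>"
  proof
    show "(\<lambda>k. of_nat p * k) ` \<int> \<subseteq> P \<inter> \<int>"
    proof
      fix x :: complex assume "x \<in> (\<lambda>k. of_nat p * k) ` \<int>"
      then obtain k where x: "x = of_nat p * of_int k" by (auto elim: Ints_cases)
      then show "x \<in> P \<inter> \<int>" using multP[OF pP OD(1)[of k]] by (simp add: mult.commute)
    qed
    show "P \<inter> \<int> \<subseteq> (\<lambda>k. of_nat p * k) ` \<int>"
    proof
      fix x assume x: "x \<in> P \<inter> \<int>"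
      then obtain n where n: "x = of_int n" by (auto elim: Ints_cases)
      have "int p dvd n"
      proof (rule ccontr)
        assume "\<not> int p dvd n"
        then obtain a b where ab: "a * int p + b * n = 1" by (rule bezout_prime_int[OF p])
        have "of_int a * of_nat p + of_int b * x \<in> P" using multP[OF pP OD(1)] multP[OF _ OD(1)] x by (intro addP) auto
        also have "of_int a * of_nat p + of_int b * x = of_int (a * int p + b * n)" by (simp add: n)
        finally show False using oneP unfolding ab by simp
      qed
      then obtain k where "n = int p * k" by (elim dvdE)
      then show "x \<in> (\<lambda>k. of_nat p * k) ` \<int>" using n by auto
    qed
  qed
  then show ?thesis using prime unfolding prime_above_def R_def by blast
qed

section \<open>Congruences at a fixed prime above p, and the ramification index\<close>

locale prime_over =
  fixes p :: nat and L P :: "complex set"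
  assumes p: "prime p" and L: "csubfield L" and above: "prime_above p L P"
begin

lemmas O = ointD[OF L]

lemma primeideal_P: "primeideal P (int_ring L)" and P_Ints: "P \<inter> \<int> = (\<lambda>k. of_nat p * k) ` \<int>"
  using above by (auto simp: prime_above_def)

lemma ideal_P: "ideal P (int_ring L)"
  using primeideal_P by (rule primeideal.axioms)

lemma P_subset: "a \<in> P \<Longrightarrow> a \<in> oint L"
  using additive_subgroup.a_subset[OF ideal.axioms(1)[OF ideal_P]] by auto

lemma P_add: "a \<in> P \<Longrightarrow> b \<in> P \<Longrightarrow> a + b \<in> P"
  using additive_subgroup.a_closed[OF ideal.axioms(1)[OF ideal_P], of a b] by simp

lemma P_mult: "a \<in> P \<Longrightarrow> r \<in> oint L \<Longrightarrow> r * a \<in> P"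
  using ideal.I_l_closed[OF ideal_P, of a r] by simp

lemma P_uminus: "a \<in> P \<Longrightarrow> - a \<in> P"
  using P_mult[of a "- 1"] O(7)[OF O(3)] by simp

lemma P_diff: "a \<in> P \<Longrightarrow> b \<in> P \<Longrightarrow> a - b \<in> P"
  using P_add[of a "- b"] P_uminus[of b] by simp

lemma P_prime: "a \<in> oint L \<Longrightarrow> b \<in> oint L \<Longrightarrow> a * b \<in> P \<Longrightarrow> a \<in> P \<or> b \<in> P"
  using primeideal.I_prime[OF primeideal_P, of a b] by simp

lemma P_of_int_iff: "of_int n \<in> P \<longleftrightarrow> int p dvd n"
proof
  assume "of_int n \<in> P"
  then have "(of_int n :: complex) \<in> (\<lambda>k. of_nat p * k) ` \<int>" using P_Ints by auto
  then obtain k where "(of_int n :: complex) = of_int (int p * k)" by (auto elim!: Ints_cases)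
  then have "n = int p * k" by (simp only: of_int_eq_iff)
  then show "int p dvd n" by simp
next
  assume "int p dvd n"
  then obtain k where "n = int p * k" by (elim dvdE)
  then have "(of_int n :: complex) \<in> (\<lambda>k. of_nat p * k) ` \<int>" by auto
  then show "of_int n \<in> P" using P_Ints by blast
qed

lemma P_of_nat: "of_nat p \<in> P"
  using P_of_int_iff[of "int p"] by simp

lemma P_1: "1 \<notin> P"
  using P_of_int_iff[of 1] prime_gt_1_nat[OF p] by simp

lemma p_nonzero: "(of_nat p :: complex) \<noteq> 0"
  using prime_gt_0_nat[OF p] by simp

text \<open>Congruence modulo \<open>p\<close> in the localization of the ring of integers at \<open>P\<close>. If every integer \<open>x\<close>
  is congruent to a rational one in this sense, then \<open>P\<close> has residue degree \<open>1\<close> and becomes principal,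
  generated by \<open>p\<close>, in the localization, so that it is unramified.\<close>

definition approx :: "complex \<Rightarrow> int \<Rightarrow> bool" where
  "approx x n \<longleftrightarrow> (\<exists>w\<in>oint L - P. \<exists>y\<in>oint L. w * (x - of_int n) = of_nat p * y)"

lemma approxI: "w \<in> oint L \<Longrightarrow> w \<notin> P \<Longrightarrow> y \<in> oint L \<Longrightarrow> w * (x - of_int n) = of_nat p * y \<Longrightarrow> approx x n"
  unfolding approx_def by blast

lemma mult_notin_P: "v \<in> oint L - P \<Longrightarrow> w \<in> oint L - P \<Longrightarrow> v * w \<in> oint L - P"
  using P_prime O(6) by blast

lemma approx_of_int: "approx (of_int n) n"
  by (rule approxI[of 1 0]) (use O P_1 in auto)

lemma approx_add:
  assumes "approx x m" "approx y n"
  shows "approx (x + y) (m + n)"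
proof -
  obtain v a where v: "v \<in> oint L - P" "a \<in> oint L" "v * (x - of_int m) = of_nat p * a"
    using assms(1) unfolding approx_def by blast
  obtain w b where w: "w \<in> oint L - P" "b \<in> oint L" "w * (y - of_int n) = of_nat p * b"
    using assms(2) unfolding approx_def by blast
  have "v * w * (x + y - of_int (m + n)) = w * (v * (x - of_int m)) + v * (w * (y - of_int n))"
    by (simp add: algebra_simps)
  also have "\<dots> = of_nat p * (w * a + v * b)" unfolding v w by (simp add: algebra_simps)
  finally show ?thesis
    using mult_notin_P[OF v(1) w(1)] v w O(5,6) by (intro approxI[of "v * w" "w * a + v * b"]) auto
qed

text \<open>From x y - m n = y (x - m) + m (y - n). Integrality of y keeps the first cofactor in the
  ring of integers.\<close>

lemma approx_mult:
  assumes "approx x m" "approx y n" "y \<in> oint L"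
  shows "approx (x * y) (m * n)"
proof -
  obtain v a where v: "v \<in> oint L - P" "a \<in> oint L" "v * (x - of_int m) = of_nat p * a"
    using assms(1) unfolding approx_def by blast
  obtain w b where w: "w \<in> oint L - P" "b \<in> oint L" "w * (y - of_int n) = of_nat p * b"
    using assms(2) unfolding approx_def by blast
  have "v * w * (x * y - of_int (m * n)) = w * y * (v * (x - of_int m)) + v * of_int m * (w * (y - of_int n))"
    by (simp add: algebra_simps)
  also have "\<dots> = of_nat p * (w * y * a + v * of_int m * b)" unfolding v w by (simp add: algebra_simps)
  finally show ?thesis
    using mult_notin_P[OF v(1) w(1)] v w O(1,5,6) assms(3)
    by (intro approxI[of "v * w" "w * y * a + v * of_int m * b"]) auto
qed

text \<open>Multiply by an inverse b of m modulo p: as b m = 1 - a p, x is congruent to b n.\<close>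

lemma approx_cancel:
  assumes x: "x \<in> oint L" and ap: "approx (of_int m * x) n" and m: "\<not> int p dvd m"
  shows "\<exists>n. approx x n"
proof -
  obtain w y where w: "w \<in> oint L - P" "y \<in> oint L" "w * (of_int m * x - of_int n) = of_nat p * y"
    using ap unfolding approx_def by blast
  obtain a b where ab: "a * int p + b * m = 1" by (rule bezout_prime_int[OF p m])
  have "of_int b * of_int m = 1 - of_int a * (of_nat p :: complex)"
    using arg_cong[OF ab, of "of_int :: int \<Rightarrow> complex"] by (simp add: algebra_simps)
  then have bm: "of_int b * (of_int m * x) = (1 - of_int a * of_nat p) * x" by (simp flip: mult.assoc)
  have "w * (x - of_int (b * n)) = of_int b * (w * (of_int m * x - of_int n)) + of_nat p * (w * (of_int a * x))"
  proof -
    have eq: "of_int b * (w * (of_int m * x - of_int n)) = w * (of_int b * (of_int m * x)) - w * of_int (b * n)"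
      by (simp add: algebra_simps)
    show ?thesis unfolding eq bm by (simp add: algebra_simps)
  qed
  also have "\<dots> = of_nat p * (of_int b * y + w * (of_int a * x))" unfolding w by (simp add: algebra_simps)
  finally have "w * (x - of_int (b * n)) = of_nat p * (of_int b * y + w * (of_int a * x))" .
  then show ?thesis
    using w x O(1,5,6) by (intro exI[of _ "b * n"] approxI[of w "of_int b * y + w * (of_int a * x)"]) auto
qed

text \<open>If y^2 is d modulo p, then (s + y)(s - y) is p times an integer. Both factors cannot lie
  in \<open>P\<close>, as their difference 2y is prime to p; the one outside \<open>P\<close> serves
  as the denominator that makes s congruent to y or -y.\<close>

lemma approx_sqrt:
  assumes s: "s \<in> oint L" "s ^ 2 = of_int d" and d: "Legendre d (int p) = 1" and "odd p"
  shows "\<exists>n. approx s n"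
proof -
  have nd: "\<not> int p dvd d" using d by (simp flip: Legendre_eq_0_iff)
  have "QuadRes (int p) d" using d by (auto simp: Legendre_def split: if_splits)
  then obtain y where "int p dvd y ^ 2 - d" unfolding QuadRes_def by (auto simp: cong_iff_dvd_diff)
  then obtain k where k: "y ^ 2 - d = int p * k" by (elim dvdE)
  have "(s + of_int y) * (s - of_int y) = s ^ 2 - of_int (y ^ 2)" by (simp add: algebra_simps power2_eq_square)
  also have "\<dots> = - of_int (y ^ 2 - d)" by (simp add: s)
  also have "\<dots> = of_nat p * of_int (- k)" unfolding k by simp
  finally have prod: "(s + of_int y) * (s - of_int y) = of_nat p * of_int (- k)" .
  have mem: "s + of_int y \<in> oint L" "s - of_int y \<in> oint L" using s O(1,5,8) by auto
  show ?thesis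
  proof (cases "s + of_int y \<in> P")
    case False
    then show ?thesis using prod mem O(1) O(1)[of "- k"] by (intro exI[of _ y] approxI[of "s + of_int y" "of_int (- k)"]) simp_all
  next
    case True
    have "s - of_int y \<notin> P"
    proof
      assume "s - of_int y \<in> P"
      then have "(s + of_int y) - (s - of_int y) \<in> P" by (rule P_diff[OF True])
      then have "of_int (2 * y) \<in> P" by simp
      then have "int p dvd 2 * y" by (simp only: P_of_int_iff)
      moreover have "coprime (int p) 2" using \<open>odd p\<close> by simp
      ultimately have "int p dvd y" by (simp add: coprime_dvd_mult_right_iff)
      then have "int p dvd y ^ 2 - (y ^ 2 - d)" unfolding k by (intro dvd_diff) (auto simp: power2_eq_square)
      then show False using nd by simp
    qed
    moreover have "(s - of_int y) * (s - of_int (- y)) = of_nat p * of_int (- k)"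
      using prod by (simp add: mult.commute)
    ultimately show ?thesis using mem O(1)[of "- k"] by (intro exI[of _ "- y"] approxI[of "s - of_int y" "of_int (- k)"]) simp_all
  qed
qed

text \<open>Remove one radicand d. For x = a + b s with conjugate a - b s, the integers x + \<psi> x
  = 2a and (x - \<psi> x) s = 2 d b lie in the smaller field, so the induction hypothesis applies to
  them although a and b need not be integral. They recombine to 2 d x, and 2 d is prime to
  p.\<close>

lemma approx_quad_field:
  assumes "finite D" "odd p" "quad_field D \<subseteq> L" "\<And>d. d \<in> D \<Longrightarrow> Legendre d (int p) = 1"
    and "x \<in> quad_field D" "algebraic_int x"
  shows "\<exists>n. approx x n"
  using assms
proof (induction D arbitrary: x)
  case empty
  have "csubfield \<rat>" by (simp add: csubfield_def)
  then have "quad_field {} \<subseteq> \<rat>" by (intro quad_field_minimal) auto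
  then have "x \<in> \<rat>" using empty by blast
  then have "x \<in> \<int>" using empty by (simp add: rational_algebraic_int_is_int)
  then obtain k where "x = of_int k" by (elim Ints_cases)
  then show ?case using approx_of_int by blast
next
  case (insert d D)
  have sub: "quad_field D \<subseteq> L" using insert.prems(2) quad_field_mono[of D "insert d D"] by auto
  have IH: "\<exists>n. approx x n" if "x \<in> quad_field D" "algebraic_int x" for x
    using insert.IH[OF insert.prems(1) sub _ that] insert.prems(3) by blast
  define K s where "K = quad_field D" and "s = csqrt (of_int d)"
  have K: "csubfield K" by (simp add: K_def csubfield_quad_field)
  note KD = csubfieldD[OF K]
  have xs: "x \<in> adjoin K s" using insert.prems(4) unfolding quad_field_insert K_def s_def .
  have s2: "s ^ 2 = of_int d" by (simp add: s_def)
  have s_int: "algebraic_int s" unfolding s_def by (rule algebraic_int_csqrt) simp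
  have sL: "s \<in> L" using insert.prems(2) csqrt_in_quad_field[of d "insert d D"] by (auto simp: s_def)
  have xL: "x \<in> L" using insert.prems by blast
  obtain a b where ab: "x = a + b * s" "a \<in> K" "b \<in> K" using xs unfolding adjoin_def by blast
  show ?case
  proof (cases "s \<in> K")
    case True
    have "x \<in> K" unfolding ab(1) by (rule KD(3)[OF ab(2) KD(4)[OF ab(3) True]])
    then show ?thesis using IH insert.prems(5) by (simp add: K_def)
  next
    case False
    have s2K: "s ^ 2 \<in> K" unfolding s2 by (rule csubfield_of_int[OF K])
    have id: "is_hom K (\<lambda>x. x)" by (simp add: is_hom_def)
    obtain \<psi> where psi: "is_hom (adjoin K s) \<psi>" "\<And>a. a \<in> K \<Longrightarrow> \<psi> a = a" "\<psi> s = - s"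
      using hom_extend[OF K id False s2K, of "- s"] by auto
    have A: "csubfield (adjoin K s)" by (rule csubfield_adjoin[OF K s2K])
    have inA: "a \<in> adjoin K s" if "a \<in> K" for a using adjoinI[of a K 0 s] that KD(2) by simp
    have sA: "s \<in> adjoin K s" using adjoinI[of 0 K 1 s] KD(1,2) by simp
    have "\<psi> x = \<psi> a + \<psi> b * \<psi> s"
      unfolding ab(1) using hom_add[OF A psi(1) inA[OF ab(2)] csubfieldD(4)[OF A inA[OF ab(3)] sA]]
        hom_mult[OF A psi(1) inA[OF ab(3)] sA] by simp
    then have px: "\<psi> x = a - b * s" using psi ab by simp
    have px_int: "algebraic_int (\<psi> x)" by (rule hom_algebraic_int[OF A psi(1) xs insert.prems(5)])
    have ai: "algebraic_int (x + \<psi> x)" "algebraic_int ((x + - \<psi> x) * s)"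
      by (rule algebraic_int_plus_times(1)[OF insert.prems(5) px_int],
          rule algebraic_int_plus_times(2)[OF algebraic_int_plus_times(1)[OF insert.prems(5)
            algebraic_int_minus[OF px_int]] s_int])
    have e1: "x + \<psi> x = of_int 2 * a" by (subst px, subst ab(1)) simp
    have e2: "(x + - \<psi> x) * s = of_int (2 * d) * b"
      by (subst px, subst ab(1)) (simp add: algebra_simps s2[unfolded power2_eq_square])
    have k1: "of_int 2 * a \<in> K" and k2: "of_int (2 * d) * b \<in> K"
      by (intro KD(4) csubfield_of_int[OF K] ab)+
    obtain n1 where n1: "approx (of_int 2 * a) n1" using IH ai(1) k1 unfolding e1 K_def by blast
    obtain n2 where n2: "approx (of_int (2 * d) * b) n2" using IH ai(2) k2 unfolding e2 K_def by blast
    have Leg: "Legendre d (int p) = 1" using insert.prems(3) by simp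
    have sO: "s \<in> oint L" using sL s_int by (simp add: oint_def)
    obtain r where r: "approx s r" using approx_sqrt[OF sO s2 Leg insert.prems(1)] by blast
    have "approx (of_int d * (of_int 2 * a) + of_int (2 * d) * b * s) (d * n1 + n2 * r)"
    proof (intro approx_add approx_mult n1 n2 r approx_of_int sO)
      have "of_int 2 * a \<in> L" using k1 sub by (auto simp: K_def)
      then show "of_int 2 * a \<in> oint L" using ai(1) unfolding e1 by (simp add: oint_def)
    qed
    also have "of_int d * (of_int 2 * a) + of_int (2 * d) * b * s = of_int (2 * d) * x"
      by (simp add: ab(1) algebra_simps)
    finally have ap: "approx (of_int (2 * d) * x) (d * n1 + n2 * r)" .
    have "\<not> int p dvd 2 * d"
    proof
      assume "int p dvd 2 * d"
      moreover have "coprime (int p) 2" using insert.prems(1) by simp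
      ultimately have "int p dvd d" by (simp add: coprime_dvd_mult_right_iff)
      then show False using Leg by (simp flip: Legendre_eq_0_iff)
    qed
    then show ?thesis using approx_cancel[OF _ ap] xL insert.prems(5) by (simp add: oint_def)
  qed
qed

lemma approx_imp_diff: "x \<in> oint L \<Longrightarrow> approx x n \<Longrightarrow> x - of_int n \<in> P"
proof -
  assume x: "x \<in> oint L" and "approx x n"
  then obtain w y where w: "w \<in> oint L - P" "y \<in> oint L" "w * (x - of_int n) = of_nat p * y"
    unfolding approx_def by blast
  have "w * (x - of_int n) \<in> P" unfolding w(3) using P_mult[OF P_of_nat w(2)] by (simp add: mult.commute)
  then show ?thesis using P_prime[of w "x - of_int n"] w x O(1,8) by auto
qed

end

context prime_over
begin

text \<open>For z in \<open>P\<close> the approximating integer lies in \<open>P\<close>, hence is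
  divisible by p and can be absorbed: locally p generates \<open>P\<close>.\<close>

lemma P_multiple:
  assumes z: "z \<in> P" and ap: "approx z n"
  shows "\<exists>w\<in>oint L - P. \<exists>y\<in>oint L. w * z = of_nat p * y"
proof -
  obtain w y where w: "w \<in> oint L - P" "y \<in> oint L" "w * (z - of_int n) = of_nat p * y"
    using ap unfolding approx_def by blast
  have "z - of_int n \<in> P" by (rule approx_imp_diff[OF P_subset[OF z] ap])
  then have "z - (z - of_int n) \<in> P" by (rule P_diff[OF z])
  then have "int p dvd n" by (simp add: P_of_int_iff)
  then obtain k where k: "n = int p * k" by (elim dvdE)
  have "w * z = w * (z - of_int n) + w * of_int n" by (simp add: algebra_simps)
  also have "\<dots> = of_nat p * y + w * of_int n" by (simp only: w(3))
  also have "\<dots> = of_nat p * (y + w * of_int k)" by (simp add: k algebra_simps)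
  finally have "w * z = of_nat p * (y + w * of_int k)" .
  moreover have "y + w * of_int k \<in> oint L" using w O(1,5,6) by auto
  ultimately show ?thesis using w(1) by blast
qed

text \<open>The powers are taken in the ring of integers of \<open>K\<close>, whereas the
  denominators w come from the larger field \<open>L\<close>. Denominators and exponents multiply
  along products of ideals, and sums are brought to a common denominator.\<close>

lemma ideal_power_multiple:
  assumes all: "\<And>x. x \<in> oint L \<Longrightarrow> \<exists>n. approx x n" and K: "K \<subseteq> L"
    and z: "z \<in> ideal_power (int_ring K) (P \<inter> K) n"
  shows "\<exists>w\<in>oint L - P. \<exists>y\<in>oint L. w * z = of_nat p ^ n * y"
  using z unfolding ideal_power_def
proof (induction n arbitrary: z)
  case 0
  then have "z \<in> oint L" using K by (auto simp: oint_def)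
  then show ?case using P_1 O(3) by (intro bexI[of _ 1] bexI[of _ z]) auto
next
  case (Suc n)
  define I where "I = (ideal_prod (int_ring K) (P \<inter> K) ^^ n) (carrier (int_ring K))"
  have "z \<in> ideal_prod (int_ring K) (P \<inter> K) I" using Suc.prems by (simp add: I_def)
  then show ?case
  proof (induction rule: ideal_prod.induct)
    case (prod i j)
    then have i: "i \<in> P" by simp
    obtain m where "approx i m" using all P_subset[OF i] by blast
    then obtain v a where v: "v \<in> oint L - P" "a \<in> oint L" "v * i = of_nat p * a"
      using P_multiple[OF i] by blast
    obtain w b where w: "w \<in> oint L - P" "b \<in> oint L" "w * j = of_nat p ^ n * b"
      using Suc.IH[of j] prod unfolding I_def by blast
    have "v * w * (i * j) = (v * i) * (w * j)" by (simp add: mult_ac)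
    also have "\<dots> = of_nat p ^ Suc n * (a * b)" unfolding v w by (simp add: mult_ac)
    finally show ?case using mult_notin_P[OF v(1) w(1)] O(6)[OF v(2) w(2)] by auto
  next
    case (sum s1 s2)
    obtain v a where v: "v \<in> oint L - P" "a \<in> oint L" "v * s1 = of_nat p ^ Suc n * a"
      using sum.IH(1) by blast
    obtain w b where w: "w \<in> oint L - P" "b \<in> oint L" "w * s2 = of_nat p ^ Suc n * b"
      using sum.IH(2) by blast
    have "v * w * (s1 + s2) = w * (v * s1) + v * (w * s2)" by (simp add: algebra_simps)
    also have "\<dots> = of_nat p ^ Suc n * (w * a + v * b)" unfolding v w by (simp add: algebra_simps)
    finally have "v * w * (s1 + s2) = of_nat p ^ Suc n * (w * a + v * b)" .
    moreover have "w * a + v * b \<in> oint L" using v w O(5,6) by auto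
    ultimately show ?case using mult_notin_P[OF v(1) w(1)] by auto
  qed
qed

text \<open>If p were in the n-th power with n \<ge> 2, then w p = p^n y with w outside
  \<open>P\<close>; cancelling p puts w into \<open>P\<close>. The exponent 1 is always
  attained.\<close>

lemma ramification_index_finite_eq_1:
  assumes all: "\<And>x. x \<in> oint L \<Longrightarrow> \<exists>n. approx x n" and K: "csubfield K" "K \<subseteq> L"
  shows "ramification_index_finite p K (P \<inter> K) = 1"
  unfolding ramification_index_finite_def
proof (rule antisym)
  note KO = ointD[OF K(1)]
  have pK: "of_nat p \<in> P \<inter> K" using P_of_nat csubfield_of_nat[OF K(1)] by simp
  have cg: "cgenideal (int_ring K) (of_nat p) = {x * of_nat p | x. x \<in> oint K}"
    by (simp add: cgenideal_def)
  show "Sup {enat n | n. cgenideal (int_ring K) (of_nat p) \<subseteq> ideal_power (int_ring K) (P \<inter> K) n} \<le> 1"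
  proof (rule Sup_least)
    fix e assume "e \<in> {enat n | n. cgenideal (int_ring K) (of_nat p) \<subseteq> ideal_power (int_ring K) (P \<inter> K) n}"
    then obtain n where n: "e = enat n" "cgenideal (int_ring K) (of_nat p) \<subseteq> ideal_power (int_ring K) (P \<inter> K) n"
      by blast
    have "1 * of_nat p \<in> cgenideal (int_ring K) (of_nat p)" unfolding cg using KO(3) by blast
    then have "of_nat p \<in> ideal_power (int_ring K) (P \<inter> K) n" using n by auto
    then obtain w y where w: "w \<in> oint L - P" "y \<in> oint L" "w * of_nat p = of_nat p ^ n * y"
      using ideal_power_multiple[OF all K(2)] by blast
    have "n \<le> 1"
    proof (rule ccontr)
      assume "\<not> n \<le> 1"
      then obtain m where m: "n = Suc (Suc m)" by (metis One_nat_def not0_implies_Suc le_0_eq not_less_eq_eq le_SucI)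
      have "w * of_nat p = (of_nat p ^ m * y * of_nat p) * of_nat p" using w(3) by (simp add: m mult_ac)
      then have "w = of_nat p ^ m * y * of_nat p" using p_nonzero by simp
      moreover have "of_nat p ^ m * y \<in> oint L" using O(2)[of "p ^ m"] O(6) w(2) by simp
      ultimately have "w \<in> P" using P_mult[OF P_of_nat] by simp
      then show False using w by simp
    qed
    then show "e \<le> 1" using n by (simp add: one_enat_def)
  qed
  show "1 \<le> Sup {enat n | n. cgenideal (int_ring K) (of_nat p) \<subseteq> ideal_power (int_ring K) (P \<inter> K) n}"
  proof (rule Sup_upper)
    have "x * of_nat p \<in> ideal_prod (int_ring K) (P \<inter> K) (oint K)" if "x \<in> oint K" for x
      using ideal_prod.prod[OF pK that, of "int_ring K"] by (simp add: mult.commute)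
    then have "cgenideal (int_ring K) (of_nat p) \<subseteq> ideal_power (int_ring K) (P \<inter> K) 1"
      unfolding cg ideal_power_def by auto
    then show "1 \<in> {enat n | n. cgenideal (int_ring K) (of_nat p) \<subseteq> ideal_power (int_ring K) (P \<inter> K) n}"
      unfolding one_enat_def by blast
  qed
qed

lemma ramification_index_eq_1:
  assumes all: "\<And>x. x \<in> oint L \<Longrightarrow> \<exists>n. approx x n"
  shows "ramification_index p L P = 1"
proof -
  have Q: "csubfield \<rat>" by (simp add: csubfield_def)
  have "ring.dimension CC 1 \<rat> \<rat>"
    using ring.dimension_one[OF ring_CC] Q by (simp add: subfield_CC_iff)
  then have "finite_extension \<rat> \<rat>"
    unfolding finite_extension_def using Q ring.finite_dimensionI[OF ring_CC] by (simp add: subfield_CC_iff)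
  \<comment> \<open>The supremum over an empty family would be 0, so the rationals are exhibited as
    a member.\<close>
  then have ne: "{K. finite_extension \<rat> K \<and> K \<subseteq> L} \<noteq> {}" using csubfield_Rats[OF L] by blast
  have "ramification_index p L P = (SUP K \<in> {K. finite_extension \<rat> K \<and> K \<subseteq> L}. 1)"
    unfolding ramification_index_def
  proof (rule SUP_cong[OF refl])
    fix K assume "K \<in> {K. finite_extension \<rat> K \<and> K \<subseteq> L}"
    then show "ramification_index_finite p K (P \<inter> K) = 1"
      by (intro ramification_index_finite_eq_1[OF all]) (auto simp: finite_extension_def subfield_CC_iff)
  qed
  also have "\<dots> = 1" using ne by (rule SUP_const)
  finally show ?thesis .
qed

section \<open>The residue field and its degree over the prime field\<close>

definition resfield :: "complex set ring" where
  "resfield = int_ring L Quot P"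

definition red :: "complex \<Rightarrow> complex set" where
  "red x = P +>\<^bsub>int_ring L\<^esub> x"

definition primefield :: "complex set set" where
  "primefield = red ` \<int>"

lemma domain_resfield: "domain resfield"
  unfolding resfield_def by (rule primeideal.quotient_is_domain[OF primeideal_P])

lemma cring_resfield: "cring resfield" using domain_resfield by (rule domain.axioms)

lemma ring_resfield: "ring resfield" using cring_resfield by (rule cring.axioms)

lemma hom_red: "ring_hom_ring (int_ring L) resfield red"
  unfolding resfield_def red_def[abs_def] by (rule ideal.rcos_ring_hom_ring[OF ideal_P])

lemma carrier_resfield: "carrier resfield = red ` oint L"
  by (auto simp: resfield_def red_def FactRing_def A_RCOSETS_def' )

lemma red_eq_iff: "x \<in> oint L \<Longrightarrow> y \<in> oint L \<Longrightarrow> red x = red y \<longleftrightarrow> x - y \<in> P"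
proof -
  assume xy: "x \<in> oint L" "y \<in> oint L"
  interpret R: cring "int_ring L" by (rule cring_int_ring[OF L])
  have "\<ominus>\<^bsub>int_ring L\<^esub> y = - y"
    using R.minus_equality[of "- y" y] xy O(7) by simp
  then have "x \<ominus>\<^bsub>int_ring L\<^esub> y = x - y" by (simp add: a_minus_def)
  then show ?thesis
    using R.quotient_eq_iff_same_a_r_cos[OF ideal_P, of x y] xy by (simp add: red_def)
qed

lemma red_ops:
  assumes "x \<in> oint L" "y \<in> oint L"
  shows "red (x + y) = red x \<oplus>\<^bsub>resfield\<^esub> red y" "red (x * y) = red x \<otimes>\<^bsub>resfield\<^esub> red y"
    "red 1 = \<one>\<^bsub>resfield\<^esub>" "red 0 = \<zero>\<^bsub>resfield\<^esub>"
  using ring_hom_ring.homh[OF hom_red] assms ring_hom_add[of red "int_ring L" resfield x y]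
    ring_hom_mult[of red "int_ring L" resfield x y] ring_hom_one[of red "int_ring L" resfield]
    ring_hom_zero[of red "int_ring L" resfield] ring_resfield cring.axioms(1)[OF cring_int_ring[OF L]]
  by simp_all

lemma primefield_inverse:
  assumes "a \<in> primefield" "a \<noteq> \<zero>\<^bsub>resfield\<^esub>"
  shows "\<exists>b\<in>primefield. b \<otimes>\<^bsub>resfield\<^esub> a = \<one>\<^bsub>resfield\<^esub>"
proof -
  obtain n where n: "a = red (of_int n)" using assms(1) by (auto simp: primefield_def elim: Ints_cases)
  have "of_int n \<notin> P"
    using assms(2) red_eq_iff[OF O(1) O(4), of n] red_ops(4)[OF O(1) O(1)] by (auto simp: n)
  then have "\<not> int p dvd n" by (simp add: P_of_int_iff)
  then obtain c d where cd: "c * int p + d * n = 1" by (rule bezout_prime_int[OF p])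
  have "int p dvd d * n - 1" using cd by (metis add_diff_cancel_left' add_diff_eq diff_add_cancel dvd_minus_iff dvd_triv_right minus_diff_eq)
  then have "of_int (d * n - 1) \<in> P" by (simp only: P_of_int_iff)
  then have "red (of_int d * of_int n) = red 1" using red_eq_iff[OF O(6)[OF O(1) O(1)] O(3)] by simp
  then have "red (of_int d) \<otimes>\<^bsub>resfield\<^esub> a = \<one>\<^bsub>resfield\<^esub>"
    using red_ops(2)[OF O(1) O(1), of d n] red_ops(3)[OF O(1) O(1)] by (simp add: n)
  then show ?thesis by (auto simp: primefield_def)
qed

lemma subfield_primefield: "subfield primefield resfield"
proof (rule ring.subfieldI[OF ring_resfield])
  have R: "ring (int_ring L)" using cring_int_ring[OF L] by (rule cring.axioms)
  have minus: "\<ominus>\<^bsub>int_ring L\<^esub> y = - y" if "y \<in> oint L" for y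
    using abelian_group.minus_equality[OF ring.is_abelian_group[OF R], of "- y" y] that O(7) by simp
  have ints: "x \<in> oint L" if "x \<in> \<int>" for x using that O(1) by (auto elim: Ints_cases)
  have "subring \<int> (int_ring L)"
    by (rule ring.subringI[OF R]) (auto simp: minus ints)
  then have "subring primefield resfield"
    unfolding primefield_def by (rule ring_hom_ring.img_is_subring[OF hom_red])
  then show sc: "subcring primefield resfield" by (rule cring.subcringI'[OF cring_resfield])
  have sub: "primefield \<subseteq> carrier resfield" unfolding carrier_resfield primefield_def using ints by blast
  interpret k: domain resfield by (rule domain_resfield)
  show "Units (resfield\<lparr>carrier := primefield\<rparr>) = primefield - {\<zero>\<^bsub>resfield\<^esub>}"
  proof
    show "Units (resfield\<lparr>carrier := primefield\<rparr>) \<subseteq> primefield - {\<zero>\<^bsub>resfield\<^esub>}"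
      using sub k.one_not_zero by (auto simp: Units_def subset_iff)
    show "primefield - {\<zero>\<^bsub>resfield\<^esub>} \<subseteq> Units (resfield\<lparr>carrier := primefield\<rparr>)"
    proof
      fix a assume a: "a \<in> primefield - {\<zero>\<^bsub>resfield\<^esub>}"
      then obtain b where b: "b \<in> primefield" "b \<otimes>\<^bsub>resfield\<^esub> a = \<one>\<^bsub>resfield\<^esub>" using primefield_inverse by blast
      have "a \<otimes>\<^bsub>resfield\<^esub> b = \<one>\<^bsub>resfield\<^esub>" using k.m_comm[of a b] a b sub by auto
      then show "a \<in> Units (resfield\<lparr>carrier := primefield\<rparr>)" using a b by (auto simp: Units_def)
    qed
  qed
qed

lemma residue_degree_eq:
  "residue_degree L P = (if ring.finite_dimension resfield primefield (carrier resfield)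
     then enat (ring.dim resfield primefield (carrier resfield)) else \<infinity>)"
  unfolding residue_degree_def resfield_def primefield_def red_def[abs_def] by (simp add: Let_def)

lemma residue_degree_eq_1:
  assumes all: "\<And>x. x \<in> oint L \<Longrightarrow> \<exists>n. x - of_int n \<in> P"
  shows "residue_degree L P = 1"
proof -
  have "carrier resfield = primefield"
  proof
    show "carrier resfield \<subseteq> primefield"
    proof
      fix a assume "a \<in> carrier resfield"
      then obtain x where x: "x \<in> oint L" "a = red x" by (auto simp: carrier_resfield)
      obtain n where "x - of_int n \<in> P" using all[OF x(1)] by blast
      then have "a = red (of_int n)" using red_eq_iff[OF x(1) O(1)] x by simp
      then show "a \<in> primefield" by (auto simp: primefield_def)
    qed
    show "primefield \<subseteq> carrier resfield"
      using subfieldE(3)[OF subfield_primefield] .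
  qed
  moreover have "ring.dimension resfield 1 primefield primefield"
    by (rule ring.dimension_one[OF ring_resfield subfield_primefield])
  ultimately have dim: "ring.dimension resfield 1 primefield (carrier resfield)" by simp
  then show ?thesis
    using ring.finite_dimensionI[OF ring_resfield dim] ring.dimI[OF ring_resfield subfield_primefield dim]
    by (simp add: residue_degree_eq over_def one_enat_def)
qed

text \<open>Dimension 0 would make 1 = 0. In dimension 1 with basis v, the equation 1 = c v puts v,
  and then every residue class, into the prime field, contrary to the choice of x. An infinite
  degree satisfies the bound as well.\<close>

lemma residue_degree_ge_2:
  assumes x: "x \<in> oint L" "\<And>n. x - of_int n \<notin> P"
  shows "residue_degree L P \<ge> 2"
proof (cases "ring.finite_dimension resfield primefield (carrier resfield)")
  case True
  interpret k: domain resfield by (rule domain_resfield)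
  define n where "n = ring.dim resfield primefield (carrier resfield)"
  have dim: "ring.dimension resfield n primefield (carrier resfield)"
    using ring.finite_dimensionE[OF ring_resfield subfield_primefield True] by (simp add: n_def over_def)
  have n0: "n \<noteq> 0"
  proof
    assume "n = 0"
    then have "carrier resfield = {\<zero>\<^bsub>resfield\<^esub>}" using k.dimension_zero[OF subfield_primefield] dim by simp
    then show False using k.one_closed k.one_not_zero by auto
  qed
  have n1: "n \<noteq> 1"
  proof
    assume "n = 1"
    then have d1: "k.dimension (Suc 0) primefield (carrier resfield)" using dim by simp
    have "\<exists>v E. v \<in> carrier resfield \<and> k.dimension 0 primefield E \<and>
        carrier resfield = k.line_extension primefield v E"
    proof (rule k.dimension.cases[OF d1])
      show ?thesis if "Suc 0 = 0" using that by simp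
      fix v E m K
      assume *: "Suc 0 = Suc m" "primefield = K" "carrier resfield = k.line_extension K v E"
        "v \<in> carrier resfield" "k.dimension m K E"
      have "m = 0" using *(1) by simp
      show ?thesis using *(3-5) unfolding *(2) \<open>m = 0\<close> by blast
    qed
    then obtain v E where v: "v \<in> carrier resfield" "k.dimension 0 primefield E"
      "carrier resfield = k.line_extension primefield v E" by blast
    have E: "E = {\<zero>\<^bsub>resfield\<^esub>}" using k.dimension_zero[OF subfield_primefield v(2)] .
    note F = subringE[OF subfieldE(1)[OF subfield_primefield]]
    have elt: "\<exists>c\<in>primefield. a = c \<otimes>\<^bsub>resfield\<^esub> v" if a: "a \<in> carrier resfield" for a
    proof -
      have "a \<in> k.line_extension primefield v {\<zero>\<^bsub>resfield\<^esub>}" using a v(3) E by simp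
      then obtain c where c: "c \<in> primefield" "a = c \<otimes>\<^bsub>resfield\<^esub> v \<oplus>\<^bsub>resfield\<^esub> \<zero>\<^bsub>resfield\<^esub>"
        unfolding k.line_extension_mem_iff by blast
      have "c \<otimes>\<^bsub>resfield\<^esub> v \<in> carrier resfield"
        by (rule k.m_closed[OF subsetD[OF F(1) c(1)] v(1)])
      then have "a = c \<otimes>\<^bsub>resfield\<^esub> v" using c(2) by simp
      then show ?thesis using c(1) by blast
    qed
    obtain c where c: "c \<in> primefield" "\<one>\<^bsub>resfield\<^esub> = c \<otimes>\<^bsub>resfield\<^esub> v" using elt[OF k.one_closed] by blast
    have cc: "c \<in> carrier resfield" by (rule subsetD[OF F(1) c(1)])
    have "c \<noteq> \<zero>\<^bsub>resfield\<^esub>" using c(2) k.l_null[OF v(1)] k.one_not_zero by metis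
    then obtain b where b: "b \<in> primefield" "b \<otimes>\<^bsub>resfield\<^esub> c = \<one>\<^bsub>resfield\<^esub>" using primefield_inverse[OF c(1)] by blast
    have bc: "b \<in> carrier resfield" by (rule subsetD[OF F(1) b(1)])
    have "b = b \<otimes>\<^bsub>resfield\<^esub> (c \<otimes>\<^bsub>resfield\<^esub> v)" using k.r_one[OF bc] unfolding c(2) by simp
    also have "\<dots> = v" using k.m_assoc[OF bc cc v(1)] b(2) v(1) by simp
    finally have vF: "v \<in> primefield" using b(1) by simp
    have "red x \<in> carrier resfield" using x(1) by (simp add: carrier_resfield)
    then obtain e where "e \<in> primefield" "red x = e \<otimes>\<^bsub>resfield\<^esub> v" using elt by blast
    then have "red x \<in> primefield" using F(6) vF by simp
    then obtain m where "red x = red (of_int m)" by (auto simp: primefield_def elim: Ints_cases)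
    then show False using red_eq_iff[OF x(1) O(1)] x(2) by blast
  qed
  have "2 \<le> n" using n0 n1 by linarith
  then have "2 \<le> enat n" by (simp add: numeral_eq_enat)
  then show ?thesis using True by (simp add: residue_degree_eq n_def)
qed (simp add: residue_degree_eq)

text \<open>If the root x were congruent to a rational integer n, then n^2 would be congruent to d
  modulo p.\<close>

lemma residue_degree_ge_2_sqrt:
  assumes x: "x \<in> oint L" "x ^ 2 = of_int d" and d: "Legendre d (int p) = -1"
  shows "residue_degree L P \<ge> 2"
proof (rule residue_degree_ge_2[OF x(1)])
  fix n
  show "x - of_int n \<notin> P"
  proof
    assume "x - of_int n \<in> P"
    then have "(x + of_int n) * (x - of_int n) \<in> P" using x(1) O(1,5) by (intro P_mult) auto
    also have "(x + of_int n) * (x - of_int n) = of_int (d - n ^ 2)"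
      using x(2) by (simp add: algebra_simps power2_eq_square)
    finally have "int p dvd d - n ^ 2" by (simp only: P_of_int_iff)
    then have "QuadRes (int p) d" unfolding QuadRes_def
      by (intro exI[of _ n]) (simp add: cong_iff_dvd_diff dvd_diff_commute)
    then show False using d by (auto simp: Legendre_def split: if_splits)
  qed
qed

end

section \<open>The sum over all primes\<close>

lemma prime_over_chosen:
  assumes "prime p" "csubfield L"
  shows "prime_over p L (chosen_prime p L)"
proof
  show "prime_above p L (chosen_prime p L)"
    unfolding chosen_prime_def by (rule someI_ex) (rule prime_above_exists[OF assms])
qed (use assms in auto)

lemma S_at_nonneg: "prime p \<Longrightarrow> 0 \<le> S_at p L"
  using prime_gt_0_nat[of p] by (auto simp: S_at_def)

lemma quad_field_approx:
  assumes pp: "prime p" "odd p" and leg: "\<And>d. d \<in> D \<Longrightarrow> Legendre d (int p) = 1"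
    and P: "prime_over p (quad_field D) P" and x: "x \<in> oint (quad_field D)"
  shows "\<exists>n. prime_over.approx p (quad_field D) P x n"
proof -
  interpret prime_over p "quad_field D" P by (rule P)
  obtain F where F: "F \<subseteq> D" "finite F" "x \<in> quad_field F"
    using quad_field_finite_subset[of x D] x by (auto simp: oint_def)
  have "Legendre d (int p) = 1" if "d \<in> F" for d using leg F that by blast
  then show ?thesis
    using approx_quad_field[OF F(2) pp(2) quad_field_mono[OF F(1)] _ F(3)] x by (simp add: oint_def)
qed

lemma S_at_split:
  assumes pp: "prime p" "odd p" and leg: "\<And>d. d \<in> D \<Longrightarrow> Legendre d (int p) = 1"
  shows "S_at p (quad_field D) = ln (real p) / (real p + 1)"
proof -
  define P where "P = chosen_prime p (quad_field D)"
  have P: "prime_over p (quad_field D) P"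
    unfolding P_def by (rule prime_over_chosen[OF pp(1) csubfield_quad_field])
  interpret prime_over p "quad_field D" P by (rule P)
  have all: "\<exists>n. approx x n" if "x \<in> oint (quad_field D)" for x
    by (rule quad_field_approx[OF pp leg P that])
  have "e_at p (quad_field D) = 1"
    unfolding e_at_def P_def[symmetric] by (rule ramification_index_eq_1[OF all])
  moreover have "f_at p (quad_field D) = 1"
    unfolding f_at_def P_def[symmetric]
    by (rule residue_degree_eq_1) (use all approx_imp_diff in blast)
  ultimately show ?thesis by (simp add: S_at_def one_enat_def)
qed

text \<open>Residue degree at least 2 already gives p^2 \<le> e (p^f + 1) for every finite e \<ge>
  1, so the ramification index need not be computed.\<close>

lemma S_at_nonresidue_le:
  assumes p: "prime p" and d: "d \<in> D" "Legendre d (int p) = -1"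
  shows "S_at p (quad_field D) \<le> ln (real p) / real p ^ 2"
proof -
  define P where "P = chosen_prime p (quad_field D)"
  have P: "prime_over p (quad_field D) P"
    unfolding P_def by (rule prime_over_chosen[OF p csubfield_quad_field])
  interpret prime_over p "quad_field D" P by (rule P)
  have "csqrt (of_int d) \<in> oint (quad_field D)"
    using csqrt_in_quad_field[OF d(1)] by (auto simp: oint_def)
  then have "residue_degree (quad_field D) P \<ge> 2"
    by (rule residue_degree_ge_2_sqrt) (use d in auto)
  then have f: "f_at p (quad_field D) \<ge> 2" by (simp add: f_at_def P_def)
  have p1: "1 < real p" using prime_gt_1_nat[OF p] by simp
  show ?thesis
  proof (cases "e_at p (quad_field D) = \<infinity> \<or> f_at p (quad_field D) = \<infinity>")
    case True
    then show ?thesis using p1 by (simp add: S_at_def)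
  next
    case False
    then obtain e f' where ef: "e_at p (quad_field D) = enat e" "f_at p (quad_field D) = enat f'"
      unfolding de_Morgan_disj not_infinity_eq by blast
    have f2: "2 \<le> f'" using f unfolding ef by (simp add: numeral_eq_enat)
    show ?thesis
    \<comment> \<open>For e = 0 the quotient is 0 by the convention for division by zero, so a
      separate proof of e \<ge> 1 is avoided.\<close>
    proof (cases "e = 0")
      case True
      then show ?thesis using p1 ef by (simp add: S_at_def)
    next
      case False
      have "real p ^ 2 \<le> real p ^ f'" using p1 f2 by (intro power_increasing) auto
      also have "\<dots> \<le> 1 * (real p ^ f' + 1)" by simp
      also have "\<dots> \<le> real e * (real p ^ f' + 1)" using False by (intro mult_right_mono) auto
      finally have "ln (real p) / (real e * (real p ^ f' + 1)) \<le> ln (real p) / real p ^ 2"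
        using p1 False by (intro divide_left_mono mult_pos_pos add_nonneg_pos) auto
      then show ?thesis by (simp add: S_at_def ef)
    qed
  qed
qed

lemma S_sum_infinite:
  assumes "\<And>C. \<exists>F. finite F \<and> (\<forall>p\<in>F. prime p) \<and> C < (\<Sum>p\<in>F. S_at p L)"
  shows "S_sum L = \<infinity>"
proof (rule ccontr)
  assume fin: "S_sum L \<noteq> \<infinity>"
  have eq: "S_sum L = (SUP F\<in>{F. finite F \<and> F \<subseteq> {p. prime p}}. \<Sum>p\<in>F. ennreal (S_at p L))"
    unfolding S_sum_def by (rule nonneg_infsum_complete) simp
  obtain F where F: "finite F" "\<forall>p\<in>F. prime p" "enn2real (S_sum L) < (\<Sum>p\<in>F. S_at p L)"
    using assms[of "enn2real (S_sum L)"] by blast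
  have "(\<Sum>p\<in>F. ennreal (S_at p L)) \<le> S_sum L"
    unfolding eq by (rule SUP_upper) (use F in auto)
  moreover have "(\<Sum>p\<in>F. ennreal (S_at p L)) = ennreal (\<Sum>p\<in>F. S_at p L)"
    using F(2) by (intro sum_ennreal) (auto intro: S_at_nonneg)
  ultimately have "ennreal (\<Sum>p\<in>F. S_at p L) \<le> ennreal (enn2real (S_sum L))"
    using fin by (simp add: ennreal_enn2real_if)
  then have "(\<Sum>p\<in>F. S_at p L) \<le> enn2real (S_sum L)"
    by (simp add: ennreal_le_iff)
  then show False using F(3) by simp
qed

text \<open>The term at 2 is kept as it stands: being a single real number it cannot affect
  convergence, and the behaviour at 2 is never analysed.\<close>

lemma S_sum_finite:
  assumes bound: "\<And>p. prime p \<Longrightarrow> p \<noteq> 2 \<Longrightarrow> S_at p L \<le> ln (real p) / real p ^ 2"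
  shows "S_sum L < \<infinity>"
proof -
  define g where "g = (\<lambda>n. ln (real n) / real n ^ 2)"
  have g: "summable g" unfolding g_def by (rule summable_ln_over_square)
  have g0: "0 \<le> g n" for n by (cases "n = 0") (auto simp: g_def)
  have "S_sum L \<le> ennreal (suminf g + S_at 2 L)"
    unfolding S_sum_def
  proof (subst nonneg_infsum_complete, simp, rule SUP_least)
    fix F assume "F \<in> {F. finite F \<and> F \<subseteq> {p. prime (p::nat)}}"
    then have F: "finite F" "\<And>p. p \<in> F \<Longrightarrow> prime p" by auto
    have "(\<Sum>p\<in>F. S_at p L) \<le> (\<Sum>p\<in>F. g p + (if p = 2 then S_at 2 L else 0))"
    proof (rule sum_mono)
      fix p assume "p \<in> F"
      then show "S_at p L \<le> g p + (if p = 2 then S_at 2 L else 0)"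
        using bound[of p] F(2)[of p] g0[of p] by (auto simp: g_def)
    qed
    also have "\<dots> = (\<Sum>p\<in>F. g p) + (\<Sum>p\<in>F. if p = 2 then S_at 2 L else 0)"
      by (rule sum.distrib)
    also have "\<dots> \<le> suminf g + S_at 2 L"
      using sum_le_suminf[OF g F(1)] g0 S_at_nonneg[of 2 L] F(1) by (intro add_mono) (auto simp: sum.delta)
    finally have "(\<Sum>p\<in>F. S_at p L) \<le> suminf g + S_at 2 L" .
    moreover have "(\<Sum>p\<in>F. ennreal (S_at p L)) = ennreal (\<Sum>p\<in>F. S_at p L)"
      using F(2) by (intro sum_ennreal) (auto intro: S_at_nonneg)
    ultimately show "(\<Sum>p\<in>F. ennreal (S_at p L)) \<le> ennreal (suminf g + S_at 2 L)"
      by (simp add: ennreal_leI)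
  qed
  then show ?thesis using ennreal_less_top[of "suminf g + S_at 2 L"] by (metis infinity_ennreal_def le_less_trans)
qed

text \<open>At a prime above q the field has residue degree 1, whereas a root of a nonresidue would
  force degree at least 2.\<close>

lemma csqrt_notin_quad_field:
  assumes q: "prime q" "odd q" and D: "\<And>e. e \<in> D \<Longrightarrow> Legendre e (int q) = 1" and d: "Legendre d (int q) = -1"
  shows "csqrt (of_int d) \<notin> quad_field D"
proof
  assume d_in: "csqrt (of_int d) \<in> quad_field D"
  define P where "P = chosen_prime q (quad_field D)"
  have P: "prime_over q (quad_field D) P"
    unfolding P_def by (rule prime_over_chosen[OF q(1) csubfield_quad_field])
  interpret prime_over q "quad_field D" P by (rule P)
  have dO: "csqrt (of_int d) \<in> oint (quad_field D)" using d_in by (auto simp: oint_def)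
  have "residue_degree (quad_field D) P \<ge> 2"
    by (rule residue_degree_ge_2_sqrt[OF dO]) (use d in auto)
  moreover have "residue_degree (quad_field D) P = 1"
    by (rule residue_degree_eq_1) (use quad_field_approx[OF q D P] approx_imp_diff in blast)
  ultimately show False by simp
qed

text \<open>The roots are linearly independent over the rationals: each lies outside the field of
  its predecessors, which contains their span. The list is reversed because independence grows at
  the head; n + 1 roots contradict dimension n.\<close>

lemma quad_field_infinite:
  fixes d :: "nat \<Rightarrow> int"
  assumes "\<And>k. csqrt (of_int (d k)) \<notin> quad_field (d ` {..<k})"
  shows "\<not> ring.finite_dimension CC \<rat> (quad_field (range d))"
proof
  define s where "s = (\<lambda>k. csqrt (of_int (d k)))"
  assume "ring.finite_dimension CC \<rat> (quad_field (range d))"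
  then obtain n where n: "ring.dimension CC n \<rat> (quad_field (range d))"
    unfolding ring.finite_dimension_def[OF ring_CC] by blast
  have Q: "subfield \<rat> CC" by (simp add: subfield_CC_iff csubfield_def)
  have "ring.independent CC \<rat> (map s (rev [0..<k])) \<and> ring.Span CC \<rat> (map s (rev [0..<k])) \<subseteq> quad_field (d ` {..<k})" for k
  proof (induction k)
    case 0
    show ?case
      using ring.independent.li_Nil[OF ring_CC] csubfieldD(2)[OF csubfield_quad_field]
      by (simp add: ring.Span.simps[OF ring_CC])
  next
    case (Suc k)
    have sk: "s k \<notin> quad_field (d ` {..<k})" unfolding s_def by (rule assms)
    have "ring.independent CC \<rat> (s k # map s (rev [0..<k]))"
      using Suc sk by (intro ring.independent.li_Cons[OF ring_CC]) auto
    moreover have "ring.Span CC \<rat> (s k # map s (rev [0..<k])) \<subseteq> quad_field (d ` {..<Suc k})"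
    proof
      fix u assume "u \<in> ring.Span CC \<rat> (s k # map s (rev [0..<k]))"
      then have "u \<in> ring.line_extension CC \<rat> (s k) (ring.Span CC \<rat> (map s (rev [0..<k])))"
        by (simp add: ring.Span.simps[OF ring_CC])
      then obtain c v where u: "c \<in> \<rat>" "v \<in> ring.Span CC \<rat> (map s (rev [0..<k]))" "u = c * s k + v"
        unfolding ring.line_extension_mem_iff[OF ring_CC] by auto
      note QD = csubfieldD[OF csubfield_quad_field[of "d ` {..<Suc k}"]]
      have "c \<in> quad_field (d ` {..<Suc k})" using u(1) csubfield_Rats[OF csubfield_quad_field] by blast
      moreover have "s k \<in> quad_field (d ` {..<Suc k})" unfolding s_def by (rule csqrt_in_quad_field) simp
      moreover have "v \<in> quad_field (d ` {..<Suc k})"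
        using u(2) Suc quad_field_mono[OF image_mono[of "{..<k}" "{..<Suc k}" d]] by auto
      ultimately show "u \<in> quad_field (d ` {..<Suc k})" unfolding u(3) by (intro QD(3,4))
    qed
    ultimately show ?case by simp
  qed
  then have "ring.independent CC \<rat> (map s (rev [0..<Suc n]))" by blast
  moreover have "set (map s (rev [0..<Suc n])) \<subseteq> quad_field (range d)"
    by (auto simp: s_def intro: csqrt_in_quad_field)
  ultimately have "length (map s (rev [0..<Suc n])) \<le> n"
    by (rule ring.independent_length_le_dimension[OF ring_CC Q n])
  then show False by simp
qed

lemma quad_field_adjoin_i: "generate_field CC (insert \<i> (quad_field D)) = quad_field (insert (-1) D)"
proof
  have G: "csubfield (generate_field CC (insert \<i> (quad_field D)))"
    unfolding subfield_CC_iff[symmetric] by (rule field.generate_field_is_subfield[OF field_CC]) auto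
  have i: "csqrt (of_int (-1)) = \<i>" by simp
  show "generate_field CC (insert \<i> (quad_field D)) \<subseteq> quad_field (insert (-1) D)"
  proof (rule field.generate_field_min_subfield1[OF field_CC])
    show "insert \<i> (quad_field D) \<subseteq> quad_field (insert (-1) D)"
      using csqrt_in_quad_field[of "-1" "insert (-1) D"] quad_field_mono[of D "insert (-1) D"] unfolding i by auto
  qed (auto simp: subfield_CC_iff csubfield_quad_field)
  show "quad_field (insert (-1) D) \<subseteq> generate_field CC (insert \<i> (quad_field D))"
  proof (rule quad_field_minimal[OF G])
    fix d assume "d \<in> insert (-1) D"
    then show "csqrt (of_int d) \<in> generate_field CC (insert \<i> (quad_field D))"
      using i csqrt_in_quad_field[of d D] by (auto intro!: generate_field.incl)
  qed
qed

lemma finite_extension_quad_field_insert: "finite_extension (quad_field D) (quad_field (insert d D))"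
proof -
  define K s where "K = quad_field D" and "s = csqrt (of_int d)"
  have K: "csubfield K" by (simp add: K_def csubfield_quad_field)
  then have Ks: "subfield K CC" by (simp add: subfield_CC_iff)
  have "ring.Span CC K [1, s] = adjoin K s"
  proof (rule Set.set_eqI)
    fix u
    have "u \<in> ring.Span CC K [1, s] \<longleftrightarrow> (\<exists>a\<in>K. \<exists>b\<in>K. u = a + b * s)"
      by (simp add: ring.Span.simps[OF ring_CC] ring.line_extension_mem_iff[OF ring_CC] Bex_def) blast
    then show "u \<in> ring.Span CC K [1, s] \<longleftrightarrow> u \<in> adjoin K s"
      unfolding adjoin_def by blast
  qed
  moreover have "ring.finite_dimension CC K (ring.Span CC K [1, s])"
    by (rule ring.Span_finite_dimension[OF ring_CC Ks]) auto
  ultimately have "ring.finite_dimension CC K (quad_field (insert d D))"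
    unfolding quad_field_insert K_def s_def by simp
  then show ?thesis
    unfolding finite_extension_def K_def using quad_field_mono[of D "insert d D"]
    by (auto simp: subfield_CC_iff csubfield_quad_field)
qed

theorem theorem1p3:
  shows "(\<exists>L. galois_over_rat L \<and> \<not> ring.finite_dimension CC \<rat> L \<and> totally_real L \<and>
            S_sum L = \<infinity> \<and> S_sum (generate_field CC (insert \<i> L)) < \<infinity>) \<and>
         (\<exists>L F. property_S L \<and> finite_extension L F \<and> galois_over_rat F \<and> \<not> property_S F)"
proof -
  obtain d :: "nat \<Rightarrow> nat" where
    d1: "\<And>k. \<exists>q\<in>split_primes (d ` {..<k}). Legendre (int (d k)) (int q) = -1" and
    d2: "\<And>p. prime p \<Longrightarrow> p mod 4 = 1 \<Longrightarrow> \<exists>k. Legendre (int (d k)) (int p) = -1" and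
    d3: "\<And>C. \<exists>N. C < (\<Sum>p | p \<in> split_primes (range d) \<and> p \<le> N. ln (real p) / (real p + 1))"
    using radicands_exist by blast
  define D where "D = range (\<lambda>k. int (d k))"
  define L where "L = quad_field D"
  define F where "F = quad_field (insert (-1) D)"
  have galL: "galois_over_rat L" and galF: "galois_over_rat F"
    by (simp_all add: L_def F_def galois_quad_field)
  have real: "totally_real L"
    unfolding L_def by (rule totally_real_quad_field) (auto simp: D_def)
  have inf: "\<not> ring.finite_dimension CC \<rat> L"
    unfolding L_def D_def
  proof (rule quad_field_infinite)
    fix k
    obtain q where q: "q \<in> split_primes (d ` {..<k})" "Legendre (int (d k)) (int q) = -1" using d1 by blast
    show "csqrt (of_int (int (d k))) \<notin> quad_field ((\<lambda>k. int (d k)) ` {..<k})"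
      by (rule csqrt_notin_quad_field[of q]) (use split_primesD[OF q(1)] q(2) in auto)
  qed
  have sumL: "S_sum L = \<infinity>"
  proof (rule S_sum_infinite)
    fix C
    obtain N where N: "C < (\<Sum>p | p \<in> split_primes (range d) \<and> p \<le> N. ln (real p) / (real p + 1))" using d3 by blast
    also have "\<dots> = (\<Sum>p | p \<in> split_primes (range d) \<and> p \<le> N. S_at p L)"
      unfolding L_def
    proof (intro sum.cong refl S_at_split[symmetric])
      fix p e assume "p \<in> {p. p \<in> split_primes (range d) \<and> p \<le> N}"
      then have p: "p \<in> split_primes (range d)" by simp
      show "prime p" "odd p" using split_primesD[OF p] by auto
      assume "e \<in> D"
      then show "Legendre e (int p) = 1" using split_primesD(4)[OF p] by (auto simp: D_def)
    qed
    finally show "\<exists>F. finite F \<and> (\<forall>p\<in>F. prime p) \<and> C < (\<Sum>p\<in>F. S_at p L)"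
      using split_primesD(1) by (intro exI[of _ "{p. p \<in> split_primes (range d) \<and> p \<le> N}"]) auto
  qed
  have sumF: "S_sum F < \<infinity>"
  proof (rule S_sum_finite)
    fix p :: nat assume p: "prime p" "p \<noteq> 2"
    then have p2: "2 < p" using prime_ge_2_nat[of p] by simp
    then have "odd p" using prime_odd_nat[OF p(1)] by simp
    then have "p mod 4 = 1 \<or> p mod 4 = 3" by presburger
    then consider "p mod 4 = 1" | "p mod 4 = 3" by blast
    then show "S_at p F \<le> ln (real p) / real p ^ 2"
    proof cases
      case 1
      then obtain k where "Legendre (int (d k)) (int p) = -1" using d2 p(1) by blast
      then show ?thesis unfolding F_def by (intro S_at_nonresidue_le[OF p(1)]) (auto simp: D_def)
    next
      case 2
      then have "Legendre (-1) (int p) = -1" using Legendre_minus_1[OF p(1) p2] by (simp add: chi4_def)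
      then show ?thesis unfolding F_def by (intro S_at_nonresidue_le[OF p(1), of "-1"]) auto
    qed
  qed
  \<comment> \<open>Since L(i) is \<open>F\<close>, the same pair of fields witnesses both halves of
    the statement.\<close>
  have Fi: "generate_field CC (insert \<i> L) = F"
    unfolding L_def F_def by (rule quad_field_adjoin_i)
  have "finite_extension L F" unfolding L_def F_def by (rule finite_extension_quad_field_insert)
  moreover have "\<not> property_S F" using sumF by (auto simp: property_S_def)
  moreover have "property_S L" using galL sumL by (simp add: property_S_def)
  ultimately show ?thesis using galL galF real inf sumL sumF unfolding Fi[symmetric] by blast
qed

end
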